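(* Let $f:\mathbb R^{n+1}\to\mathbb R$ be smooth and let $\Sigma\subset\mathbb R^{n+1}$ be a two-sided, smooth, properly immersed hypersurface with unit normal $N$ such that $\delta\mathcal A_f(u)=0$ for all $u\in C_0^\infty(\Sigma)$ with $\int_\Sigma u\,d\mathcal A_f=0$. Then for any $u=\langle\partial_tF(0,x),N(x)\rangle$ representing a compact normal variation $F$ of $\Sigma$ that preserves $\mathcal V_f$, we have $$\delta^2\mathcal A_f(\Sigma)(u)=-\int_\Sigma u\left(\triangle u+|A|^2u-\operatorname{Hess}_f(N,N)\,u+\langle\nabla f,\nabla u\rangle\right)d\mathcal A_f.$$
   Context: $d\mathcal A$ is the $n$-dimensional area measure on $\Sigma$ and $d\mathcal A_f=e^f\,d\mathcal A$. $A(X,Y)=\langle\nabla_XN,Y\rangle$ is the second fundamental form of $\Sigma$, $|A|$ its norm; $\triangle u$ and $\nabla u$ are the Laplacian and gradient of $u$ in the induced metric on $\Sigma$; $\nabla f$ and $\operatorname{Hess}_f$ are the Euclidean gradient and Hessian of $f$. A compact normal variation of $\Sigma$ is a smooth map $F:(-\epsilon,\epsilon)\times\Sigma\to\mathbb R^{n+1}$ with $F(0,\cdot)$ the given immersion, $F(t,\cdot)$ independent of $t$ outside a compact set, and $\partial_tF$ normal to $\Sigma_t=F(t,\Sigma)$ for all $t$. It preserves $\mathcal V_f$ if $\int_{\Sigma_t}\langle\partial_tF,N\rangle\,d\mathcal A_f=0$ for all $t$ ($N$ the unit normal of $\Sigma_t$); in particular $\int_\Sigma u\,d\mathcal A_f=0$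 for $u=\langle\partial_tF(0,\cdot),N\rangle$. The first variation $\delta\mathcal A_f(u)$ is the derivative $\frac{d}{dt}\big|_{t=0}\mathcal A_f(\Sigma_t)$ for a compact normal variation with $\langle\partial_tF(0,\cdot),N\rangle=u$ (it depends only on $u$), and $\delta^2\mathcal A_f(\Sigma)(u)=\frac{d^2}{dt^2}\big|_{t=0}\mathcal A_f(\Sigma_t)$ for the given $\mathcal V_f$-preserving normal variation $F$ representing $u$ (weighted areas computed on the compact set where $F$ varies). *)

theory Defs
  imports "HOL-Analysis.Analysis"
begin

section \<open>Smooth manifolds and smooth maps\<close>

text \<open>Smoothness on an \<^emph>\<open>open\<close> set: all iterated directional derivatives exist and are continuous.\<close>

primrec Ck_on :: "nat \<Rightarrow> 'a::real_normed_vector set \<Rightarrow> ('a \<Rightarrow> 'b::real_normed_vector) \<Rightarrow> bool" where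
  "Ck_on 0 S h \<longleftrightarrow> continuous_on S h"
| "Ck_on (Suc k) S h \<longleftrightarrow> (\<forall>x\<in>S. h differentiable (at x)) \<and>
     (\<forall>v. Ck_on k S (\<lambda>x. frechet_derivative h (at x) v))"

definition smooth_on :: "'a::real_normed_vector set \<Rightarrow> ('a \<Rightarrow> 'b::real_normed_vector) \<Rightarrow> bool" where
  "smooth_on S h \<longleftrightarrow> (\<forall>k. Ck_on k S h)"

text \<open>An atlas consists of local parametrizations \<open>\<psi> : V \<rightarrow> M\<close> with \<open>V\<close> open in \<open>real^'n\<close>.
  The manifold is the whole type \<open>'m\<close>; Hausdorffness and second countability are imposed by the
  type classes of \<open>'m\<close>.\<close>

type_synonym ('n, 'm) param = "(real^'n) set \<times> (real^'n \<Rightarrow> 'm)"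

definition smooth_atlas :: "('n::finite, 'm::{t2_space,second_countable_topology}) param set \<Rightarrow> bool" where
  "smooth_atlas \<A> \<longleftrightarrow>
     (\<forall>(V,\<psi>)\<in>\<A>. open V \<and> open (\<psi> ` V) \<and> (\<exists>\<phi>. homeomorphism V (\<psi> ` V) \<psi> \<phi>)) \<and>
     (\<Union>(V,\<psi>)\<in>\<A>. \<psi> ` V) = UNIV \<and>
     (\<forall>(V,\<psi>)\<in>\<A>. \<forall>(W,\<xi>)\<in>\<A>. smooth_on (V \<inter> \<psi> -` (\<xi> ` W)) (inv_into W \<xi> \<circ> \<psi>))"

definition smooth_map :: "('n::finite, 'm) param set \<Rightarrow> ('m \<Rightarrow> 'b::real_normed_vector) \<Rightarrow> bool" where
  "smooth_map \<A> h \<longleftrightarrow> (\<forall>(V,\<psi>)\<in>\<A>. smooth_on V (h \<circ> \<psi>))"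

definition smooth_family ::
  "('n::finite, 'm) param set \<Rightarrow> real set \<Rightarrow> (real \<Rightarrow> 'm \<Rightarrow> 'b::real_normed_vector) \<Rightarrow> bool" where
  "smooth_family \<A> I F \<longleftrightarrow> (\<forall>(V,\<psi>)\<in>\<A>. smooth_on (I \<times> V) (\<lambda>(t,y). F t (\<psi> y)))"

definition chart_at :: "('n::finite, 'm) param set \<Rightarrow> 'm \<Rightarrow> ('n, 'm) param" where
  "chart_at \<A> x = (SOME (V,\<psi>). (V,\<psi>) \<in> \<A> \<and> x \<in> \<psi> ` V)"

text \<open>The differential of \<open>h\<close> at \<open>x\<close> read in the chosen chart around \<open>x\<close>. Its range, its injectivity
  and \<open>tderiv\<close> below do not depend on the chart.\<close>

definition chart_diff ::
  "('n::finite, 'm) param set \<Rightarrow> ('m \<Rightarrow> 'b::real_normed_vector) \<Rightarrow> 'm \<Rightarrow> real^'n \<Rightarrow> 'b" where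
  "chart_diff \<A> h x =
     (case chart_at \<A> x of (V,\<psi>) \<Rightarrow> frechet_derivative (h \<circ> \<psi>) (at (inv_into V \<psi> x)))"


section \<open>Immersed hypersurfaces\<close>

definition immersion :: "('n::finite, 'm) param set \<Rightarrow> ('m \<Rightarrow> 'e::euclidean_space) \<Rightarrow> bool" where
  "immersion \<A> X \<longleftrightarrow> smooth_map \<A> X \<and> (\<forall>x. inj (chart_diff \<A> X x))"

definition proper_immersion ::
  "('n::finite, 'm::topological_space) param set \<Rightarrow> ('m \<Rightarrow> 'e::euclidean_space) \<Rightarrow> bool" where
  "proper_immersion \<A> X \<longleftrightarrow> immersion \<A> X \<and> (\<forall>C. compact C \<longrightarrow> compact (X -` C))"

definition tangent_space :: "('n::finite, 'm) param set \<Rightarrow> ('m \<Rightarrow> 'e::euclidean_space) \<Rightarrow> 'm \<Rightarrow> 'e set" where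
  "tangent_space \<A> X x = range (chart_diff \<A> X x)"

text \<open>Pointwise condition; smoothness of the field is required separately.\<close>

definition unit_normal_field ::
  "('n::finite, 'm) param set \<Rightarrow> ('m \<Rightarrow> 'e::euclidean_space) \<Rightarrow> ('m \<Rightarrow> 'e) \<Rightarrow> bool" where
  "unit_normal_field \<A> X N \<longleftrightarrow>
     (\<forall>x. norm (N x) = 1 \<and> (\<forall>e\<in>tangent_space \<A> X x. N x \<bullet> e = 0))"

text \<open>Derivative of \<open>h\<close> at \<open>x\<close> in the direction of the tangent vector \<open>e\<close>, where tangent vectors are
  regarded as elements of the ambient Euclidean space through the differential of \<open>X\<close>.\<close>

definition tderiv ::
  "('n::finite, 'm) param set \<Rightarrow> ('m \<Rightarrow> 'e::euclidean_space) \<Rightarrow> ('m \<Rightarrow> 'b::real_normed_vector) \<Rightarrow>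
   'm \<Rightarrow> 'e \<Rightarrow> 'b" where
  "tderiv \<A> X h x e = chart_diff \<A> h x (inv (chart_diff \<A> X x) e)"

definition orthonormal_basis :: "'e::euclidean_space set \<Rightarrow> 'e set \<Rightarrow> bool" where
  "orthonormal_basis T B \<longleftrightarrow> pairwise orthogonal B \<and> (\<forall>b\<in>B. norm b = 1) \<and> span B = T"

definition tangent_frame :: "('n::finite, 'm) param set \<Rightarrow> ('m \<Rightarrow> 'e::euclidean_space) \<Rightarrow> 'm \<Rightarrow> 'e set" where
  "tangent_frame \<A> X x = (SOME B. orthonormal_basis (tangent_space \<A> X x) B)"

definition second_ff ::
  "('n::finite, 'm) param set \<Rightarrow> ('m \<Rightarrow> 'e::euclidean_space) \<Rightarrow> ('m \<Rightarrow> 'e) \<Rightarrow> 'm \<Rightarrow> 'e \<Rightarrow> 'e \<Rightarrow> real" where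
  "second_ff \<A> X N x v w = tderiv \<A> X N x v \<bullet> w"

definition second_ff_norm ::
  "('n::finite, 'm) param set \<Rightarrow> ('m \<Rightarrow> 'e::euclidean_space) \<Rightarrow> ('m \<Rightarrow> 'e) \<Rightarrow> 'm \<Rightarrow> real" where
  "second_ff_norm \<A> X N x =
     sqrt (\<Sum>a\<in>tangent_frame \<A> X x. \<Sum>b\<in>tangent_frame \<A> X x. (second_ff \<A> X N x a b)\<^sup>2)"

text \<open>Gradient in the induced metric, as a tangent vector in the ambient space.\<close>

definition surf_grad ::
  "('n::finite, 'm) param set \<Rightarrow> ('m \<Rightarrow> 'e::euclidean_space) \<Rightarrow> ('m \<Rightarrow> real) \<Rightarrow> 'm \<Rightarrow> 'e" where
  "surf_grad \<A> X u x = (THE w. w \<in> tangent_space \<A> X x \<and>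
     (\<forall>e\<in>tangent_space \<A> X x. w \<bullet> e = tderiv \<A> X u x e))"

text \<open>The Levi-Civita connection of the induced metric is the tangential part of the Euclidean
  derivative. As the frame vectors \<open>b\<close> are tangent, the normal part does not contribute to
  \<open>\<Sum>b. tderiv \<A> X W x b \<bullet> b\<close>, which is therefore the intrinsic divergence of a tangent field \<open>W\<close>.\<close>

definition surf_div ::
  "('n::finite, 'm) param set \<Rightarrow> ('m \<Rightarrow> 'e::euclidean_space) \<Rightarrow> ('m \<Rightarrow> 'e) \<Rightarrow> 'm \<Rightarrow> real" where
  "surf_div \<A> X W x = (\<Sum>b\<in>tangent_frame \<A> X x. tderiv \<A> X W x b \<bullet> b)"

definition surf_laplacian ::
  "('n::finite, 'm) param set \<Rightarrow> ('m \<Rightarrow> 'e::euclidean_space) \<Rightarrow> ('m \<Rightarrow> real) \<Rightarrow> 'm \<Rightarrow> real" where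
  "surf_laplacian \<A> X u x = surf_div \<A> X (surf_grad \<A> X u) x"

definition euclid_grad :: "('e::euclidean_space \<Rightarrow> real) \<Rightarrow> 'e \<Rightarrow> 'e" where
  "euclid_grad f p = (THE D. GDERIV f p :> D)"

definition euclid_hess :: "('e::euclidean_space \<Rightarrow> real) \<Rightarrow> 'e \<Rightarrow> 'e \<Rightarrow> 'e \<Rightarrow> real" where
  "euclid_hess f p v w = frechet_derivative (euclid_grad f) (at p) v \<bullet> w"


section \<open>Weighted area\<close>

definition area_density :: "(real^'n \<Rightarrow> 'm) \<Rightarrow> ('m \<Rightarrow> 'e::euclidean_space) \<Rightarrow> real^'n::finite \<Rightarrow> real" where
  "area_density \<psi> X y = sqrt (det (\<chi> i j.
     frechet_derivative (X \<circ> \<psi>) (at y) (axis i 1) \<bullet> frechet_derivative (X \<circ> \<psi>) (at y) (axis j 1)))"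

text \<open>The area measure is transported to the abstract manifold, so that points of the image are
  counted with multiplicity.\<close>

definition area_measure ::
  "('n::finite, 'm::topological_space) param set \<Rightarrow> ('m \<Rightarrow> 'e::euclidean_space) \<Rightarrow> 'm measure" where
  "area_measure \<A> X = (THE \<mu>. sets \<mu> = sets borel \<and>
     (\<forall>(V,\<psi>)\<in>\<A>. \<forall>B\<in>sets borel. B \<subseteq> \<psi> ` V \<longrightarrow>
        emeasure \<mu> B = (\<integral>\<^sup>+y\<in>V \<inter> \<psi> -` B. ennreal (area_density \<psi> X y) \<partial>lborel)))"

definition weighted_area_measure ::
  "('n::finite, 'm::topological_space) param set \<Rightarrow> ('m \<Rightarrow> 'e::euclidean_space) \<Rightarrow> ('e \<Rightarrow> real) \<Rightarrow> 'm measure" where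
  "weighted_area_measure \<A> X f = density (area_measure \<A> X) (\<lambda>x. ennreal (exp (f (X x))))"

definition weighted_area ::
  "('n::finite, 'm::topological_space) param set \<Rightarrow> ('m \<Rightarrow> 'e::euclidean_space) \<Rightarrow> ('e \<Rightarrow> real) \<Rightarrow> 'm set \<Rightarrow> real" where
  "weighted_area \<A> X f K = measure (weighted_area_measure \<A> X f) K"


section \<open>Normal variations\<close>

definition test_function :: "('n::finite, 'm::topological_space) param set \<Rightarrow> ('m \<Rightarrow> real) \<Rightarrow> bool" where
  "test_function \<A> u \<longleftrightarrow> smooth_map \<A> u \<and> (\<exists>K. compact K \<and> (\<forall>x. x \<notin> K \<longrightarrow> u x = 0))"

definition velocity :: "(real \<Rightarrow> 'm \<Rightarrow> 'e::euclidean_space) \<Rightarrow> real \<Rightarrow> 'm \<Rightarrow> 'e" where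
  "velocity F t x = vector_derivative (\<lambda>s. F s x) (at t)"

text \<open>\<open>K\<close> is a compact set outside of which \<open>F\<close> does not depend on time. That \<open>F t\<close> is an immersion
  is not demanded; by compactness it holds for all sufficiently small \<open>t\<close>.\<close>

definition compact_normal_variation ::
  "('n::finite, 'm::topological_space) param set \<Rightarrow> ('m \<Rightarrow> 'e::euclidean_space) \<Rightarrow> real \<Rightarrow> 'm set \<Rightarrow>
   (real \<Rightarrow> 'm \<Rightarrow> 'e) \<Rightarrow> bool" where
  "compact_normal_variation \<A> X \<epsilon> K F \<longleftrightarrow>
     0 < \<epsilon> \<and> smooth_family \<A> {-\<epsilon><..<\<epsilon>} F \<and> F 0 = X \<and>
     compact K \<and> (\<forall>t\<in>{-\<epsilon><..<\<epsilon>}. \<forall>x. x \<notin> K \<longrightarrow> F t x = X x) \<and>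
     (\<forall>t\<in>{-\<epsilon><..<\<epsilon>}. \<forall>x. \<forall>e\<in>tangent_space \<A> (F t) x. velocity F t x \<bullet> e = 0)"

text \<open>\<open>\<nu> t\<close> is the unit normal of \<open>F t\<close>, the orientation being fixed by \<open>\<nu> 0 = N\<close> and
  smoothness in \<open>t\<close>.\<close>

definition preserves_weighted_volume ::
  "('n::finite, 'm::topological_space) param set \<Rightarrow> ('m \<Rightarrow> 'e::euclidean_space) \<Rightarrow> ('e \<Rightarrow> real) \<Rightarrow> real \<Rightarrow>
   (real \<Rightarrow> 'm \<Rightarrow> 'e) \<Rightarrow> bool" where
  "preserves_weighted_volume \<A> N f \<epsilon> F \<longleftrightarrow>
     (\<exists>\<nu>. smooth_family \<A> {-\<epsilon><..<\<epsilon>} \<nu> \<and> \<nu> 0 = N \<and>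
        (\<forall>t\<in>{-\<epsilon><..<\<epsilon>}. unit_normal_field \<A> (F t) (\<nu> t) \<and>
           (\<integral>x. velocity F t x \<bullet> \<nu> t x \<partial>weighted_area_measure \<A> (F t) f) = 0))"

text \<open>\<open>has_first_variation \<A> X N f u d\<close> expresses that the first variation of weighted area at \<open>u\<close>
  is \<open>d\<close>: some compact normal variation represents \<open>u\<close> and \<open>d\<close> is the derivative of the area along
  it. Every test function is represented, and \<open>d\<close> does not depend on the representing variation.\<close>

definition has_first_variation ::
  "('n::finite, 'm::topological_space) param set \<Rightarrow> ('m \<Rightarrow> 'e::euclidean_space) \<Rightarrow> ('m \<Rightarrow> 'e) \<Rightarrow>
   ('e \<Rightarrow> real) \<Rightarrow> ('m \<Rightarrow> real) \<Rightarrow> real \<Rightarrow> bool" where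
  "has_first_variation \<A> X N f u d \<longleftrightarrow>
     (\<exists>\<epsilon> K F. compact_normal_variation \<A> X \<epsilon> K F \<and> (\<forall>x. velocity F 0 x \<bullet> N x = u x) \<and>
        ((\<lambda>t. weighted_area \<A> (F t) f K) has_real_derivative d) (at 0))"

definition has_second_real_derivative :: "(real \<Rightarrow> real) \<Rightarrow> real \<Rightarrow> real \<Rightarrow> bool" where
  "has_second_real_derivative g d t \<longleftrightarrow>
     (\<exists>g'. (\<forall>\<^sub>F s in nhds t. (g has_real_derivative g' s) (at s)) \<and> (g' has_real_derivative d) (at t))"

definition has_second_variation ::
  "('n::finite, 'm::topological_space) param set \<Rightarrow> ('e::euclidean_space \<Rightarrow> real) \<Rightarrow> 'm set \<Rightarrow>
   (real \<Rightarrow> 'm \<Rightarrow> 'e) \<Rightarrow> real \<Rightarrow> bool" where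
  "has_second_variation \<A> f K F d \<longleftrightarrow>
     has_second_real_derivative (\<lambda>t. weighted_area \<A> (F t) f K) d 0"

end

theory Submission
  imports Defs
begin

text \<open>
  In a chart, a variation \<open>F\<close> has weighted area density \<open>D = exp (f F) sqrt (det g)\<close>. For a normal
  variation, differentiating \<open>log D\<close> in an orthonormal frame gives at time \<open>0\<close>, pointwise and without
  integration by parts, \<open>D' = u H D\<close> with \<open>H = div N + \<nabla>f \<bullet> N\<close>, and \<open>D'' = (v H - u J) D\<close>, where \<open>J\<close> is the
  bracket in the asserted formula and \<open>v = \<phi>' + u\<^sup>2 H\<close> for the normal speed \<open>\<phi>\<close>. Because \<open>(\<phi> D)' = v D\<close>,
  preservation of the weighted volume yields \<open>\<integral>v = 0\<close>; as \<open>v\<close> is a test function, criticality gives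
  \<open>\<integral>v H = 0\<close>, and only \<open>- \<integral>u J\<close> remains. That \<open>H\<close> is constant is never needed.
\<close>

subsection \<open>Calculus of smooth functions\<close>

text \<open>\<open>area_measure\<close> is a definite description of local conditions, so nothing
  can be integrated until existence and uniqueness are settled; compatibility of the charts is the
  change of variables formula, and second countability allows gluing along a sequence of disjoint
  pieces. Integrals over \<open>K\<close> are cut along finitely many fixed Borel pieces, each
  inside a compact part of a chart, and time derivatives pass under each of them. Pointwise, the
  orthonormal frame is realized by constant coordinate vectors \<open>q\<close>: orthonormality is
  asked at one point only, but being constant they alter \<open>log D\<close> by a constant, and at
  that point the derivatives of the determinant reduce to traces. The Laplacian appears because the
  unit normal evolves by minus the gradient of \<open>u\<close>. Criticality merely supplies, for a
  given \<open>v\<close> of mean zero, some variation with vanishing derivative; the first variation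
  formula is therefore proved for arbitrary compact normal variations, not only for volume
  preserving ones.\<close>

definition dder :: "'a \<Rightarrow> ('a::real_normed_vector \<Rightarrow> 'b::real_normed_vector) \<Rightarrow> 'a \<Rightarrow> 'b" where
  "dder v h x = frechet_derivative h (at x) v"

lemma dder_eqI: "(h has_derivative h') (at x) \<Longrightarrow> dder v h x = h' v"
  unfolding dder_def using frechet_derivative_at by metis

text \<open>With the direction as first argument, \<open>dder v h\<close> is again a function of the
  point; the recursion behind \<open>Ck_on\<close> becomes iteration of \<open>dder\<close>, and
  induction hypotheses apply to \<open>dder v h\<close> directly.\<close>

lemma Ck_on_Suc_dder: "Ck_on (Suc k) S h \<longleftrightarrow> (\<forall>x\<in>S. h differentiable (at x)) \<and> (\<forall>v. Ck_on k S (dder v h))"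
  by (simp add: dder_def[abs_def])

lemma dder_cong:
  assumes "open S" "x \<in> S" "\<And>y. y \<in> S \<Longrightarrow> g y = h y"
  shows "dder v g x = dder v h x"
  unfolding dder_def
proof (cases "g differentiable at x")
  case True
  then show "frechet_derivative g (at x) v = frechet_derivative h (at x) v"
    using frechet_derivative_transform_within_open[OF True assms(1,2)] assms(3) by simp
next
  case False
  \<comment> \<open>Without differentiability \<open>frechet_derivative\<close> is still a choice
    from the set of derivatives at \<open>x\<close>; both functions have the same such set, so the
    choices agree.\<close>
  have "(g has_derivative D) (at x) \<longleftrightarrow> (h has_derivative D) (at x)" for D
    using assms by (metis has_derivative_transform_within_open)
  then show "frechet_derivative g (at x) v = frechet_derivative h (at x) v"
    by (simp add: frechet_derivative_def)
qed

lemma differentiable_at_cong: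
  assumes "open S" "x \<in> S" "\<And>y. y \<in> S \<Longrightarrow> g y = h y"
  shows "g differentiable (at x) \<longleftrightarrow> h differentiable (at x)"
  unfolding differentiable_def using assms by (metis has_derivative_transform_within_open)

lemma Ck_on_cong:
  assumes "open S" "\<And>y. y \<in> S \<Longrightarrow> g y = h y"
  shows "Ck_on k S g \<longleftrightarrow> Ck_on k S h"
  using assms(2)
proof (induction k arbitrary: g h)
  case 0
  then show ?case using continuous_on_cong by auto
next
  case (Suc k)
  have "Ck_on k S (dder v g) \<longleftrightarrow> Ck_on k S (dder v h)" for v
    using Suc dder_cong[OF assms(1)] by blast
  then show ?case
    unfolding Ck_on_Suc_dder using Suc.prems differentiable_at_cong[OF assms(1)] by blast
qed

lemma Ck_on_subset: "Ck_on k S h \<Longrightarrow> T \<subseteq> S \<Longrightarrow> Ck_on k T h"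
  by (induction k arbitrary: h) (auto intro: continuous_on_subset)

lemma Ck_on_SucD: "Ck_on (Suc k) S h \<Longrightarrow> Ck_on k S h"
proof (induction k arbitrary: h)
  case 0
  then show ?case
    by (simp add: differentiable_imp_continuous_within continuous_at_imp_continuous_on)
next
  case (Suc k)
  then show ?case by (subst Ck_on_Suc_dder) (auto simp: dder_def[abs_def])
qed

section \<open>Closure properties of the differentiability classes\<close>

lemma Ck_on_const: "Ck_on k S (\<lambda>x. c)"
  by (induction k arbitrary: c) simp_all

lemma Ck_on_bounded_linear: "bounded_linear h \<Longrightarrow> Ck_on k S h"
proof (cases k)
  case 0
  assume "bounded_linear h"
  with 0 show ?thesis by (simp add: linear_continuous_on)
next
  case (Suc m)
  assume h: "bounded_linear h"
  then have "dder v h x = h v" for v x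
    by (intro dder_eqI bounded_linear_imp_has_derivative)
  then have "dder v h = (\<lambda>x. h v)" for v by auto
  with h Suc show ?thesis
    by (auto simp: Ck_on_Suc_dder Ck_on_const bounded_linear_imp_differentiable simp del: Ck_on.simps)
qed

lemma Ck_on_add:
  assumes "open S"
  shows "Ck_on k S g \<Longrightarrow> Ck_on k S h \<Longrightarrow> Ck_on k S (\<lambda>x. g x + h x)"
proof (induction k arbitrary: g h)
  case 0
  then show ?case by (simp add: continuous_on_add)
next
  case (Suc k)
  have "dder v (\<lambda>x. g x + h x) x = dder v g x + dder v h x" if "x \<in> S" for x v
    unfolding dder_def using Suc.prems that
    by (intro dder_eqI[unfolded dder_def] has_derivative_add) (auto simp: frechet_derivative_works)
  moreover have "Ck_on k S (\<lambda>x. dder v g x + dder v h x)" for v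
    using Suc unfolding Ck_on_Suc_dder by auto
  ultimately have "Ck_on k S (dder v (\<lambda>x. g x + h x))" for v
    by (subst Ck_on_cong[OF assms]) auto
  then show ?case using Suc.prems unfolding Ck_on_Suc_dder by auto
qed

text \<open>The Leibniz rule expresses the derivative through the same bilinear map, so one
  induction covers inner products, scalar multiples and products. The undifferentiated factor is
  lowered from class \<open>k + 1\<close> to class \<open>k\<close> by
  \<open>Ck_on_SucD\<close>.\<close>

lemma Ck_on_bilinear:
  assumes "open S" "bounded_bilinear B"
  shows "Ck_on k S g \<Longrightarrow> Ck_on k S h \<Longrightarrow> Ck_on k S (\<lambda>x. B (g x) (h x))"
proof (induction k arbitrary: g h)
  case 0
  then show ?case by (simp add: bounded_bilinear.continuous_on[OF assms(2)])
next
  case (Suc k)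
  have *: "((\<lambda>x. B (g x) (h x)) has_derivative (\<lambda>v. B (g x) (dder v h x) + B (dder v g x) (h x))) (at x)"
    if "x \<in> S" for x
    unfolding dder_def using Suc.prems that
    by (intro bounded_bilinear.FDERIV[OF assms(2)]) (auto simp: frechet_derivative_works)
  have "Ck_on k S (\<lambda>x. B (g x) (dder v h x) + B (dder v g x) (h x))" for v
    using Suc Ck_on_SucD[OF Suc.prems(1)] Ck_on_SucD[OF Suc.prems(2)]
    by (intro Ck_on_add[OF assms(1)] Suc.IH) (auto simp: Ck_on_Suc_dder simp del: Ck_on.simps)
  moreover have "dder v (\<lambda>x. B (g x) (h x)) x = B (g x) (dder v h x) + B (dder v g x) (h x)" if "x \<in> S" for x v
    using dder_eqI[OF *[OF that]] .
  ultimately have "Ck_on k S (dder v (\<lambda>x. B (g x) (h x)))" for v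
    by (subst Ck_on_cong[OF assms(1)]) auto
  then show ?case using * unfolding Ck_on_Suc_dder differentiable_def by blast
qed

lemma Ck_on_sum:
  assumes "open S" "\<And>i. i \<in> I \<Longrightarrow> Ck_on k S (h i)"
  shows "Ck_on k S (\<lambda>x. \<Sum>i\<in>I. h i x)"
proof (cases "finite I")
  case True
  then show ?thesis using assms(2)
    by (induction I) (auto intro!: Ck_on_const Ck_on_add[OF assms(1)])
qed (simp add: Ck_on_const)

text \<open>The chain rule produces a derivative of \<open>h\<close> in the direction
  \<open>dder v g x\<close>, which moves with \<open>x\<close>, whereas \<open>Ck_on\<close> speaks
  of fixed directions only. Expanding this direction in \<open>Basis\<close> leaves products of
  functions already known to be of class \<open>k\<close>; hence the Euclidean codomain of
  \<open>g\<close>.\<close>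

lemma Ck_on_compose:
  fixes g :: "'a::real_normed_vector \<Rightarrow> 'b::euclidean_space"
  assumes "open S"
  shows "Ck_on k T h \<Longrightarrow> Ck_on k S g \<Longrightarrow> g ` S \<subseteq> T \<Longrightarrow> Ck_on k S (\<lambda>x. h (g x))"
proof (induction k arbitrary: g h)
  case 0
  then show ?case by (auto intro: continuous_on_compose2)
next
  case (Suc k)
  have diff: "((\<lambda>x. h (g x)) has_derivative (\<lambda>v. dder (dder v g x) h (g x))) (at x)" if "x \<in> S" for x
    unfolding dder_def using Suc.prems that
    by (intro has_derivative_compose[of g _ x UNIV h]) (auto simp: frechet_derivative_works image_subset_iff)
  have eq: "dder v (\<lambda>x. h (g x)) x = (\<Sum>b\<in>Basis. (dder v g x \<bullet> b) *\<^sub>R dder b h (g x))" if "x \<in> S" for x v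
  proof -
    have "h differentiable (at (g x))" using Suc.prems that by auto
    then have l: "linear (\<lambda>w. dder w h (g x))"
      unfolding dder_def by (rule linear_frechet_derivative)
    have "dder v (\<lambda>x. h (g x)) x = dder (dder v g x) h (g x)"
      using dder_eqI[OF diff[OF that]] .
    also have "\<dots> = dder (\<Sum>b\<in>Basis. (dder v g x \<bullet> b) *\<^sub>R b) h (g x)"
      by (simp add: euclidean_representation)
    also have "\<dots> = (\<Sum>b\<in>Basis. (dder v g x \<bullet> b) *\<^sub>R dder b h (g x))"
      by (simp only: linear_sum[OF l, of "\<lambda>b. (dder v g x \<bullet> b) *\<^sub>R b"] linear_cmul[OF l])
    finally show ?thesis .
  qed
  have "Ck_on k S (\<lambda>x. (dder v g x \<bullet> b) *\<^sub>R dder b h (g x))" for v b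
  proof (intro Ck_on_bilinear[OF assms bounded_bilinear_scaleR] Ck_on_bilinear[OF assms bounded_bilinear_inner])
    show "Ck_on k S (dder v g)" using Suc.prems unfolding Ck_on_Suc_dder by auto
    show "Ck_on k S (\<lambda>x. dder b h (g x))"
      using Suc.prems Suc.IH Ck_on_SucD unfolding Ck_on_Suc_dder by blast
  qed (rule Ck_on_const)
  then have "Ck_on k S (\<lambda>x. \<Sum>b\<in>Basis. (dder v g x \<bullet> b) *\<^sub>R dder b h (g x))" for v
    by (intro Ck_on_sum assms)
  then have "Ck_on k S (dder v (\<lambda>x. h (g x)))" for v
    by (subst Ck_on_cong[OF assms]) (simp_all add: eq)
  then show ?case using diff unfolding Ck_on_Suc_dder differentiable_def by auto
qed

lemma smooth_on_cong: "open S \<Longrightarrow> (\<And>y. y \<in> S \<Longrightarrow> g y = h y) \<Longrightarrow> smooth_on S g \<longleftrightarrow> smooth_on S h"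
  unfolding smooth_on_def using Ck_on_cong by blast

lemma smooth_on_subset: "smooth_on S h \<Longrightarrow> T \<subseteq> S \<Longrightarrow> smooth_on T h"
  unfolding smooth_on_def using Ck_on_subset by blast

lemma smooth_on_const: "smooth_on S (\<lambda>x. c)"
  unfolding smooth_on_def using Ck_on_const by blast

lemma smooth_on_bounded_linear: "bounded_linear h \<Longrightarrow> smooth_on S h"
  unfolding smooth_on_def using Ck_on_bounded_linear by blast

lemma smooth_on_add: "open S \<Longrightarrow> smooth_on S g \<Longrightarrow> smooth_on S h \<Longrightarrow> smooth_on S (\<lambda>x. g x + h x)"
  unfolding smooth_on_def using Ck_on_add by blast

lemma smooth_on_bilinear:
  "open S \<Longrightarrow> bounded_bilinear B \<Longrightarrow> smooth_on S g \<Longrightarrow> smooth_on S h \<Longrightarrow> smooth_on S (\<lambda>x. B (g x) (h x))"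
  unfolding smooth_on_def using Ck_on_bilinear by blast

lemmas smooth_on_inner = smooth_on_bilinear[OF _ bounded_bilinear_inner]
lemmas smooth_on_scaleR = smooth_on_bilinear[OF _ bounded_bilinear_scaleR]
lemmas smooth_on_mult = smooth_on_bilinear[OF _ bounded_bilinear_mult]

lemma smooth_on_sum: "open S \<Longrightarrow> (\<And>i. i \<in> I \<Longrightarrow> smooth_on S (h i)) \<Longrightarrow> smooth_on S (\<lambda>x. \<Sum>i\<in>I. h i x)"
  unfolding smooth_on_def using Ck_on_sum[of S I _ h] by blast

lemma smooth_on_prod:
  fixes h :: "'i \<Rightarrow> 'a::real_normed_vector \<Rightarrow> real"
  assumes "open S" "\<And>i. i \<in> I \<Longrightarrow> smooth_on S (h i)"
  shows "smooth_on S (\<lambda>x. \<Prod>i\<in>I. h i x)"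
proof (cases "finite I")
  case True
  then show ?thesis using assms(2)
    by (induction I) (auto intro!: smooth_on_const smooth_on_mult[OF assms(1)])
qed (simp add: smooth_on_const)

lemma smooth_on_compose:
  fixes g :: "'a::real_normed_vector \<Rightarrow> 'b::euclidean_space"
  shows "open S \<Longrightarrow> smooth_on T h \<Longrightarrow> smooth_on S g \<Longrightarrow> g ` S \<subseteq> T \<Longrightarrow> smooth_on S (\<lambda>x. h (g x))"
  unfolding smooth_on_def using Ck_on_compose by blast

lemma smooth_on_imp_continuous_on: "smooth_on S h \<Longrightarrow> continuous_on S h"
  unfolding smooth_on_def using Ck_on.simps(1) by blast

lemma smooth_on_dder: "smooth_on S h \<Longrightarrow> smooth_on S (dder v h)"
  unfolding smooth_on_def using Ck_on_Suc_dder by blast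

lemma smooth_on_imp_differentiable: "smooth_on S h \<Longrightarrow> x \<in> S \<Longrightarrow> h differentiable (at x)"
  unfolding smooth_on_def using Ck_on_Suc_dder by blast

lemma smooth_on_has_derivative: "smooth_on S h \<Longrightarrow> x \<in> S \<Longrightarrow> (h has_derivative (\<lambda>v. dder v h x)) (at x)"
  using smooth_on_imp_differentiable frechet_derivative_works unfolding dder_def by blast

lemma smooth_on_linear_dder: "smooth_on S h \<Longrightarrow> x \<in> S \<Longrightarrow> linear (\<lambda>v. dder v h x)"
  using smooth_on_has_derivative has_derivative_linear by blast

section \<open>Smoothness of the inverse, the exponential and the logarithm\<close>

text \<open>In one variable the derivative in direction \<open>v\<close> is \<open>v * h' x\<close>,
  so one more order of differentiability can be read off from \<open>h'\<close>. For
  \<open>inverse\<close> and \<open>exp\<close> the derivative is built from the function itself,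
  which closes an induction.\<close>

lemma Ck_on_Suc_real:
  fixes h :: "real \<Rightarrow> real"
  assumes S: "open S" and d: "\<And>x. x \<in> S \<Longrightarrow> (h has_real_derivative h' x) (at x)" and h': "Ck_on k S h'"
  shows "Ck_on (Suc k) S h"
proof -
  have d': "(h has_derivative (\<lambda>v. v * h' x)) (at x)" if "x \<in> S" for x
    using d[OF that] by (simp add: has_field_derivative_def mult_commute_abs)
  have "Ck_on k S (\<lambda>x. v * h' x)" for v
    by (intro Ck_on_bilinear[OF S bounded_bilinear_mult] Ck_on_const h')
  moreover have "dder v h x = v * h' x" if "x \<in> S" for v x using dder_eqI[OF d'[OF that]] .
  ultimately have "Ck_on k S (dder v h)" for v by (subst Ck_on_cong[OF S]) simp_all
  then show ?thesis unfolding Ck_on_Suc_dder differentiable_def using d' by auto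
qed

lemma smooth_on_inverse: "smooth_on (-{0}) (inverse :: real \<Rightarrow> real)"
  unfolding smooth_on_def
proof
  fix k show "Ck_on k (-{0}) (inverse :: real \<Rightarrow> real)"
  proof (induction k)
    case (Suc k)
    have o: "open (-{0::real})" by auto
    have "Ck_on k (-{0}) (\<lambda>x::real. - 1 * (inverse x * inverse x))"
      by (rule Ck_on_bilinear[OF o bounded_bilinear_mult Ck_on_const Ck_on_bilinear[OF o bounded_bilinear_mult Suc Suc]])
    then show ?case
      by (rule Ck_on_Suc_real[OF o, rotated]) (auto intro!: derivative_eq_intros)
  qed (auto intro!: continuous_intros)
qed

lemma smooth_on_exp: "smooth_on UNIV (exp :: real \<Rightarrow> real)"
  unfolding smooth_on_def
proof
  fix k show "Ck_on k UNIV (exp :: real \<Rightarrow> real)"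
  proof (induction k)
    case (Suc k)
    then show ?case by (rule Ck_on_Suc_real[OF open_UNIV DERIV_exp])
  qed (auto intro!: continuous_intros)
qed

lemma smooth_on_ln: "smooth_on {0<..} (ln :: real \<Rightarrow> real)"
  unfolding smooth_on_def
proof
  fix k
  have i: "Ck_on k {0<..} (inverse :: real \<Rightarrow> real)"
    using smooth_on_subset[OF smooth_on_inverse, of "{0<..}"] by (auto simp: smooth_on_def)
  show "Ck_on k {0<..} (ln :: real \<Rightarrow> real)"
    by (rule Ck_on_SucD[OF Ck_on_Suc_real[OF open_greaterThan DERIV_ln i]]) simp
qed

subsection \<open>Symmetry of mixed derivatives\<close>

lemma dder_vector_derivative:
  assumes "smooth_on S h" "x + s *\<^sub>R v \<in> S"
  shows "((\<lambda>r. h (x + r *\<^sub>R v)) has_vector_derivative dder v h (x + s *\<^sub>R v)) (at s)"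
proof -
  have "((\<lambda>r. h (x + r *\<^sub>R v)) has_derivative (\<lambda>r. dder (r *\<^sub>R v) h (x + s *\<^sub>R v))) (at s)"
    by (rule has_derivative_compose[of "\<lambda>r. x + r *\<^sub>R v" "\<lambda>r. r *\<^sub>R v" s UNIV h])
       (auto intro!: derivative_eq_intros smooth_on_has_derivative[OF assms])
  then show ?thesis
    unfolding has_vector_derivative_def
    using linear_cmul[OF smooth_on_linear_dder[OF assms]] by simp
qed

lemma dder_inner_const:
  assumes "smooth_on S h" "x \<in> S"
  shows "dder v (\<lambda>x. h x \<bullet> c) x = dder v h x \<bullet> c"
  by (rule dder_eqI) (auto intro!: derivative_eq_intros smooth_on_has_derivative assms)

text \<open>The second difference of \<open>h\<close> over a small parallelogram is, by two applications of the mean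
  value theorem, a value of either mixed derivative at a nearby point.\<close>

lemma second_difference_mean_value:
  fixes h :: "'a::real_normed_vector \<Rightarrow> real"
  assumes h: "smooth_on S h" and d: "d > 0"
    and sub: "\<And>r s. 0 \<le> r \<Longrightarrow> r \<le> d \<Longrightarrow> 0 \<le> s \<Longrightarrow> s \<le> d \<Longrightarrow> x + r *\<^sub>R v + s *\<^sub>R w \<in> S"
  obtains r s where "0 < r" "r < d" "0 < s" "s < d"
    "h (x + d *\<^sub>R v + d *\<^sub>R w) - h (x + d *\<^sub>R v) - h (x + d *\<^sub>R w) + h x
       = d * d * dder w (dder v h) (x + r *\<^sub>R v + s *\<^sub>R w)"
proof -
  define p where "p r = h ((x + d *\<^sub>R w) + r *\<^sub>R v) - h (x + r *\<^sub>R v)" for r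
  have "\<exists>r>0. r < d \<and> p d - p 0 = (d - 0) * (dder v h ((x + d *\<^sub>R w) + r *\<^sub>R v) - dder v h (x + r *\<^sub>R v))"
  proof (rule MVT2[OF d])
    fix r assume r: "0 \<le> r" "r \<le> d"
    have "(x + d *\<^sub>R w) + r *\<^sub>R v \<in> S" "x + r *\<^sub>R v \<in> S"
      using sub[OF r, of d] sub[OF r, of 0] d by (auto simp: algebra_simps)
    then show "DERIV p r :> dder v h ((x + d *\<^sub>R w) + r *\<^sub>R v) - dder v h (x + r *\<^sub>R v)"
      unfolding p_def has_real_derivative_iff_has_vector_derivative
      by (intro has_vector_derivative_diff dder_vector_derivative[OF h])
  qed
  then obtain r where r: "r > 0" "r < d"
    "p d - p 0 = (d - 0) * (dder v h ((x + d *\<^sub>R w) + r *\<^sub>R v) - dder v h (x + r *\<^sub>R v))" by blast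
  have "\<exists>s>0. s < d \<and> dder v h (x + r *\<^sub>R v + d *\<^sub>R w) - dder v h (x + r *\<^sub>R v + 0 *\<^sub>R w)
       = (d - 0) * dder w (dder v h) (x + r *\<^sub>R v + s *\<^sub>R w)"
    by (rule MVT2[OF d], unfold has_real_derivative_iff_has_vector_derivative,
        rule dder_vector_derivative[OF smooth_on_dder[OF h]]) (use r sub in auto)
  then obtain s where s: "s > 0" "s < d" "dder v h (x + r *\<^sub>R v + d *\<^sub>R w) - dder v h (x + r *\<^sub>R v + 0 *\<^sub>R w)
       = (d - 0) * dder w (dder v h) (x + r *\<^sub>R v + s *\<^sub>R w)" by blast
  show thesis
  proof (rule that[OF r(1,2) s(1,2)])
    have "p d - p 0 = d * (d * dder w (dder v h) (x + r *\<^sub>R v + s *\<^sub>R w))"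
      using r(3) s(3) by (simp add: algebra_simps)
    moreover have "p d - p 0 = h (x + d *\<^sub>R v + d *\<^sub>R w) - h (x + d *\<^sub>R v) - h (x + d *\<^sub>R w) + h x"
      by (simp add: p_def algebra_simps)
    ultimately show "h (x + d *\<^sub>R v + d *\<^sub>R w) - h (x + d *\<^sub>R v) - h (x + d *\<^sub>R w) + h x
       = d * d * dder w (dder v h) (x + r *\<^sub>R v + s *\<^sub>R w)" by simp
  qed
qed

text \<open>Both mixed derivatives occur as mean values of one and the same second difference, which
  is symmetric in \<open>v\<close> and \<open>w\<close>; continuity carries the equality of these
  nearby values to \<open>x\<close>.\<close>

lemma dder_commute_real:
  fixes h :: "'a::real_normed_vector \<Rightarrow> real"
  assumes S: "open S" and h: "smooth_on S h" and x: "x \<in> S"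
  shows "dder w (dder v h) x = dder v (dder w h) x"
proof (rule ccontr)
  assume ne: "dder w (dder v h) x \<noteq> dder v (dder w h) x"
  \<comment> \<open>Half of the supposed gap, so that no number lies within \<open>e\<close> of both
    values.\<close>
  define e where "e = dist (dder w (dder v h) x) (dder v (dder w h) x) / 2"
  have e: "e > 0" using ne by (simp add: e_def)
  have "continuous_on S (dder w (dder v h))" "continuous_on S (dder v (dder w h))"
    using h by (intro smooth_on_imp_continuous_on smooth_on_dder; simp)+
  then have "isCont (dder w (dder v h)) x" "isCont (dder v (dder w h)) x"
    using S x by (auto simp: continuous_on_eq_continuous_at)
  then have "\<forall>\<^sub>F y in nhds x. dist (dder w (dder v h) y) (dder w (dder v h) x) < e"
    "\<forall>\<^sub>F y in nhds x. dist (dder v (dder w h) y) (dder v (dder w h) x) < e"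
    using e by (auto simp: continuous_at tendsto_iff eventually_at_filter eventually_mono
      intro: eventually_mono)
  moreover have "\<forall>\<^sub>F y in nhds x. y \<in> S" using S x by (simp add: eventually_nhds_in_open)
  ultimately have "\<forall>\<^sub>F y in nhds x. y \<in> S \<and> dist (dder w (dder v h) y) (dder w (dder v h) x) < e
      \<and> dist (dder v (dder w h) y) (dder v (dder w h) x) < e"
    by eventually_elim auto
  then obtain \<delta> where \<delta>: "\<delta> > 0" "\<And>y. dist y x < \<delta> \<Longrightarrow> y \<in> S \<and> dist (dder w (dder v h) y) (dder w (dder v h) x) < e
      \<and> dist (dder v (dder w h) y) (dder v (dder w h) x) < e"
    by (auto simp: eventually_nhds_metric)
  \<comment> \<open>Keeps the whole parallelogram spanned by \<open>d\<close> times \<open>v\<close>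
    and \<open>d\<close> times \<open>w\<close> within \<open>\<delta>\<close> of \<open>x\<close>;
    the summand 1 covers the case \<open>v = w = 0\<close>.\<close>
  define d where "d = \<delta> / (2 * (norm v + norm w + 1))"
  have nn: "norm v + norm w + 1 > 0" by (smt (verit) norm_ge_zero)
  have d: "d > 0" using \<delta>(1) nn by (simp add: d_def)
  have near: "dist (x + r *\<^sub>R v + s *\<^sub>R w) x < \<delta>" if "0 \<le> r" "r \<le> d" "0 \<le> s" "s \<le> d" for r s
  proof -
    have "norm (r *\<^sub>R v + s *\<^sub>R w) \<le> d * norm v + d * norm w"
      using that by (intro norm_triangle_le) (simp add: add_mono mult_right_mono)
    also have "\<dots> < d * (norm v + norm w + 1)" using d by (simp add: algebra_simps)
    also have "\<dots> = \<delta> / 2" using nn by (simp add: d_def field_simps)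
    finally show ?thesis using \<delta>(1) by (simp add: dist_norm add.assoc)
  qed
  have near': "dist (x + r *\<^sub>R w + s *\<^sub>R v) x < \<delta>" if "0 \<le> r" "r \<le> d" "0 \<le> s" "s \<le> d" for r s
    using near[of s r] that by (simp add: algebra_simps)
  obtain r s where rs: "0 < r" "r < d" "0 < s" "s < d"
    "h (x + d *\<^sub>R v + d *\<^sub>R w) - h (x + d *\<^sub>R v) - h (x + d *\<^sub>R w) + h x
       = d * d * dder w (dder v h) (x + r *\<^sub>R v + s *\<^sub>R w)"
    using second_difference_mean_value[OF h d, of x v w] near \<delta>(2) by metis
  obtain r' s' where rs': "0 < r'" "r' < d" "0 < s'" "s' < d"
    "h (x + d *\<^sub>R w + d *\<^sub>R v) - h (x + d *\<^sub>R w) - h (x + d *\<^sub>R v) + h x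
       = d * d * dder v (dder w h) (x + r' *\<^sub>R w + s' *\<^sub>R v)"
    using second_difference_mean_value[OF h d, of x w v] near' \<delta>(2) by metis
  have "d * d * dder w (dder v h) (x + r *\<^sub>R v + s *\<^sub>R w) = d * d * dder v (dder w h) (x + r' *\<^sub>R w + s' *\<^sub>R v)"
    using rs(5) rs'(5) by (simp add: algebra_simps)
  then have "dder w (dder v h) (x + r *\<^sub>R v + s *\<^sub>R w) = dder v (dder w h) (x + r' *\<^sub>R w + s' *\<^sub>R v)"
    using d by simp
  moreover have "dist (dder w (dder v h) (x + r *\<^sub>R v + s *\<^sub>R w)) (dder w (dder v h) x) < e"
    using \<delta>(2) near rs by simp
  moreover have "dist (dder v (dder w h) (x + r' *\<^sub>R w + s' *\<^sub>R v)) (dder v (dder w h) x) < e"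
    using \<delta>(2) near' rs' by simp
  ultimately show False using ne unfolding e_def dist_real_def by (simp add: abs_if field_simps split: if_splits)
qed

text \<open>The mean value theorem is a scalar statement, so vector-valued maps are treated one
  coordinate at a time.\<close>

lemma dder_commute:
  fixes h :: "'a::real_normed_vector \<Rightarrow> 'b::euclidean_space"
  assumes S: "open S" and h: "smooth_on S h" and x: "x \<in> S"
  shows "dder w (dder v h) x = dder v (dder w h) x"
proof (rule euclidean_eqI)
  fix b :: 'b assume "b \<in> Basis"
  have sm: "smooth_on S (\<lambda>x. h x \<bullet> b)"
    by (intro smooth_on_inner S h smooth_on_const)
  have *: "dder a (dder c h) x \<bullet> b = dder a (dder c (\<lambda>x. h x \<bullet> b)) x" for a c
  proof -
    have "dder a (dder c (\<lambda>x. h x \<bullet> b)) x = dder a (\<lambda>x. dder c h x \<bullet> b) x"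
      by (rule dder_cong[OF S x]) (rule dder_inner_const[OF h])
    then show ?thesis using dder_inner_const[OF smooth_on_dder[OF h] x] by simp
  qed
  show "dder w (dder v h) x \<bullet> b = dder v (dder w h) x \<bullet> b"
    unfolding * by (rule dder_commute_real[OF S sm x])
qed

section \<open>Product, chain and slicing rules for directional derivatives\<close>

lemma dder_inner:
  assumes "smooth_on S g" "smooth_on S h" "x \<in> S"
  shows "dder v (\<lambda>x. g x \<bullet> h x) x = dder v g x \<bullet> h x + g x \<bullet> dder v h x"
  using dder_eqI[OF has_derivative_inner[OF smooth_on_has_derivative[OF assms(1,3)] smooth_on_has_derivative[OF assms(2,3)]]]
  by simp

lemma dder_scaleR:
  assumes "smooth_on S g" "smooth_on S h" "x \<in> S"
  shows "dder v (\<lambda>x. g x *\<^sub>R h x) x = dder v g x *\<^sub>R h x + g x *\<^sub>R dder v h x"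
  using dder_eqI[OF has_derivative_scaleR[OF smooth_on_has_derivative[OF assms(1,3)] smooth_on_has_derivative[OF assms(2,3)]]]
  by simp

lemma dder_mult:
  fixes g h :: "'a::real_normed_vector \<Rightarrow> real"
  assumes "smooth_on S g" "smooth_on S h" "x \<in> S"
  shows "dder v (\<lambda>x. g x * h x) x = dder v g x * h x + g x * dder v h x"
  using dder_scaleR[OF assms] by simp

lemma dder_sum:
  assumes "\<And>i. i \<in> I \<Longrightarrow> smooth_on S (h i)" "x \<in> S"
  shows "dder v (\<lambda>x. \<Sum>i\<in>I. h i x) x = (\<Sum>i\<in>I. dder v (h i) x)"
  by (rule dder_eqI, rule has_derivative_sum, rule smooth_on_has_derivative) (use assms in auto)

lemma dder_compose:
  assumes "smooth_on S g" "x \<in> S" "smooth_on T h" "g x \<in> T"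
  shows "dder v (\<lambda>x. h (g x)) x = dder (dder v g x) h (g x)"
  by (rule dder_eqI)
    (rule has_derivative_compose[OF smooth_on_has_derivative[OF assms(1,2)] smooth_on_has_derivative[OF assms(3,4)]])

lemma dder_exp:
  fixes g :: "'a::real_normed_vector \<Rightarrow> real"
  assumes "smooth_on S g" "x \<in> S"
  shows "dder v (\<lambda>x. exp (g x)) x = exp (g x) * dder v g x"
  using dder_eqI[OF has_derivative_exp[OF smooth_on_has_derivative[OF assms]]] by simp

lemma dder_ln:
  fixes g :: "'a::real_normed_vector \<Rightarrow> real"
  assumes "smooth_on S g" "x \<in> S" "g x > 0"
  shows "dder v (\<lambda>x. ln (g x)) x = dder v g x / g x"
  using dder_eqI[OF has_derivative_ln[OF assms(3) smooth_on_has_derivative[OF assms(1,2)]]]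
  by (simp add: divide_inverse)

lemma has_derivative_slice:
  "((\<lambda>y. (t, y)) has_derivative (\<lambda>v. (0, v))) (at y)"
  by (auto intro!: derivative_eq_intros)

lemma dder_slice:
  assumes "smooth_on S h" "(t, y) \<in> S"
  shows "dder v (\<lambda>y. h (t, y)) y = dder (0, v) h (t, y)"
  by (rule dder_eqI) (rule has_derivative_compose[OF has_derivative_slice smooth_on_has_derivative[OF assms]])

lemma smooth_on_slice:
  fixes h :: "'a::euclidean_space \<times> 'b::euclidean_space \<Rightarrow> 'c::real_normed_vector"
  assumes "open S" "smooth_on S h" "open V" "\<And>y. y \<in> V \<Longrightarrow> (t, y) \<in> S"
  shows "smooth_on V (\<lambda>y. h (t, y))"
proof -
  have "smooth_on V (\<lambda>y. (t, 0) + (0, y))"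
    by (intro smooth_on_add assms smooth_on_const smooth_on_bounded_linear bounded_linear_Pair
        bounded_linear_zero bounded_linear_ident)
  then show ?thesis
    using assms(4) smooth_on_compose[OF assms(3,2), of "\<lambda>y. (t, 0) + (0, y)"] by auto
qed

abbreviation dt :: "(real \<times> 'b::real_normed_vector \<Rightarrow> 'c::real_normed_vector) \<Rightarrow> real \<times> 'b \<Rightarrow> 'c" where
  "dt \<equiv> dder (1, 0)"

lemma has_vector_derivative_time_slice:
  fixes h :: "real \<times> 'b::real_normed_vector \<Rightarrow> 'c::real_normed_vector"
  assumes "smooth_on S h" "(t, y) \<in> S"
  shows "((\<lambda>s. h (s, y)) has_vector_derivative dt h (t, y)) (at t)"
  using dder_vector_derivative[OF assms(1), of "(0, y)" t "(1, 0)"] assms(2) by simp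

subsection \<open>Derivatives of determinants\<close>

text \<open>A determinant is multilinear in its rows, so its derivative is a sum of determinants
  with one row replaced; a second derivative replaces two.\<close>

definition set_row :: "'m \<Rightarrow> 'a^'n \<Rightarrow> 'a^'n^'m \<Rightarrow> 'a^'n^'m" where
  "set_row i v A = (\<chi> k. if k = i then v else A $ k)"

lemma set_row_nth: "set_row i v A $ k = (if k = i then v else A $ k)"
  by (simp add: set_row_def)

lemma set_row_commute: "i \<noteq> j \<Longrightarrow> set_row i v (set_row j w A) = set_row j w (set_row i v A)"
  by (auto simp: set_row_def vec_eq_iff)

lemma set_row_same: "A $ i = v \<Longrightarrow> set_row i v A = A"
  by (auto simp: set_row_def vec_eq_iff)

lemma mat_row_axis: "mat 1 $ k = axis k (1::real)"
  by (simp add: mat_def axis_def vec_eq_iff)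

lemma det_set_row_expand:
  fixes A :: "real^'n^'n"
  shows "det (set_row i v A) = (\<Sum>k\<in>UNIV. v $ k * det (set_row i (axis k 1) A))"
proof -
  have v: "v = (\<Sum>k\<in>UNIV. v $ k *s axis k 1)"
    by (simp add: vec_eq_iff axis_def if_distrib if_distribR sum.delta cong: if_cong)
  have "det (set_row i v A) = det (\<chi> l. if l = i then \<Sum>k\<in>UNIV. v $ k *s axis k 1 else A $ l)"
    unfolding set_row_def using v by metis
  also have "\<dots> = (\<Sum>k\<in>UNIV. det (\<chi> l. if l = i then v $ k *s axis k 1 else A $ l))"
    by (rule det_linear_row_sum) simp
  also have "\<dots> = (\<Sum>k\<in>UNIV. v $ k * det (set_row i (axis k 1) A))"
    unfolding set_row_def by (simp only: det_row_mul)
  finally show ?thesis .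
qed

lemma det_set_row_identical:
  fixes A :: "real^'n^'n"
  assumes "k \<noteq> i" "A $ k = v"
  shows "det (set_row i v A) = 0"
  by (rule det_identical_rows[of i k]) (use assms in \<open>auto simp: row_def set_row_nth vec_eq_iff\<close>)

lemma det_set_row_mat1:
  fixes v :: "real^'n"
  shows "det (set_row i v (mat 1)) = v $ i"
proof -
  have "v $ k * det (set_row i (axis k 1) (mat 1 :: real^'n^'n)) = (if k = i then v $ i else 0)" for k
    using det_set_row_identical[of k i "mat 1" "axis k 1"] set_row_same[of "mat 1 :: real^'n^'n" i "axis i 1"]
    by (auto simp: mat_row_axis)
  then show ?thesis by (subst det_set_row_expand) simp
qed

text \<open>A 2x2 minor. Expanding both rows in unit vectors, a term survives only if no row is
  repeated: the two positions are kept, or they are exchanged and the transposition contributes the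
  sign.\<close>

lemma det_set_row2_mat1:
  fixes v w :: "real^'n"
  assumes "i \<noteq> j"
  shows "det (set_row i v (set_row j w (mat 1))) = v $ i * w $ j - v $ j * w $ i"
proof -
  let ?I = "mat 1 :: real^'n^'n"
  have swap: "det (set_row i (axis j 1) (set_row j (axis i 1) ?I)) = -1"
  proof -
    have "set_row i (axis j 1) (set_row j (axis i 1) ?I) = (\<chi> k. ?I $ Transposition.transpose i j k)"
      using assms by (auto simp: vec_eq_iff set_row_nth mat_row_axis Transposition.transpose_def)
    then show ?thesis
      using det_permute_rows[of "Transposition.transpose i j" ?I] assms
      by (simp add: permutes_swap_id sign_swap_id)
  qed
  have j: "det (set_row i (axis j 1) (set_row j w ?I)) = - w $ i"
  proof -
    have "w $ l * det (set_row j (axis l 1) (set_row i (axis j 1) ?I)) = (if l = i then - w $ i else 0)" for l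
    proof (cases "l = i")
      case True
      then show ?thesis using swap by (simp add: set_row_commute[OF assms])
    next
      case False
      then have "det (set_row j (axis l 1) (set_row i (axis j 1) ?I)) = 0"
        using assms det_set_row_identical[of l j "set_row i (axis j 1) ?I" "axis l 1"]
          det_set_row_identical[of i j "set_row i (axis j 1) ?I" "axis l 1"]
        by (cases "l = j") (auto simp: set_row_nth mat_row_axis)
      then show ?thesis using False by simp
    qed
    then show ?thesis
      by (subst set_row_commute[OF assms], subst det_set_row_expand) simp
  qed
  have "v $ k * det (set_row i (axis k 1) (set_row j w ?I))
     = (if k = i then v $ i * w $ j else 0) + (if k = j then - v $ j * w $ i else 0)" for k
  proof -
    consider "k = i" | "k = j" | "k \<noteq> i" "k \<noteq> j" by blast
    then show ?thesis
    proof cases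
      case 1
      then show ?thesis
        using assms set_row_same[of "set_row j w ?I" i "axis i 1"] det_set_row_mat1[of j w]
        by (simp add: set_row_nth mat_row_axis)
    next
      case 2
      then show ?thesis using assms j by simp
    next
      case 3
      then show ?thesis
        using det_set_row_identical[of k i "set_row j w ?I" "axis k 1"]
        by (simp add: set_row_nth mat_row_axis)
    qed
  qed
  then show ?thesis
    by (subst det_set_row_expand) (simp add: sum.distrib)
qed

text \<open>Product rule in the Leibniz formula; exchanging the sums over permutations and rows
  collects the terms in which row \<open>i\<close> has been differentiated.\<close>

lemma det_has_derivative:
  fixes G :: "'a::real_normed_vector \<Rightarrow> real^'n^'n"
  assumes "\<And>i j. ((\<lambda>x. G x $ i $ j) has_derivative (\<lambda>h. G' h $ i $ j)) (at x)"
  shows "((\<lambda>x. det (G x)) has_derivative (\<lambda>h. \<Sum>i\<in>UNIV. det (set_row i (G' h $ i) (G x)))) (at x)"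
proof -
  have row: "det (set_row i v A) =
      (\<Sum>p | p permutes UNIV. of_int (sign p) * (v $ p i * (\<Prod>k\<in>UNIV - {i}. A $ k $ p k)))"
    for i v and A :: "real^'n^'n"
    unfolding det_def by (intro sum.cong refl) (simp add: prod.remove[of UNIV i] set_row_nth)
  have "((\<lambda>x. \<Sum>p | p permutes UNIV. of_int (sign p) * (\<Prod>i\<in>UNIV. G x $ i $ p i)) has_derivative
    (\<lambda>h. \<Sum>p | p permutes UNIV. of_int (sign p) *
       (\<Sum>i\<in>UNIV. G' h $ i $ p i * (\<Prod>k\<in>UNIV - {i}. G x $ k $ p k)))) (at x)"
    by (intro has_derivative_sum has_derivative_mult_right has_derivative_prod assms)
  moreover have "(\<Sum>p | p permutes UNIV. of_int (sign p) *
       (\<Sum>i\<in>UNIV. G' h $ i $ p i * (\<Prod>k\<in>UNIV - {i}. G x $ k $ p k)))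
     = (\<Sum>i\<in>UNIV. det (set_row i (G' h $ i) (G x)))" for h
    unfolding row sum_distrib_left by (rule sum.swap)
  ultimately show ?thesis unfolding det_def by simp
qed

lemma smooth_on_det:
  fixes G :: "'a::real_normed_vector \<Rightarrow> real^'n^'n"
  assumes "open S" "\<And>i j. smooth_on S (\<lambda>x. G x $ i $ j)"
  shows "smooth_on S (\<lambda>x. det (G x))"
  unfolding det_def
  by (intro smooth_on_sum smooth_on_mult smooth_on_prod smooth_on_const assms)

lemma dder_det:
  fixes G :: "'a::real_normed_vector \<Rightarrow> real^'n^'n"
  assumes "\<And>i j. smooth_on S (\<lambda>x. G x $ i $ j)" "x \<in> S"
  shows "dder e (\<lambda>x. det (G x)) x =
    (\<Sum>i\<in>UNIV. det (set_row i (\<chi> j. dder e (\<lambda>x. G x $ i $ j) x) (G x)))"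
proof -
  have "((\<lambda>x. det (G x)) has_derivative
    (\<lambda>h. \<Sum>i\<in>UNIV. det (set_row i ((\<chi> i j. dder h (\<lambda>x. G x $ i $ j) x) $ i) (G x)))) (at x)"
    by (rule det_has_derivative) (simp add: smooth_on_has_derivative[OF assms])
  from dder_eqI[OF this] show ?thesis by simp
qed

text \<open>Jacobi's formula at the identity matrix: the derivative of the determinant is the trace
  of the derivative.\<close>

lemma dder_det_mat1:
  fixes G :: "'a::real_normed_vector \<Rightarrow> real^'n^'n"
  assumes "\<And>i j. smooth_on S (\<lambda>x. G x $ i $ j)" "x \<in> S" "G x = mat 1"
  shows "dder e (\<lambda>x. det (G x)) x = (\<Sum>i\<in>UNIV. dder e (\<lambda>x. G x $ i $ i) x)"
  using dder_det[of S G x e, OF assms(1,2)] by (simp add: assms(3) det_set_row_mat1)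

text \<open>With dots for derivatives this is \<open>tr G'' + (tr G')\<^sup>2 - tr (G' G')\<close>.
  It comes from differentiating the row formula once more: hitting the same row gives
  \<open>G''\<close>, hitting another row gives a 2x2 minor of \<open>G'\<close>.\<close>

lemma dder2_det_mat1:
  fixes G :: "'a::real_normed_vector \<Rightarrow> real^'n^'n"
  assumes S: "open S" and G: "\<And>i j. smooth_on S (\<lambda>x. G x $ i $ j)" and x: "x \<in> S" "G x = mat 1"
  shows "dder e (dder e (\<lambda>x. det (G x))) x =
    (\<Sum>i\<in>UNIV. dder e (dder e (\<lambda>x. G x $ i $ i)) x) + (\<Sum>i\<in>UNIV. dder e (\<lambda>x. G x $ i $ i) x)\<^sup>2
    - (\<Sum>i\<in>UNIV. \<Sum>j\<in>UNIV. dder e (\<lambda>x. G x $ i $ j) x * dder e (\<lambda>x. G x $ j $ i) x)"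
proof -
  define G1 where "G1 x = (\<chi> i j. dder e (\<lambda>x. G x $ i $ j) x)" for x
  define G2 where "G2 x = (\<chi> i j. dder e (dder e (\<lambda>x. G x $ i $ j)) x)" for x
  define R where "R i x = set_row i (G1 x $ i) (G x)" for i x
  have G1: "smooth_on S (\<lambda>x. G1 x $ i $ j)" for i j
    using smooth_on_dder[OF G, of e i j] by (simp add: G1_def[abs_def])
  have R: "smooth_on S (\<lambda>x. R i x $ k $ j)" for i j k
    by (cases "k = i") (simp_all add: R_def set_row_nth G G1)
  have dR: "(\<chi> j. dder e (\<lambda>x. R i x $ k $ j) x) = (if k = i then G2 x $ i else G1 x $ k)" for i k
    by (auto simp: R_def set_row_nth G1_def[abs_def] G2_def vec_eq_iff eta_contract_eq)
  have 1: "dder e (\<lambda>x. det (G x)) y = (\<Sum>i\<in>UNIV. det (R i y))" if "y \<in> S" for y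
    unfolding dder_det[of S G, OF G that] R_def G1_def by simp
  have "dder e (dder e (\<lambda>x. det (G x))) x = dder e (\<lambda>y. \<Sum>i\<in>UNIV. det (R i y)) x"
    by (rule dder_cong[OF S x(1) 1])
  also have "\<dots> = (\<Sum>i\<in>UNIV. \<Sum>k\<in>UNIV. det (set_row k (if k = i then G2 x $ i else G1 x $ k) (R i x)))"
    by (subst dder_sum[where S = S]) (auto simp: x(1) smooth_on_det[OF S R] dder_det[of S "R _", OF R x(1)] dR)
  \<comment> \<open>The 2x2 minor vanishes for \<open>k = i\<close>, so it may be included for all
    pairs; this makes the double sum factor into traces.\<close>
  also have "\<dots> = (\<Sum>i\<in>UNIV. \<Sum>k\<in>UNIV. (if k = i then G2 x $ i $ i else 0) +
      (G1 x $ i $ i * G1 x $ k $ k - G1 x $ i $ k * G1 x $ k $ i))"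
  proof (intro sum.cong refl)
    fix i k
    have *: "set_row i v (set_row i w A) = set_row i v A" for v w and A :: "real^'n^'n"
      by (auto simp: set_row_def vec_eq_iff)
    show "det (set_row k (if k = i then G2 x $ i else G1 x $ k) (R i x)) =
      (if k = i then G2 x $ i $ i else 0) + (G1 x $ i $ i * G1 x $ k $ k - G1 x $ i $ k * G1 x $ k $ i)"
      using det_set_row_mat1[of i "G2 x $ i"] det_set_row2_mat1[of k i "G1 x $ k" "G1 x $ i"]
      by (auto simp: R_def x(2) * mult.commute)
  qed
  also have "\<dots> = (\<Sum>i\<in>UNIV. G2 x $ i $ i) + (\<Sum>i\<in>UNIV. G1 x $ i $ i) * (\<Sum>i\<in>UNIV. G1 x $ i $ i)
      - (\<Sum>i\<in>UNIV. \<Sum>k\<in>UNIV. G1 x $ i $ k * G1 x $ k $ i)"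
    by (simp add: sum.distrib sum_subtractf sum_product)
  finally show ?thesis
    by (simp add: G1_def G2_def power2_eq_square)
qed

subsection \<open>Orthonormal frames of hyperplanes\<close>

text \<open>A non-zero remainder would be orthogonal to the normal and to the frame, giving
  \<open>CARD('n) + 2\<close> orthogonal non-zero vectors in a space of dimension one less.\<close>

lemma hyperplane_expansion:
  fixes b :: "'n::finite \<Rightarrow> 'e::euclidean_space"
  assumes dim: "DIM('e) = CARD('n) + 1" and b: "\<And>i j. b i \<bullet> b j = (if i = j then 1 else 0)"
    and \<nu>: "\<nu> \<bullet> \<nu> = 1" "\<And>i. \<nu> \<bullet> b i = 0"
  shows "v = (v \<bullet> \<nu>) *\<^sub>R \<nu> + (\<Sum>i\<in>UNIV. (v \<bullet> b i) *\<^sub>R b i)"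
proof (rule ccontr)
  define r where "r = v - ((v \<bullet> \<nu>) *\<^sub>R \<nu> + (\<Sum>i\<in>UNIV. (v \<bullet> b i) *\<^sub>R b i))"
  assume "v \<noteq> (v \<bullet> \<nu>) *\<^sub>R \<nu> + (\<Sum>i\<in>UNIV. (v \<bullet> b i) *\<^sub>R b i)"
  then have r0: "r \<noteq> 0" by (simp add: r_def)
  have b\<nu>: "b i \<bullet> \<nu> = 0" for i using \<nu>(2) by (simp add: inner_commute)
  have r\<nu>: "r \<bullet> \<nu> = 0"
    using \<nu> b\<nu> by (simp add: r_def inner_diff_left inner_add_left inner_sum_left)
  have rb: "r \<bullet> b i = 0" for i
  proof -
    have "(\<Sum>j\<in>UNIV. (v \<bullet> b j) * (b j \<bullet> b i)) = (\<Sum>j\<in>UNIV. if j = i then v \<bullet> b j else 0)"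
      by (intro sum.cong) (auto simp: b)
    then show ?thesis
      using \<nu>(2) by (simp add: r_def inner_diff_left inner_add_left inner_sum_left)
  qed
  have "inj b" by (rule injI) (metis b zero_neq_one)
  moreover have "\<nu> \<notin> range b" using \<nu> by auto
  moreover have "r \<noteq> \<nu>" using \<nu>(1) r\<nu> by auto
  moreover have "r \<noteq> b i" for i using rb[of i] b[of i i] by auto
  ultimately have card: "card (insert r (insert \<nu> (range b))) = CARD('n) + 2"
    by (subst card_insert_disjoint) (auto simp: card_image card_insert_if)
  have "pairwise orthogonal (insert r (insert \<nu> (range b)))"
    using r\<nu> rb \<nu> b by (auto simp: pairwise_def orthogonal_def inner_commute)
  moreover have "0 \<notin> insert r (insert \<nu> (range b))"
    using r0 \<nu> b by (auto simp: ) (metis b inner_zero_left zero_neq_one)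
  ultimately have "independent (insert r (insert \<nu> (range b)))"
    by (rule pairwise_orthogonal_independent)
  then have "card (insert r (insert \<nu> (range b))) \<le> DIM('e)"
    using independent_bound by blast
  then show False using card dim by simp
qed

text \<open>Converts the orthogonality demanded of a normal variation into an equation between the
  velocity and a multiple of the unit normal.\<close>

lemma hyperplane_normal:
  fixes b :: "'n::finite \<Rightarrow> 'e::euclidean_space"
  assumes "DIM('e) = CARD('n) + 1" "\<And>i j. b i \<bullet> b j = (if i = j then 1 else 0)"
    "\<nu> \<bullet> \<nu> = 1" "\<And>i. \<nu> \<bullet> b i = 0" "\<And>i. v \<bullet> b i = 0"
  shows "v = (v \<bullet> \<nu>) *\<^sub>R \<nu>"
  using hyperplane_expansion[OF assms(1-4), of v] assms(5) by simp

text \<open>Applied to a derivative of the unit normal, whose squared length then becomes one row of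
  the double sum for the squared norm of the second fundamental form.\<close>

lemma hyperplane_norm:
  fixes b :: "'n::finite \<Rightarrow> 'e::euclidean_space"
  assumes "DIM('e) = CARD('n) + 1" "\<And>i j. b i \<bullet> b j = (if i = j then 1 else 0)"
    "\<nu> \<bullet> \<nu> = 1" "\<And>i. \<nu> \<bullet> b i = 0" "v \<bullet> \<nu> = 0"
  shows "v \<bullet> v = (\<Sum>i\<in>UNIV. (v \<bullet> b i)\<^sup>2)"
proof -
  have "v = (\<Sum>i\<in>UNIV. (v \<bullet> b i) *\<^sub>R b i)"
    using hyperplane_expansion[OF assms(1-4), of v] assms(5) by simp
  then have "v \<bullet> v = v \<bullet> (\<Sum>i\<in>UNIV. (v \<bullet> b i) *\<^sub>R b i)" by simp
  then show ?thesis by (simp add: inner_sum_right power2_eq_square)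
qed

text \<open>Indexing by \<open>'n\<close> lets the frame label the rows of a Gram matrix;
  injectivity of \<open>T\<close> makes the cardinalities match. The preimages \<open>q\<close> are
  the coordinate vectors along which chart expressions are differentiated.\<close>

lemma orthonormal_frame:
  fixes T :: "real^'n \<Rightarrow> 'e::euclidean_space"
  assumes T: "linear T" "inj T" and B: "orthonormal_basis (range T) B"
  obtains b q where "bij_betw b (UNIV::'n set) B" "\<And>i. T (q i) = b i"
    "\<And>i j. b i \<bullet> b j = (if i = j then 1 else 0)"
proof -
  have orth: "pairwise orthogonal B" and norm: "\<And>x. x \<in> B \<Longrightarrow> norm x = 1" and span: "span B = range T"
    using B by (auto simp: orthonormal_basis_def)
  have "independent B"
    using orth norm by (intro pairwise_orthogonal_independent) force+
  then have "card B = dim (range T)" "finite B"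
    using span by (metis dim_eq_card_independent dim_span, metis independent_imp_finite)
  moreover have "dim (range T) = CARD('n)"
    using dim_image_eq[OF T(1), of UNIV] T(2) by (simp add: dim_UNIV)
  ultimately obtain b where b: "bij_betw b (UNIV::'n set) B"
    by (metis finite_class.finite_UNIV finite_same_card_bij)
  have bB: "b i \<in> B" for i using b by (auto simp: bij_betw_def)
  then have "b i \<in> range T" for i using span span_superset[of B] by blast
  then have "\<exists>x. T x = b i" for i by (metis image_iff)
  then have "\<exists>q. \<forall>i. T (q i) = b i" by (intro choice) blast
  then obtain q where "\<And>i. T (q i) = b i" by blast
  moreover have "b i \<bullet> b j = (if i = j then 1 else 0)" for i j
  proof (cases "i = j")
    case False
    then have "b i \<noteq> b j" using b by (auto simp: bij_betw_def inj_on_def)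
    then have "orthogonal (b i) (b j)" using pairwiseD[OF orth bB bB] by blast
    with False show ?thesis by (simp add: orthogonal_def)
  next
    case True
    then show ?thesis using norm[OF bB, of i] dot_square_norm[of "b i"] by simp
  qed
  ultimately show thesis using that b by blast
qed

lemma orthonormal_basis_exists:
  assumes "subspace T"
  obtains B where "orthonormal_basis T B"
  using orthonormal_basis_subspace[OF assms] unfolding orthonormal_basis_def by metis

subsection \<open>Gradient and Hessian of the weight\<close>

lemma euclid_grad_eqI:
  assumes "GDERIV f p :> D" shows "euclid_grad f p = D"
  unfolding euclid_grad_def
proof (rule the_equality[where P = "\<lambda>D. GDERIV f p :> D", OF assms])
  fix D' assume "GDERIV f p :> D'"
  then have "(\<lambda>h. h \<bullet> D') = (\<lambda>h. h \<bullet> D)"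
    using assms unfolding gderiv_def by (metis has_derivative_unique)
  then show "D' = D" by (metis inner_commute vector_eq_rdot)
qed

lemma linear_Basis_expand:
  fixes T :: "'a::euclidean_space \<Rightarrow> 'b::real_vector"
  assumes "linear T"
  shows "T v = (\<Sum>b\<in>Basis. (v \<bullet> b) *\<^sub>R T b)"
proof -
  have "T v = T (\<Sum>b\<in>Basis. (v \<bullet> b) *\<^sub>R b)" by (simp add: euclidean_representation)
  also have "\<dots> = (\<Sum>b\<in>Basis. (v \<bullet> b) *\<^sub>R T b)"
    by (simp only: linear_sum[OF assms, of "\<lambda>b. (v \<bullet> b) *\<^sub>R b"] linear_cmul[OF assms])
  finally show ?thesis .
qed

lemma euclid_grad_eq:
  assumes "smooth_on UNIV f"
  shows "euclid_grad f p = (\<Sum>b\<in>Basis. dder b f p *\<^sub>R b)"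
proof (rule euclid_grad_eqI)
  have lin: "linear (\<lambda>v. dder v f p)" by (rule smooth_on_linear_dder[OF assms UNIV_I])
  have "dder h f p = h \<bullet> (\<Sum>b\<in>Basis. dder b f p *\<^sub>R b)" for h
    using linear_Basis_expand[OF lin, of h] by (simp add: inner_sum_right mult.commute)
  then have "(\<lambda>h. h \<bullet> (\<Sum>b\<in>Basis. dder b f p *\<^sub>R b)) = (\<lambda>h. dder h f p)" by metis
  then show "GDERIV f p :> (\<Sum>b\<in>Basis. dder b f p *\<^sub>R b)"
    unfolding gderiv_def using smooth_on_has_derivative[OF assms UNIV_I, of p] by metis
qed

lemma dder_eq_euclid_grad:
  assumes "smooth_on UNIV f"
  shows "dder v f p = euclid_grad f p \<bullet> v"
  using linear_Basis_expand[OF smooth_on_linear_dder[OF assms UNIV_I, of p], of v]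
  unfolding euclid_grad_eq[OF assms] by (simp add: inner_sum_left mult.commute inner_commute[of v])

lemma smooth_on_euclid_grad:
  assumes "smooth_on UNIV f"
  shows "smooth_on UNIV (euclid_grad f)"
  unfolding euclid_grad_eq[OF assms, abs_def]
  by (intro smooth_on_sum smooth_on_scaleR smooth_on_dder smooth_on_const assms open_UNIV)

lemma euclid_hess_eq: "euclid_hess f p v w = dder v (euclid_grad f) p \<bullet> w"
  by (simp add: euclid_hess_def dder_def)

subsection \<open>The weighted area density of a family of parametrized hypersurfaces\<close>

text \<open>The first fundamental form of a time slice, evaluated on arbitrary constant coordinate
  vectors \<open>q\<close>. The coordinate basis gives the area density, while a well chosen
  \<open>q\<close> gives the identity matrix at a prescribed point.\<close>

definition gram :: "('n \<Rightarrow> real^'n) \<Rightarrow> (real \<times> (real^'n) \<Rightarrow> 'e::real_inner) \<Rightarrow> real \<times> (real^'n) \<Rightarrow> real^'n^'n" where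
  "gram q \<Phi> p = (\<chi> i j. dder (0, q i) \<Phi> p \<bullet> dder (0, q j) \<Phi> p)"

abbreviation gram_det :: "(real \<times> (real^'n) \<Rightarrow> 'e::real_inner) \<Rightarrow> real \<times> (real^'n) \<Rightarrow> real" where
  "gram_det \<Phi> p \<equiv> det (gram (\<lambda>i. axis i 1) \<Phi> p)"

text \<open>The logarithm of \<open>weighted_density\<close> where the Gram determinant is positive.
  Logarithmically, a change of the constant frame is a constant shift.\<close>

definition log_density :: "('e::real_inner \<Rightarrow> real) \<Rightarrow> (real \<times> (real^'n) \<Rightarrow> 'e) \<Rightarrow> real \<times> (real^'n) \<Rightarrow> real" where
  "log_density f \<Phi> p = f (\<Phi> p) + ln (gram_det \<Phi> p) / 2"

definition weighted_density :: "('e::real_inner \<Rightarrow> real) \<Rightarrow> (real \<times> (real^'n) \<Rightarrow> 'e) \<Rightarrow> real \<times> (real^'n) \<Rightarrow> real" where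
  "weighted_density f \<Phi> p = exp (f (\<Phi> p)) * sqrt (gram_det \<Phi> p)"

lemma gram_nth: "gram q \<Phi> p $ i $ j = dder (0, q i) \<Phi> p \<bullet> dder (0, q j) \<Phi> p"
  by (simp add: gram_def)

lemma smooth_on_gram:
  assumes "open S" "smooth_on S \<Phi>"
  shows "smooth_on S (\<lambda>p. gram q \<Phi> p $ i $ j)"
  unfolding gram_nth by (intro smooth_on_inner smooth_on_dder assms)

lemma smooth_on_gram_det:
  assumes "open S" "smooth_on S \<Phi>"
  shows "smooth_on S (\<lambda>p. det (gram q \<Phi> p))"
  by (intro smooth_on_det smooth_on_gram assms)

lemma linear_dder_spatial:
  fixes \<Phi> :: "real \<times> (real^'n) \<Rightarrow> 'e::euclidean_space"
  assumes "smooth_on S \<Phi>" "p \<in> S"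
  shows "linear (\<lambda>v. dder (0, v) \<Phi> p)"
  using linear_compose[OF _ smooth_on_linear_dder[OF assms], of "\<lambda>v. (0, v)"]
  by (simp add: o_def linear_iff)

lemma dder_spatial_expand:
  fixes \<Phi> :: "real \<times> (real^'n) \<Rightarrow> 'e::euclidean_space"
  assumes "smooth_on S \<Phi>" "p \<in> S"
  shows "dder (0, v) \<Phi> p = (\<Sum>k\<in>UNIV. v $ k *\<^sub>R dder (0, axis k 1) \<Phi> p)"
proof -
  have "v = (\<Sum>k\<in>UNIV. v $ k *\<^sub>R axis k 1)"
    using basis_expansion[of v] by (simp add: scalar_mult_eq_scaleR)
  then have "dder (0, v) \<Phi> p = dder (0, \<Sum>k\<in>UNIV. v $ k *\<^sub>R axis k 1) \<Phi> p" by simp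
  also have "\<dots> = (\<Sum>k\<in>UNIV. v $ k *\<^sub>R dder (0, axis k 1) \<Phi> p)"
    by (simp only: linear_sum[OF linear_dder_spatial[OF assms], of "\<lambda>k. v $ k *\<^sub>R axis k 1"]
        linear_cmul[OF linear_dder_spatial[OF assms]])
  finally show ?thesis .
qed

text \<open>With \<open>Q\<close> the matrix of rows \<open>q i\<close> and \<open>G\<close> the
  coordinate Gram matrix, the new one is \<open>Q G Q^T\<close>. The factor
  \<open>(det Q)\<^sup>2\<close> is the same at every point, although \<open>q\<close> is usually
  adapted to a single one.\<close>

lemma det_gram_basis:
  fixes \<Phi> :: "real \<times> (real^'n) \<Rightarrow> 'e::euclidean_space"
  assumes "smooth_on S \<Phi>" "p \<in> S"
  shows "det (gram q \<Phi> p) = (det (\<chi> i. q i))\<^sup>2 * gram_det \<Phi> p"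
proof -
  let ?Q = "\<chi> i. q i" and ?G = "gram (\<lambda>i. axis i 1) \<Phi> p"
  have "gram q \<Phi> p $ i $ j = (?Q ** ?G ** transpose ?Q) $ i $ j" for i j
  proof -
    have "gram q \<Phi> p $ i $ j = (\<Sum>l\<in>UNIV. \<Sum>k\<in>UNIV. q i $ k * q j $ l * (?G $ k $ l))"
      unfolding gram_nth dder_spatial_expand[OF assms, of "q _"]
      by (simp add: inner_sum_left inner_sum_right sum_distrib_left mult_ac)
    also have "\<dots> = (?Q ** ?G ** transpose ?Q) $ i $ j"
      by (simp add: matrix_matrix_mult_def transpose_def sum_distrib_left sum_distrib_right mult_ac)
    finally show ?thesis .
  qed
  then have "gram q \<Phi> p = ?Q ** ?G ** transpose ?Q" by (simp add: vec_eq_iff)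
  then show ?thesis by (simp add: det_mul det_transpose power2_eq_square)
qed

lemma gram_det_pos_of_orthonormal:
  fixes \<Phi> :: "real \<times> (real^'n) \<Rightarrow> 'e::euclidean_space"
  assumes "smooth_on S \<Phi>" "p \<in> S" "gram q \<Phi> p = mat 1"
  shows "gram_det \<Phi> p > 0" "det (\<chi> i. q i) \<noteq> 0"
proof -
  have *: "(det (\<chi> i. q i))\<^sup>2 * gram_det \<Phi> p = 1"
    using det_gram_basis[OF assms(1,2), of q] assms(3) by simp
  then show "det (\<chi> i. q i) \<noteq> 0" by auto
  then have "(det (\<chi> i. q i))\<^sup>2 > 0" by simp
  with * show "gram_det \<Phi> p > 0" by (metis zero_less_mult_pos zero_less_one)
qed

text \<open>An injective differential has a frame with identity Gram matrix, so the determinant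
  times a square equals 1.\<close>

lemma gram_det_pos:
  fixes \<Phi> :: "real \<times> (real^'n) \<Rightarrow> 'e::euclidean_space"
  assumes "smooth_on S \<Phi>" "p \<in> S" "inj (\<lambda>v. dder (0, v) \<Phi> p)"
  shows "gram_det \<Phi> p > 0"
proof -
  have lin: "linear (\<lambda>v. dder (0, v) \<Phi> p)" by (rule linear_dder_spatial[OF assms(1,2)])
  obtain B where B: "orthonormal_basis (range (\<lambda>v. dder (0, v) \<Phi> p)) B"
    using orthonormal_basis_exists[OF linear_subspace_image[OF lin subspace_UNIV]] .
  obtain b q where "bij_betw b (UNIV::'n set) B" "\<And>i. dder (0, q i) \<Phi> p = b i"
    "\<And>i j. b i \<bullet> b j = (if i = j then 1 else 0)"
    by (rule orthonormal_frame[OF lin assms(3) B]) (rule that)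
  then have "gram q \<Phi> p = mat 1" by (simp add: vec_eq_iff gram_nth mat_def)
  then show ?thesis using gram_det_pos_of_orthonormal[OF assms(1,2)] by blast
qed

text \<open>A kernel vector of the differential is also annihilated by the Gram matrix.\<close>

lemma inj_of_gram_det_nonzero:
  fixes \<Phi> :: "real \<times> (real^'n) \<Rightarrow> 'e::euclidean_space"
  assumes "smooth_on S \<Phi>" "p \<in> S" "gram_det \<Phi> p \<noteq> 0"
  shows "inj (\<lambda>v. dder (0, v) \<Phi> p)"
proof -
  have lin: "linear (\<lambda>v. dder (0, v) \<Phi> p)" by (rule linear_dder_spatial[OF assms(1,2)])
  have "v = 0" if v: "dder (0, v) \<Phi> p = 0" for v
  proof -
    let ?G = "gram (\<lambda>i. axis i 1) \<Phi> p"
    have "(?G *v v) $ i = dder (0, axis i 1) \<Phi> p \<bullet> dder (0, v) \<Phi> p" for i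
      unfolding dder_spatial_expand[OF assms(1,2), of v]
      by (simp add: matrix_vector_mult_def gram_nth inner_sum_right mult.commute)
    then have "?G *v v = 0" using v by (simp add: vec_eq_iff)
    then show "v = 0"
      using assms(3) by (metis invertible_det_nz matrix_left_invertible_ker invertible_left_inverse)
  qed
  then show ?thesis using linear_injective_0[OF lin] by blast
qed

lemma exp_log_density:
  "gram_det \<Phi> p > 0 \<Longrightarrow> weighted_density f \<Phi> p = exp (log_density f \<Phi> p)"
  by (simp add: weighted_density_def log_density_def exp_add ln_sqrt[symmetric])

lemma open_gram_det_pos:
  assumes "open S" "smooth_on S \<Phi>"
  shows "open {p \<in> S. gram_det \<Phi> p > 0}"
proof -
  have "continuous_on S (gram_det \<Phi>)"
    using smooth_on_imp_continuous_on[OF smooth_on_gram_det[OF assms]] .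
  from continuous_open_preimage[OF this assms(1) open_greaterThan[of 0]]
  show ?thesis by (simp add: vimage_def Int_def)
qed

lemma smooth_on_compose_UNIV:
  fixes \<Phi> :: "'a::real_normed_vector \<Rightarrow> 'e::euclidean_space"
  shows "open S \<Longrightarrow> smooth_on UNIV f \<Longrightarrow> smooth_on S \<Phi> \<Longrightarrow> smooth_on S (\<lambda>p. f (\<Phi> p))"
  by (rule smooth_on_compose) auto

lemma smooth_on_ln_pos:
  assumes "open S" "smooth_on S h" "\<And>p. p \<in> S \<Longrightarrow> h p > 0"
  shows "smooth_on S (\<lambda>p. ln (h p :: real))"
  by (rule smooth_on_compose[OF assms(1) smooth_on_ln assms(2)]) (use assms(3) in auto)

lemma smooth_on_log_density:
  fixes \<Phi> :: "real \<times> (real^'n) \<Rightarrow> 'e::euclidean_space"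
  assumes "open S" "smooth_on S \<Phi>" "smooth_on UNIV f" "\<And>p. p \<in> S \<Longrightarrow> gram_det \<Phi> p > 0"
  shows "smooth_on S (log_density f \<Phi>)"
proof -
  have "smooth_on S (\<lambda>p. f (\<Phi> p) + ln (gram_det \<Phi> p) * (1/2))"
    by (rule smooth_on_add[OF assms(1) smooth_on_compose_UNIV[OF assms(1,3,2)]
          smooth_on_mult[OF assms(1) smooth_on_ln_pos[OF assms(1) smooth_on_gram_det[OF assms(1,2)] assms(4)]
            smooth_on_const]])
  then show ?thesis by (simp add: log_density_def[abs_def])
qed

lemma smooth_on_weighted_density:
  fixes \<Phi> :: "real \<times> (real^'n) \<Rightarrow> 'e::euclidean_space"
  assumes "open S" "smooth_on S \<Phi>" "smooth_on UNIV f" "\<And>p. p \<in> S \<Longrightarrow> gram_det \<Phi> p > 0"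
  shows "smooth_on S (weighted_density f \<Phi>)"
proof -
  have "smooth_on S (\<lambda>p. exp (log_density f \<Phi> p))"
    by (rule smooth_on_compose[OF assms(1) smooth_on_exp smooth_on_log_density[OF assms]]) auto
  then show ?thesis
    by (subst smooth_on_cong[OF assms(1)]) (auto intro: exp_log_density assms(4))
qed

lemma dder_weighted_density:
  fixes \<Phi> :: "real \<times> (real^'n) \<Rightarrow> 'e::euclidean_space"
  assumes "open S" "smooth_on S \<Phi>" "smooth_on UNIV f" "\<And>p. p \<in> S \<Longrightarrow> gram_det \<Phi> p > 0" "p \<in> S"
  shows "dder e (weighted_density f \<Phi>) p = weighted_density f \<Phi> p * dder e (log_density f \<Phi>) p"
proof -
  have "dder e (weighted_density f \<Phi>) p = dder e (\<lambda>p. exp (log_density f \<Phi> p)) p"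
    by (rule dder_cong[OF assms(1,5)]) (rule exp_log_density[OF assms(4)])
  then show ?thesis
    using dder_exp[OF smooth_on_log_density[OF assms(1-4)] assms(5)] exp_log_density[OF assms(4)[OF assms(5)], of f]
    by simp
qed

lemma dder2_weighted_density:
  fixes \<Phi> :: "real \<times> (real^'n) \<Rightarrow> 'e::euclidean_space"
  assumes "open S" "smooth_on S \<Phi>" "smooth_on UNIV f" "\<And>p. p \<in> S \<Longrightarrow> gram_det \<Phi> p > 0" "p \<in> S"
  shows "dder e (dder e (weighted_density f \<Phi>)) p =
    weighted_density f \<Phi> p * (dder e (dder e (log_density f \<Phi>)) p + (dder e (log_density f \<Phi>) p)\<^sup>2)"
proof -
  have "dder e (dder e (weighted_density f \<Phi>)) p
      = dder e (\<lambda>p. weighted_density f \<Phi> p * dder e (log_density f \<Phi>) p) p"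
    by (rule dder_cong[OF assms(1,5)]) (rule dder_weighted_density[OF assms(1-4)])
  then show ?thesis
    using dder_mult[OF smooth_on_weighted_density[OF assms(1-4)] smooth_on_dder[OF smooth_on_log_density[OF assms(1-4)]] assms(5), of e]
      dder_weighted_density[OF assms, of e]
    by (simp add: algebra_simps power2_eq_square)
qed

text \<open>In the frame \<open>q\<close> the log density is \<open>f + ln (det G) / 2\<close> up to
  a constant, with \<open>G = mat 1\<close> at \<open>p0\<close>. Passing from the determinant to
  its logarithm cancels the squared trace, leaving \<open>tr G'' - tr (G' G')\<close> in second
  order.\<close>

lemma log_density_derivatives:
  fixes \<Phi> :: "real \<times> (real^'n) \<Rightarrow> 'e::euclidean_space"
  assumes S: "open S" and \<Phi>: "smooth_on S \<Phi>" and f: "smooth_on UNIV f"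
    and p0: "p0 \<in> S" "gram q \<Phi> p0 = mat 1"
  shows "dder e (log_density f \<Phi>) p0
      = dder e (\<lambda>p. f (\<Phi> p)) p0 + (\<Sum>i\<in>UNIV. dder e (\<lambda>p. gram q \<Phi> p $ i $ i) p0) / 2" (is ?first)
    and "dder e (dder e (log_density f \<Phi>)) p0
      = dder e (dder e (\<lambda>p. f (\<Phi> p))) p0 + ((\<Sum>i\<in>UNIV. dder e (dder e (\<lambda>p. gram q \<Phi> p $ i $ i)) p0)
        - (\<Sum>i\<in>UNIV. \<Sum>j\<in>UNIV. dder e (\<lambda>p. gram q \<Phi> p $ i $ j) p0 * dder e (\<lambda>p. gram q \<Phi> p $ j $ i) p0)) / 2" (is ?second)
proof -
  define W where "W p = det (gram q \<Phi> p)" for p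
  \<comment> \<open>The logarithm is smooth on this open set, which contains \<open>p0\<close>
    because an identity Gram matrix in the frame \<open>q\<close> forces a positive coordinate
    determinant.\<close>
  define S' where "S' = {p \<in> S. gram_det \<Phi> p > 0}"
  have S': "open S'" "S' \<subseteq> S" using open_gram_det_pos[OF S \<Phi>] by (auto simp: S'_def)
  have \<Phi>': "smooth_on S' \<Phi>" using smooth_on_subset[OF \<Phi> S'(2)] .
  have p0': "p0 \<in> S'" using p0 gram_det_pos_of_orthonormal[OF \<Phi>] by (auto simp: S'_def)
  have Q: "det (\<chi> i. q i) \<noteq> 0" using gram_det_pos_of_orthonormal[OF \<Phi> p0] by auto
  have W: "W p = (det (\<chi> i. q i))\<^sup>2 * gram_det \<Phi> p" if "p \<in> S'" for p
    unfolding W_def using det_gram_basis[OF \<Phi>' that] .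
  have Wpos: "W p > 0" if "p \<in> S'" for p
    using W[OF that] Q that by (simp add: S'_def)
  have W0: "W p0 = 1" using p0 by (simp add: W_def)
  have fs: "smooth_on S' (\<lambda>p. f (\<Phi> p))" by (rule smooth_on_compose_UNIV[OF S'(1) f \<Phi>'])
  have Ws: "smooth_on S' W" unfolding W_def[abs_def] by (rule smooth_on_gram_det[OF S'(1) \<Phi>'])
  have lnW: "smooth_on S' (\<lambda>p. ln (W p))" by (rule smooth_on_ln_pos[OF S'(1) Ws Wpos])
  \<comment> \<open>The shift caused by replacing the coordinate basis by \<open>q\<close>; it
    disappears on differentiation.\<close>
  let ?c = "- ln ((det (\<chi> i. q i))\<^sup>2) / 2"
  have ld: "log_density f \<Phi> p = f (\<Phi> p) + (1/2) *\<^sub>R ln (W p) + ?c" if "p \<in> S'" for p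
  proof -
    have "gram_det \<Phi> p > 0" using that by (simp add: S'_def)
    then have "ln (W p) = ln ((det (\<chi> i. q i))\<^sup>2) + ln (gram_det \<Phi> p)"
      unfolding W[OF that] using Q by (intro ln_mult_pos) simp_all
    then show ?thesis unfolding log_density_def by (simp add: field_simps)
  qed
  have d1: "dder e (log_density f \<Phi>) p = dder e (\<lambda>p. f (\<Phi> p)) p + (1/2) *\<^sub>R dder e (\<lambda>p. ln (W p)) p"
    if "p \<in> S'" for p
  proof -
    have "dder e (log_density f \<Phi>) p = dder e (\<lambda>p. f (\<Phi> p) + (1/2) *\<^sub>R ln (W p) + ?c) p"
      by (rule dder_cong[OF S'(1) that ld])
    also have "\<dots> = dder e (\<lambda>p. f (\<Phi> p)) p + (1/2) *\<^sub>R dder e (\<lambda>p. ln (W p)) p"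
      by (rule trans[OF dder_eqI[OF has_derivative_add[OF has_derivative_add[OF smooth_on_has_derivative[OF fs that]
        has_derivative_scaleR_right[OF smooth_on_has_derivative[OF lnW that]]] has_derivative_const]]]) simp
    finally show ?thesis .
  qed
  have dln: "dder e (\<lambda>p. ln (W p)) p * W p = dder e W p" if "p \<in> S'" for p
    using dder_ln[OF Ws that Wpos[OF that], of e] Wpos[OF that] by simp
  have first: "dder e (\<lambda>p. ln (W p)) p0 = dder e W p0" using dln[OF p0'] W0 by simp
  \<comment> \<open>Differentiating the identity \<open>(ln W)' * W = W'\<close> once more avoids
    quotients; \<open>W p0 = 1\<close> then isolates the second derivative of
    \<open>ln W\<close>.\<close>
  have "dder e (dder e W) p0 = dder e (\<lambda>p. dder e (\<lambda>p. ln (W p)) p * W p) p0"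
    by (rule dder_cong[OF S'(1) p0']) (simp add: dln)
  also have "\<dots> = dder e (dder e (\<lambda>p. ln (W p))) p0 + (dder e W p0)\<^sup>2"
    using dder_mult[OF smooth_on_dder[OF lnW] Ws p0', of e e] first W0 by (simp add: power2_eq_square)
  finally have second: "dder e (dder e (\<lambda>p. ln (W p))) p0 = dder e (dder e W) p0 - (dder e W p0)\<^sup>2" by simp
  have d2: "dder e (dder e (log_density f \<Phi>)) p0
      = dder e (dder e (\<lambda>p. f (\<Phi> p))) p0 + (1/2) *\<^sub>R dder e (dder e (\<lambda>p. ln (W p))) p0"
  proof -
    have "dder e (dder e (log_density f \<Phi>)) p0
      = dder e (\<lambda>p. dder e (\<lambda>p. f (\<Phi> p)) p + (1/2) *\<^sub>R dder e (\<lambda>p. ln (W p)) p) p0"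
      by (rule dder_cong[OF S'(1) p0' d1])
    also have "\<dots> = dder e (dder e (\<lambda>p. f (\<Phi> p))) p0 + (1/2) *\<^sub>R dder e (dder e (\<lambda>p. ln (W p))) p0"
      by (rule dder_eqI[OF has_derivative_add[OF smooth_on_has_derivative[OF smooth_on_dder[OF fs] p0']
        has_derivative_scaleR_right[OF smooth_on_has_derivative[OF smooth_on_dder[OF lnW] p0']]]])
    finally show ?thesis .
  qed
  have G: "smooth_on S' (\<lambda>p. gram q \<Phi> p $ i $ j)" for i j by (rule smooth_on_gram[OF S'(1) \<Phi>'])
  have W1: "dder e W p0 = (\<Sum>i\<in>UNIV. dder e (\<lambda>p. gram q \<Phi> p $ i $ i) p0)"
    unfolding W_def[abs_def] by (rule dder_det_mat1[OF G p0' p0(2)])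
  show ?first using d1[OF p0'] first W1 by simp
  show ?second
    using d2 second dder2_det_mat1[of S' "gram q \<Phi>", OF S'(1) G p0' p0(2), of e] W1
    by (simp add: W_def[abs_def])
qed

subsection \<open>Pointwise variation formulas\<close>

lemma dder_weight:
  fixes \<Phi> :: "'a::real_normed_vector \<Rightarrow> 'e::euclidean_space"
  assumes "smooth_on S \<Phi>" "p \<in> S" "smooth_on UNIV f"
  shows "dder e (\<lambda>p. f (\<Phi> p)) p = euclid_grad f (\<Phi> p) \<bullet> dder e \<Phi> p"
  using dder_compose[OF assms(1,2,3) UNIV_I] dder_eq_euclid_grad[OF assms(3)] by simp

text \<open>Commuting time and space derivatives turns the time derivative of a tangent vector into
  a space derivative of \<open>w n\<close>; the part with the derivative of \<open>w\<close> drops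
  out since \<open>n\<close> is orthogonal to the frame. Only the velocity at time 0 enters, so the
  straight-line family \<open>X + t N\<close> is covered as well.\<close>

lemma first_variation_pointwise:
  fixes \<Phi> :: "real \<times> (real^'n) \<Rightarrow> 'e::euclidean_space" and q :: "'n \<Rightarrow> real^'n"
  assumes S: "open S" and \<Phi>: "smooth_on S \<Phi>" and f: "smooth_on UNIV f"
    and V: "open V" "\<And>y. y \<in> V \<Longrightarrow> (0, y) \<in> S" and y0: "y0 \<in> V"
    and n: "smooth_on V n" and w: "smooth_on V w"
    and vel: "\<And>y. y \<in> V \<Longrightarrow> dt \<Phi> (0, y) = w y *\<^sub>R n y"
    and frame: "\<And>i. dder (0, q i) \<Phi> (0, y0) = b i" "\<And>i j. b i \<bullet> b j = (if i = j then 1 else 0)"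
      "\<And>i. n y0 \<bullet> b i = 0"
  shows "dt (log_density f \<Phi>) (0, y0)
    = w y0 * ((\<Sum>i\<in>UNIV. dder (q i) n y0 \<bullet> b i) + euclid_grad f (\<Phi> (0, y0)) \<bullet> n y0)"
proof -
  let ?e = "(1, 0) :: real \<times> (real^'n)"
  have p0: "(0, y0) \<in> S" using V y0 by blast
  have mixed: "dder ?e (dder (0, q i) \<Phi>) (0, y0) = dder (q i) w y0 *\<^sub>R n y0 + w y0 *\<^sub>R dder (q i) n y0" for i
  proof -
    have "dder ?e (dder (0, q i) \<Phi>) (0, y0) = dder (0, q i) (dder ?e \<Phi>) (0, y0)"
      by (rule dder_commute[OF S \<Phi> p0])
    also have "\<dots> = dder (q i) (\<lambda>y. dder ?e \<Phi> (0, y)) y0"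
      by (rule dder_slice[OF smooth_on_dder[OF \<Phi>] p0, symmetric])
    also have "\<dots> = dder (q i) (\<lambda>y. w y *\<^sub>R n y) y0"
      by (rule dder_cong[OF V(1) y0 vel])
    also have "\<dots> = dder (q i) w y0 *\<^sub>R n y0 + w y0 *\<^sub>R dder (q i) n y0"
      by (rule dder_scaleR[OF w n y0])
    finally show ?thesis .
  qed
  have G: "dder ?e (\<lambda>p. gram q \<Phi> p $ i $ i) (0, y0) = 2 * w y0 * (dder (q i) n y0 \<bullet> b i)" for i
    unfolding gram_nth
    by (subst dder_inner[OF smooth_on_dder[OF \<Phi>] smooth_on_dder[OF \<Phi>] p0])
       (simp add: mixed frame inner_add_left inner_add_right inner_commute[of "b i"])
  have "gram q \<Phi> (0, y0) = mat 1" using frame by (simp add: vec_eq_iff gram_nth mat_def)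
  from log_density_derivatives(1)[OF S \<Phi> f p0 this, of ?e]
  show ?thesis
    unfolding G dder_weight[OF \<Phi> p0 f] vel[OF y0]
    by (simp add: sum_distrib_left[symmetric] algebra_simps)
qed

text \<open>Here the velocity must be normal for all times in \<open>S\<close>: the Gram matrix
  evolves by \<phi> times the symmetrized second fundamental form, and this evolution equation is
  itself differentiated in time.\<close>

lemma second_variation_pointwise:
  fixes \<Phi> \<nu> :: "real \<times> (real^'n) \<Rightarrow> 'e::euclidean_space" and q :: "'n \<Rightarrow> real^'n"
  assumes dim: "DIM('e) = CARD('n) + 1"
    and S: "open S" and \<Phi>: "smooth_on S \<Phi>" and \<nu>: "smooth_on S \<nu>" and f: "smooth_on UNIV f"
    and \<nu>1: "\<And>p. p \<in> S \<Longrightarrow> \<nu> p \<bullet> \<nu> p = 1"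
    and \<nu>n: "\<And>p v. p \<in> S \<Longrightarrow> \<nu> p \<bullet> dder (0, v) \<Phi> p = 0"
    and \<phi>: "smooth_on S \<phi>" "\<And>p. p \<in> S \<Longrightarrow> dt \<Phi> p = \<phi> p *\<^sub>R \<nu> p"
    and p0: "p0 \<in> S"
    and frame: "\<And>i. dder (0, q i) \<Phi> p0 = b i" "\<And>i j. b i \<bullet> b j = (if i = j then 1 else 0)"
  shows "dt (dt (log_density f \<Phi>)) p0
    = dt \<phi> p0 * ((\<Sum>i\<in>UNIV. dder (0, q i) \<nu> p0 \<bullet> b i) + euclid_grad f (\<Phi> p0) \<bullet> \<nu> p0)
     + \<phi> p0 * ((\<Sum>i\<in>UNIV. dder (0, q i) (dt \<nu>) p0 \<bullet> b i)
       - (\<Sum>i\<in>UNIV. \<Sum>j\<in>UNIV. (dder (0, q i) \<nu> p0 \<bullet> b j)\<^sup>2) * \<phi> p0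
       + euclid_hess f (\<Phi> p0) (\<nu> p0) (\<nu> p0) * \<phi> p0
       + euclid_grad f (\<Phi> p0) \<bullet> dt \<nu> p0)"
proof -
  let ?e = "(1, 0) :: real \<times> (real^'n)"
  \<comment> \<open>The second fundamental form on the frame vectors, kept as a function of space
    and time so that its time derivative makes sense.\<close>
  define B where "B i j p = dder (0, q i) \<nu> p \<bullet> dder (0, q j) \<Phi> p" for i j p
  have sd: "smooth_on S (dder v \<Phi>)" "smooth_on S (dder v \<nu>)" for v
    by (rule smooth_on_dder[OF \<Phi>]) (rule smooth_on_dder[OF \<nu>])
  have sB: "smooth_on S (B i j)" for i j
    unfolding B_def[abs_def] by (rule smooth_on_inner[OF S sd(2) sd(1)])
  have mixed: "dder ?e (dder (0, v) \<Phi>) p = dder (0, v) \<phi> p *\<^sub>R \<nu> p + \<phi> p *\<^sub>R dder (0, v) \<nu> p"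
    if p: "p \<in> S" for v p
  proof -
    have "dder ?e (dder (0, v) \<Phi>) p = dder (0, v) (dder ?e \<Phi>) p"
      by (rule dder_commute[OF S \<Phi> p])
    also have "\<dots> = dder (0, v) (\<lambda>p. \<phi> p *\<^sub>R \<nu> p) p"
      by (rule dder_cong[OF S p \<phi>(2)])
    also have "\<dots> = dder (0, v) \<phi> p *\<^sub>R \<nu> p + \<phi> p *\<^sub>R dder (0, v) \<nu> p"
      by (rule dder_scaleR[OF \<phi>(1) \<nu> p])
    finally show ?thesis .
  qed
  have G1: "dder ?e (\<lambda>p. gram q \<Phi> p $ i $ j) p = \<phi> p * (B i j p + B j i p)" if p: "p \<in> S" for i j p
    unfolding gram_nth B_def
    by (subst dder_inner[OF sd(1) sd(1) p])
       (simp add: mixed[OF p] \<nu>n[OF p] inner_add_left inner_add_right inner_commute[of _ "\<nu> p"]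
         inner_commute[of _ "dder _ \<nu> p"] algebra_simps)
  have \<nu>d: "\<nu> p0 \<bullet> dder v \<nu> p0 = 0" for v
  proof -
    have "dder v (\<lambda>p. \<nu> p \<bullet> \<nu> p) p0 = dder v (\<lambda>p. 1) p0" by (rule dder_cong[OF S p0 \<nu>1])
    also have "\<dots> = 0" by (simp add: dder_def)
    finally show ?thesis using dder_inner[OF \<nu> \<nu> p0, of v] by (simp add: inner_commute)
  qed
  have B0: "B i j p0 = dder (0, q i) \<nu> p0 \<bullet> b j" for i j by (simp add: B_def frame)
  \<comment> \<open>Differentiating the orthogonality of \<nu> and the \<open>q j\<close>-derivative
    of \<Phi> in direction \<open>q i\<close> moves the derivative onto \<Phi>, where mixed
    derivatives commute.\<close>
  have Bsym: "B i j p0 = B j i p0" for i j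
  proof -
    have *: "B i j p0 = - (\<nu> p0 \<bullet> dder (0, q i) (dder (0, q j) \<Phi>) p0)" for i j
    proof -
      have "dder (0, q i) (\<lambda>p. \<nu> p \<bullet> dder (0, q j) \<Phi> p) p0 = dder (0, q i) (\<lambda>p. 0) p0"
        by (rule dder_cong[OF S p0 \<nu>n])
      also have "\<dots> = 0" by (simp add: dder_def)
      finally show ?thesis using dder_inner[OF \<nu> sd(1) p0, of "(0, q i)" "(0, q j)"] by (simp add: B_def)
    qed
    show ?thesis unfolding * using dder_commute[OF S \<Phi> p0] by metis
  qed
  \<comment> \<open>The moving tangent vector contributes \<phi> times the squared length of the
    \<open>q i\<close>-derivative of \<nu>; that derivative is tangent, so its length is computed in
    the frame.\<close>
  have B1: "dder ?e (B i i) p0 = dder (0, q i) (dder ?e \<nu>) p0 \<bullet> b i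
      + \<phi> p0 * (\<Sum>j\<in>UNIV. (dder (0, q i) \<nu> p0 \<bullet> b j)\<^sup>2)" for i
  proof -
    have "dder (0, q i) \<nu> p0 \<bullet> dder (0, q i) \<nu> p0 = (\<Sum>j\<in>UNIV. (dder (0, q i) \<nu> p0 \<bullet> b j)\<^sup>2)"
      using \<nu>d \<nu>n[OF p0] frame by (intro hyperplane_norm[OF dim _ \<nu>1[OF p0]]) (metis inner_commute)+
    moreover have "dder ?e (dder (0, q i) \<nu>) p0 = dder (0, q i) (dder ?e \<nu>) p0"
      by (rule dder_commute[OF S \<nu> p0])
    moreover have "dder (0, q i) \<nu> p0 \<bullet> \<nu> p0 = 0" using \<nu>d by (simp add: inner_commute)
    ultimately show ?thesis
      unfolding B_def[abs_def]
      by (subst dder_inner[OF sd(2) sd(1) p0]) (simp add: mixed[OF p0] frame inner_add_right)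
  qed
  have G2: "dder ?e (dder ?e (\<lambda>p. gram q \<Phi> p $ i $ i)) p0
      = 2 * (dder ?e \<phi> p0 * B i i p0 + \<phi> p0 * dder ?e (B i i) p0)" for i
  proof -
    have "dder ?e (dder ?e (\<lambda>p. gram q \<Phi> p $ i $ i)) p0 = dder ?e (\<lambda>p. (2 * \<phi> p) * B i i p) p0"
      by (rule dder_cong[OF S p0]) (simp add: G1)
    also have "\<dots> = dder ?e (\<lambda>p. 2 * \<phi> p) p0 * B i i p0 + (2 * \<phi> p0) * dder ?e (B i i) p0"
      by (rule dder_mult[OF smooth_on_mult[OF S smooth_on_const \<phi>(1)] sB p0])
    also have "dder ?e (\<lambda>p. 2 * \<phi> p) p0 = 2 * dder ?e \<phi> p0"
      using dder_mult[OF smooth_on_const \<phi>(1) p0, of ?e 2] by (simp add: dder_def)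
    finally show ?thesis by (simp add: algebra_simps)
  qed
  have g: "smooth_on S (\<lambda>p. euclid_grad f (\<Phi> p))"
    by (rule smooth_on_compose_UNIV[OF S smooth_on_euclid_grad[OF f] \<Phi>])
  have f1: "dder ?e (\<lambda>p. f (\<Phi> p)) p = \<phi> p * (euclid_grad f (\<Phi> p) \<bullet> \<nu> p)" if "p \<in> S" for p
    using dder_weight[OF \<Phi> that f, of ?e] \<phi>(2)[OF that] by simp
  have dg: "dder ?e (\<lambda>p. euclid_grad f (\<Phi> p)) p0 \<bullet> \<nu> p0 = \<phi> p0 * euclid_hess f (\<Phi> p0) (\<nu> p0) (\<nu> p0)"
  proof -
    have "dder ?e (\<lambda>p. euclid_grad f (\<Phi> p)) p0 = dder (\<phi> p0 *\<^sub>R \<nu> p0) (euclid_grad f) (\<Phi> p0)"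
      using dder_compose[OF \<Phi> p0 smooth_on_euclid_grad[OF f] UNIV_I, of ?e] \<phi>(2)[OF p0] by simp
    also have "\<dots> = \<phi> p0 *\<^sub>R dder (\<nu> p0) (euclid_grad f) (\<Phi> p0)"
      by (rule linear_cmul[OF smooth_on_linear_dder[OF smooth_on_euclid_grad[OF f] UNIV_I]])
    finally show ?thesis by (simp add: euclid_hess_eq)
  qed
  have "dder ?e (dder ?e (\<lambda>p. f (\<Phi> p))) p0 = dder ?e (\<lambda>p. \<phi> p * (euclid_grad f (\<Phi> p) \<bullet> \<nu> p)) p0"
    by (rule dder_cong[OF S p0 f1])
  also have "\<dots> = dder ?e \<phi> p0 * (euclid_grad f (\<Phi> p0) \<bullet> \<nu> p0)
      + \<phi> p0 * (dder ?e (\<lambda>p. euclid_grad f (\<Phi> p)) p0 \<bullet> \<nu> p0 + euclid_grad f (\<Phi> p0) \<bullet> dder ?e \<nu> p0)"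
    by (subst dder_mult[OF \<phi>(1) smooth_on_inner[OF S g \<nu>] p0]) (subst dder_inner[OF g \<nu> p0], rule refl)
  finally have f2: "dder ?e (dder ?e (\<lambda>p. f (\<Phi> p))) p0 = dder ?e \<phi> p0 * (euclid_grad f (\<Phi> p0) \<bullet> \<nu> p0)
      + \<phi> p0 * (\<phi> p0 * euclid_hess f (\<Phi> p0) (\<nu> p0) (\<nu> p0) + euclid_grad f (\<Phi> p0) \<bullet> dder ?e \<nu> p0)"
    by (simp add: dg)
  have G0: "gram q \<Phi> p0 = mat 1" using frame by (simp add: vec_eq_iff gram_nth mat_def)
  let ?A2 = "\<Sum>i\<in>UNIV. \<Sum>j\<in>UNIV. (dder (0, q i) \<nu> p0 \<bullet> b j)\<^sup>2"
  \<comment> \<open>Sign of the curvature term: half of this sum, subtracted, contributes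
    \<open>- 2 * (\<phi> p0)\<^sup>2 * ?A2\<close>, while half of the second derivatives of the
    diagonal contributes \<open>(\<phi> p0)\<^sup>2 * ?A2\<close>. The balance is negative.\<close>
  have "(\<Sum>i\<in>UNIV. \<Sum>j\<in>UNIV. dder ?e (\<lambda>p. gram q \<Phi> p $ i $ j) p0 * dder ?e (\<lambda>p. gram q \<Phi> p $ j $ i) p0)
      = (\<Sum>i\<in>UNIV. \<Sum>j\<in>UNIV. 4 * (\<phi> p0)\<^sup>2 * (dder (0, q i) \<nu> p0 \<bullet> b j)\<^sup>2)"
    unfolding G1[OF p0] by (intro sum.cong refl) (simp add: Bsym[symmetric] B0 power2_eq_square; simp add: algebra_simps)
  also have "\<dots> = 4 * (\<phi> p0)\<^sup>2 * ?A2" by (simp add: sum_distrib_left)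
  finally have q1: "(\<Sum>i\<in>UNIV. \<Sum>j\<in>UNIV. dder ?e (\<lambda>p. gram q \<Phi> p $ i $ j) p0 * dder ?e (\<lambda>p. gram q \<Phi> p $ j $ i) p0)
      = 4 * (\<phi> p0)\<^sup>2 * ?A2" .
  have q2: "(\<Sum>i\<in>UNIV. dder ?e (dder ?e (\<lambda>p. gram q \<Phi> p $ i $ i)) p0)
      = 2 * (dder ?e \<phi> p0 * (\<Sum>i\<in>UNIV. dder (0, q i) \<nu> p0 \<bullet> b i)
        + \<phi> p0 * ((\<Sum>i\<in>UNIV. dder (0, q i) (dder ?e \<nu>) p0 \<bullet> b i) + \<phi> p0 * ?A2))"
    unfolding G2 B1 B0 by (simp add: sum.distrib sum_distrib_left algebra_simps)
  show ?thesis
    unfolding log_density_derivatives(2)[OF S \<Phi> f p0 G0] q1 q2 f2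
    by (simp add: field_simps power2_eq_square)
qed

subsection \<open>Charts\<close>

text \<open>The unnamed inverse in the definition of an atlas is identified with
  \<open>inv_into\<close>, in terms of which transition maps and \<open>chart_diff\<close> are
  written.\<close>

lemma atlas_chart:
  assumes "smooth_atlas \<A>" "(V, \<psi>) \<in> \<A>"
  shows "open V" "open (\<psi> ` V)" "inj_on \<psi> V" "continuous_on V \<psi>" "continuous_on (\<psi> ` V) (inv_into V \<psi>)"
proof -
  obtain \<phi> where "open V" "open (\<psi> ` V)" "homeomorphism V (\<psi> ` V) \<psi> \<phi>"
    using assms unfolding smooth_atlas_def by fast
  moreover from this have inj: "inj_on \<psi> V" by (metis homeomorphism_apply1 inj_on_inverseI)
  moreover have "inv_into V \<psi> x = \<phi> x" if "x \<in> \<psi> ` V" for x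
    using \<open>homeomorphism V (\<psi> ` V) \<psi> \<phi>\<close> that inj
    by (metis f_inv_into_f homeomorphism_apply1 inv_into_into)
  ultimately show "open V" "open (\<psi> ` V)" "inj_on \<psi> V" "continuous_on V \<psi>" "continuous_on (\<psi> ` V) (inv_into V \<psi>)"
    by (auto simp: homeomorphism_def cong: continuous_on_cong)
qed

lemma atlas_transition:
  assumes "smooth_atlas \<A>" "(V, \<psi>) \<in> \<A>" "(W, \<xi>) \<in> \<A>"
  shows "open (V \<inter> \<psi> -` (\<xi> ` W))" "smooth_on (V \<inter> \<psi> -` (\<xi> ` W)) (\<lambda>y. inv_into W \<xi> (\<psi> y))"
proof -
  show "open (V \<inter> \<psi> -` (\<xi> ` W))"
    using atlas_chart[OF assms(1,2)] atlas_chart(2)[OF assms(1,3)] by (metis continuous_open_preimage)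
  show "smooth_on (V \<inter> \<psi> -` (\<xi> ` W)) (\<lambda>y. inv_into W \<xi> (\<psi> y))"
    using assms unfolding smooth_atlas_def by (fastforce simp: o_def)
qed

lemma atlas_cover:
  assumes "smooth_atlas \<A>"
  obtains V \<psi> y where "(V, \<psi>) \<in> \<A>" "y \<in> V" "x = \<psi> y"
proof -
  have "x \<in> (\<Union>(V,\<psi>)\<in>\<A>. \<psi> ` V)" using assms by (simp add: smooth_atlas_def)
  then show thesis using that by auto
qed

lemma chart_at_mem:
  assumes "smooth_atlas \<A>" "chart_at \<A> x = (V, \<psi>)"
  shows "(V, \<psi>) \<in> \<A>" "x \<in> \<psi> ` V"
proof -
  have "\<exists>c. case c of (V, \<psi>) \<Rightarrow> (V, \<psi>) \<in> \<A> \<and> x \<in> \<psi> ` V"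
    using atlas_cover[OF assms(1), of x] by (metis (no_types, lifting) image_eqI case_prod_conv)
  from someI_ex[OF this] show "(V, \<psi>) \<in> \<A>" "x \<in> \<psi> ` V"
    using assms(2) unfolding chart_at_def by auto
qed

lemma smooth_mapD: "smooth_map \<A> h \<Longrightarrow> (V, \<psi>) \<in> \<A> \<Longrightarrow> smooth_on V (\<lambda>y. h (\<psi> y))"
  unfolding smooth_map_def by (auto simp: o_def)

lemma smooth_map_continuous:
  assumes "smooth_atlas \<A>" "\<And>V \<psi>. (V, \<psi>) \<in> \<A> \<Longrightarrow> continuous_on V (\<lambda>y. h (\<psi> y))"
  shows "continuous_on UNIV h"
proof -
  have "continuous_on (\<psi> ` V) h" if c: "(V, \<psi>) \<in> \<A>" for V \<psi>
  proof -
    note ch = atlas_chart[OF assms(1) c]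
    have "continuous_on (\<psi> ` V) (\<lambda>x. h (\<psi> (inv_into V \<psi> x)))"
      using ch by (intro continuous_on_compose2[OF assms(2)[OF c]]) (auto intro: inv_into_into)
    then show ?thesis by (rule continuous_on_eq) (simp add: f_inv_into_f)
  qed
  then have "continuous (at x) h" for x
    using atlas_cover[OF assms(1), of x] atlas_chart(2)[OF assms(1)]
    by (metis continuous_on_eq_continuous_at image_eqI)
  then show ?thesis by (simp add: continuous_on_eq_continuous_within)
qed

text \<open>The isomorphism between the chart that \<open>chart_diff\<close> selects at \<open>\<psi> y\<close> and the chart \<open>\<psi>\<close>.\<close>

definition chart_change :: "('n::finite, 'm) param set \<Rightarrow> (real^'n) set \<Rightarrow> (real^'n \<Rightarrow> 'm) \<Rightarrow> real^'n \<Rightarrow> real^'n \<Rightarrow> real^'n" where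
  "chart_change \<A> V \<psi> y w =
     (case chart_at \<A> (\<psi> y) of (W, \<xi>) \<Rightarrow> dder w (\<lambda>z. inv_into V \<psi> (\<xi> z)) (inv_into W \<xi> (\<psi> y)))"

text \<open>Near the point, \<open>h\<close> in the selected chart is \<open>h\<close> in the chart
  \<psi> composed with the transition map. The resulting factor \<open>chart_change\<close> is
  independent of \<open>h\<close>, which is what makes ranges and quotients of differentials
  independent of the chart.\<close>

lemma chart_diff_chart:
  assumes \<A>: "smooth_atlas \<A>" and c: "(V, \<psi>) \<in> \<A>" and y: "y \<in> V" and h: "smooth_map \<A> h"
  shows "chart_diff \<A> h (\<psi> y) w = dder (chart_change \<A> V \<psi> y w) (\<lambda>y. h (\<psi> y)) y"
proof -
  obtain W \<xi> where W: "chart_at \<A> (\<psi> y) = (W, \<xi>)" by fastforce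
  note c' = chart_at_mem[OF \<A> W]
  define z where "z = inv_into W \<xi> (\<psi> y)"
  define \<tau> where "\<tau> z = inv_into V \<psi> (\<xi> z)" for z
  let ?U = "W \<inter> \<xi> -` (\<psi> ` V)"
  note inj = atlas_chart(3)[OF \<A> c]
  have z: "z \<in> W" "\<xi> z = \<psi> y" using c'(2) by (auto simp: z_def inv_into_into f_inv_into_f)
  then have zU: "z \<in> ?U" using y by auto
  have \<tau>z: "\<tau> z = y" using z y inj by (simp add: \<tau>_def)
  have \<tau>: "open ?U" "smooth_on ?U \<tau>" using atlas_transition[OF \<A> c'(1) c] by (auto simp: \<tau>_def[abs_def])
  have "chart_diff \<A> h (\<psi> y) w = dder w (\<lambda>z. h (\<xi> z)) z"
    by (simp add: chart_diff_def W dder_def z_def o_def)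
  also have "\<dots> = dder w (\<lambda>z. h (\<psi> (\<tau> z))) z"
    by (rule dder_cong[OF \<tau>(1) zU]) (simp add: \<tau>_def f_inv_into_f)
  also have "\<dots> = dder (dder w \<tau> z) (\<lambda>y. h (\<psi> y)) (\<tau> z)"
    by (rule dder_compose[OF \<tau>(2) zU smooth_mapD[OF h c]]) (simp add: \<tau>z y)
  also have "dder w \<tau> z = chart_change \<A> V \<psi> y w"
    by (simp add: chart_change_def W \<tau>_def[abs_def] z_def)
  finally show ?thesis by (simp only: \<tau>z)
qed

text \<open>The two transition maps compose to the identity near \<open>z\<close>, so the chain rule
  applies. Used in both orders, this makes \<open>chart_change\<close> bijective.\<close>

lemma transition_inverse_derivative:
  assumes \<A>: "smooth_atlas \<A>" and c: "(V, \<psi>) \<in> \<A>" "(W, \<xi>) \<in> \<A>" and y: "y \<in> V" "z \<in> W" "\<xi> z = \<psi> y"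
  shows "dder (dder w (\<lambda>z. inv_into V \<psi> (\<xi> z)) z) (\<lambda>y. inv_into W \<xi> (\<psi> y)) y = w"
proof -
  define \<tau> where "\<tau> z = inv_into V \<psi> (\<xi> z)" for z
  define \<sigma> where "\<sigma> y = inv_into W \<xi> (\<psi> y)" for y
  let ?U = "W \<inter> \<xi> -` (\<psi> ` V)" and ?U' = "V \<inter> \<psi> -` (\<xi> ` W)"
  note inj = atlas_chart(3)[OF \<A> c(1)] atlas_chart(3)[OF \<A> c(2)]
  have "\<xi> z \<in> \<psi> ` V" "\<psi> y \<in> \<xi> ` W" using y by (metis imageI)+
  then have zU: "z \<in> ?U" "y \<in> ?U'" using y by auto
  have \<tau>z: "\<tau> z = y" using y inj by (simp add: \<tau>_def)
  have \<tau>: "open ?U" "smooth_on ?U \<tau>" using atlas_transition[OF \<A> c(2,1)] by (auto simp: \<tau>_def[abs_def])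
  have \<sigma>: "smooth_on ?U' \<sigma>" using atlas_transition[OF \<A> c] by (auto simp: \<sigma>_def[abs_def])
  have "dder (dder w \<tau> z) \<sigma> (\<tau> z) = dder w (\<lambda>z. \<sigma> (\<tau> z)) z"
    using dder_compose[OF \<tau>(2) zU(1) \<sigma>] zU(2) \<tau>z by simp
  also have "\<dots> = dder w (\<lambda>z. z) z"
    by (rule dder_cong[OF \<tau>(1) zU(1)]) (use inj in \<open>auto simp: \<tau>_def \<sigma>_def f_inv_into_f\<close>)
  also have "\<dots> = w" by (simp add: dder_def)
  finally show ?thesis unfolding \<tau>z by (simp only: \<tau>_def[abs_def] \<sigma>_def[abs_def])
qed

lemma bij_chart_change:
  assumes \<A>: "smooth_atlas \<A>" and c: "(V, \<psi>) \<in> \<A>" and y: "y \<in> V"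
  shows "bij (chart_change \<A> V \<psi> y)"
proof -
  obtain W \<xi> where W: "chart_at \<A> (\<psi> y) = (W, \<xi>)" by fastforce
  note c' = chart_at_mem[OF \<A> W]
  define z where "z = inv_into W \<xi> (\<psi> y)"
  have z: "z \<in> W" "\<xi> z = \<psi> y" using c'(2) by (auto simp: z_def inv_into_into f_inv_into_f)
  have eq: "chart_change \<A> V \<psi> y = (\<lambda>w. dder w (\<lambda>z. inv_into V \<psi> (\<xi> z)) z)"
    by (simp add: chart_change_def[abs_def] W z_def)
  show ?thesis unfolding eq
  proof (rule o_bij)
    show "(\<lambda>v. dder v (\<lambda>y. inv_into W \<xi> (\<psi> y)) y) \<circ> (\<lambda>w. dder w (\<lambda>z. inv_into V \<psi> (\<xi> z)) z) = id"
      using transition_inverse_derivative[OF \<A> c c'(1) y z] by auto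
    show "(\<lambda>w. dder w (\<lambda>z. inv_into V \<psi> (\<xi> z)) z) \<circ> (\<lambda>v. dder v (\<lambda>y. inv_into W \<xi> (\<psi> y)) y) = id"
      using transition_inverse_derivative[OF \<A> c'(1) c z(1) y z(2)[symmetric]] by auto
  qed
qed

lemma tangent_space_chart:
  assumes "smooth_atlas \<A>" "(V, \<psi>) \<in> \<A>" "y \<in> V" "smooth_map \<A> Y"
  shows "tangent_space \<A> Y (\<psi> y) = range (\<lambda>v. dder v (\<lambda>y. Y (\<psi> y)) y)"
proof -
  have "chart_diff \<A> Y (\<psi> y) = (\<lambda>v. dder v (\<lambda>y. Y (\<psi> y)) y) \<circ> chart_change \<A> V \<psi> y"
    using chart_diff_chart[OF assms] by auto
  then have "tangent_space \<A> Y (\<psi> y) = (\<lambda>v. dder v (\<lambda>y. Y (\<psi> y)) y) ` range (chart_change \<A> V \<psi> y)"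
    unfolding tangent_space_def by (simp only: image_comp)
  then show ?thesis
    by (simp only: bij_is_surj[OF bij_chart_change[OF assms(1-3)]])
qed

lemma inj_chart:
  assumes "smooth_atlas \<A>" "(V, \<psi>) \<in> \<A>" "y \<in> V" "immersion \<A> X"
  shows "inj (\<lambda>v. dder v (\<lambda>y. X (\<psi> y)) y)"
proof -
  have X: "smooth_map \<A> X" "inj (chart_diff \<A> X (\<psi> y))" using assms(4) by (auto simp: immersion_def)
  have "chart_diff \<A> X (\<psi> y) = (\<lambda>v. dder v (\<lambda>y. X (\<psi> y)) y) \<circ> chart_change \<A> V \<psi> y"
    using chart_diff_chart[OF assms(1-3) X(1)] by auto
  then have "inj_on (\<lambda>v. dder v (\<lambda>y. X (\<psi> y)) y) (range (chart_change \<A> V \<psi> y))"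
    using X(2) by (metis inj_on_imageI)
  then show ?thesis using bij_is_surj[OF bij_chart_change[OF assms(1-3)]] by simp
qed

text \<open>The differentials of \<open>h\<close> and of \<open>X\<close> carry the same factor
  \<open>chart_change\<close>, which cancels when that of \<open>X\<close> is inverted.\<close>

lemma tderiv_chart:
  assumes "smooth_atlas \<A>" "(V, \<psi>) \<in> \<A>" "y \<in> V" "immersion \<A> X" "smooth_map \<A> h"
  shows "tderiv \<A> X h (\<psi> y) (dder v (\<lambda>y. X (\<psi> y)) y) = dder v (\<lambda>y. h (\<psi> y)) y"
proof -
  have X: "smooth_map \<A> X" "inj (chart_diff \<A> X (\<psi> y))" using assms(4) by (auto simp: immersion_def)
  obtain w where w: "v = chart_change \<A> V \<psi> y w"
    using bij_is_surj[OF bij_chart_change[OF assms(1-3)]] by (metis surjD)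
  then have "dder v (\<lambda>y. X (\<psi> y)) y = chart_diff \<A> X (\<psi> y) w"
    using chart_diff_chart[OF assms(1-3) X(1)] by simp
  then show ?thesis unfolding tderiv_def
    using X(2) w chart_diff_chart[OF assms(1-3,5)] by simp
qed

text \<open>Existence of an orthonormal basis validates the choice hidden in
  \<open>tangent_frame\<close>; the chosen vectors are then lifted to coordinate vectors
  \<open>q\<close>.\<close>

lemma tangent_frame_chart:
  fixes X :: "'m::{t2_space,second_countable_topology} \<Rightarrow> 'e::euclidean_space" and V :: "(real^'n) set"
  assumes "smooth_atlas \<A>" "(V, \<psi>) \<in> \<A>" "y \<in> V" "immersion \<A> X"
  obtains b :: "'n \<Rightarrow> 'e" and q where "bij_betw b UNIV (tangent_frame \<A> X (\<psi> y))"
    "\<And>i. dder (q i) (\<lambda>y. X (\<psi> y)) y = b i" "\<And>i j. b i \<bullet> b j = (if i = j then 1 else 0)"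
proof -
  let ?T = "\<lambda>v. dder v (\<lambda>y. X (\<psi> y)) y"
  have X: "smooth_map \<A> X" using assms(4) by (simp add: immersion_def)
  have lin: "linear ?T" by (rule smooth_on_linear_dder[OF smooth_mapD[OF X assms(2)] assms(3)])
  note T = tangent_space_chart[OF assms(1-3) X]
  have "subspace (tangent_space \<A> X (\<psi> y))"
    unfolding T by (rule linear_subspace_image[OF lin subspace_UNIV])
  then obtain B where "orthonormal_basis (tangent_space \<A> X (\<psi> y)) B" by (rule orthonormal_basis_exists)
  then have "orthonormal_basis (range ?T) (tangent_frame \<A> X (\<psi> y))"
    unfolding tangent_frame_def T[symmetric] by (rule someI)
  from orthonormal_frame[OF lin inj_chart[OF assms] this] that show thesis by blast
qed

lemma surf_div_chart:
  assumes "smooth_atlas \<A>" "(V, \<psi>) \<in> \<A>" "y \<in> V" "immersion \<A> X" "smooth_map \<A> W"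
    and frame: "bij_betw b UNIV (tangent_frame \<A> X (\<psi> y))" "\<And>i. dder (q i) (\<lambda>y. X (\<psi> y)) y = b i"
  shows "surf_div \<A> X W (\<psi> y) = (\<Sum>i\<in>UNIV. dder (q i) (\<lambda>y. W (\<psi> y)) y \<bullet> b i)"
proof -
  have "surf_div \<A> X W (\<psi> y) = (\<Sum>i\<in>UNIV. tderiv \<A> X W (\<psi> y) (b i) \<bullet> b i)"
    unfolding surf_div_def by (rule sum.reindex_bij_betw[OF frame(1), symmetric])
  then show ?thesis by (simp add: tderiv_chart[OF assms(1-5)] frame(2)[symmetric])
qed

lemma second_ff_norm_chart:
  assumes "smooth_atlas \<A>" "(V, \<psi>) \<in> \<A>" "y \<in> V" "immersion \<A> X" "smooth_map \<A> N"
    and frame: "bij_betw b UNIV (tangent_frame \<A> X (\<psi> y))" "\<And>i. dder (q i) (\<lambda>y. X (\<psi> y)) y = b i"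
  shows "(second_ff_norm \<A> X N (\<psi> y))\<^sup>2 = (\<Sum>i\<in>UNIV. \<Sum>j\<in>UNIV. (dder (q i) (\<lambda>y. N (\<psi> y)) y \<bullet> b j)\<^sup>2)"
proof -
  have "(second_ff_norm \<A> X N (\<psi> y))\<^sup>2
     = (\<Sum>a\<in>tangent_frame \<A> X (\<psi> y). \<Sum>c\<in>tangent_frame \<A> X (\<psi> y). (tderiv \<A> X N (\<psi> y) a \<bullet> c)\<^sup>2)"
    by (simp add: second_ff_norm_def second_ff_def sum_nonneg)
  also have "\<dots> = (\<Sum>i\<in>UNIV. \<Sum>j\<in>UNIV. (tderiv \<A> X N (\<psi> y) (b i) \<bullet> b j)\<^sup>2)"
    by (simp add: sum.reindex_bij_betw[OF frame(1), symmetric])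
  finally show ?thesis by (simp add: tderiv_chart[OF assms(1-5)] frame(2)[symmetric])
qed

text \<open>The difference of two candidates is tangent and orthogonal to all tangent vectors, in
  particular to itself.\<close>

lemma surf_grad_eqI:
  assumes "subspace (tangent_space \<A> X x)"
    and "g \<in> tangent_space \<A> X x" "\<And>e. e \<in> tangent_space \<A> X x \<Longrightarrow> g \<bullet> e = tderiv \<A> X u x e"
  shows "surf_grad \<A> X u x = g"
  unfolding surf_grad_def
proof (rule the_equality)
  fix w assume w: "w \<in> tangent_space \<A> X x \<and> (\<forall>e\<in>tangent_space \<A> X x. w \<bullet> e = tderiv \<A> X u x e)"
  then have "w - g \<in> tangent_space \<A> X x" using assms by (intro subspace_diff) auto
  then have "(w - g) \<bullet> (w - g) = 0" using w assms(3) by (simp add: inner_diff_left)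
  then show "w = g" by simp
qed (use assms in blast)

subsection \<open>Smooth families\<close>

lemma smooth_familyD:
  "smooth_family \<A> I F \<Longrightarrow> (V, \<psi>) \<in> \<A> \<Longrightarrow> smooth_on (I \<times> V) (\<lambda>(t, y). F t (\<psi> y))"
  unfolding smooth_family_def by auto

lemma smooth_family_slice:
  assumes "smooth_atlas \<A>" "smooth_family \<A> I F" "open I" "t \<in> I"
  shows "smooth_map \<A> (F t)"
  unfolding smooth_map_def
proof safe
  fix V \<psi> assume c: "(V, \<psi>) \<in> \<A>"
  have "open V" using atlas_chart[OF assms(1) c] by simp
  then have "smooth_on V (\<lambda>y. (\<lambda>(t, y). F t (\<psi> y)) (t, y))"
    using assms by (intro smooth_on_slice[OF _ smooth_familyD[OF assms(2) c]]) (auto intro: open_Times)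
  then show "smooth_on V (F t \<circ> \<psi>)" by (simp add: o_def)
qed

lemma velocity_chart:
  assumes "smooth_family \<A> I F" "(V, \<psi>) \<in> \<A>" "t \<in> I" "y \<in> V"
  shows "velocity F t (\<psi> y) = dt (\<lambda>(t, y). F t (\<psi> y)) (t, y)"
  using has_vector_derivative_time_slice[OF smooth_familyD[OF assms(1,2)], of t y] assms(3,4)
  unfolding velocity_def by (intro vector_derivative_at) auto

lemma smooth_family_velocity:
  assumes "smooth_atlas \<A>" "smooth_family \<A> I F" "open I"
  shows "smooth_family \<A> I (velocity F)"
  unfolding smooth_family_def
proof safe
  fix V \<psi> assume c: "(V, \<psi>) \<in> \<A>"
  have "open (I \<times> V)" using atlas_chart[OF assms(1) c] assms(3) by (simp add: open_Times)
  then show "smooth_on (I \<times> V) (\<lambda>(t, y). velocity F t (\<psi> y))"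
    using smooth_on_dder[OF smooth_familyD[OF assms(2) c], of "(1, 0)"] velocity_chart[OF assms(2) c]
    by (subst smooth_on_cong) auto
qed

lemma spatial_derivative_chart:
  assumes "smooth_family \<A> I F" "(V, \<psi>) \<in> \<A>" "t \<in> I" "y \<in> V"
  shows "dder v (\<lambda>y. F t (\<psi> y)) y = dder (0, v) (\<lambda>(t, y). F t (\<psi> y)) (t, y)"
  using dder_slice[OF smooth_familyD[OF assms(1,2)], of t y v] assms(3,4) by simp

lemma area_density_chart:
  assumes "smooth_family \<A> I F" "(V, \<psi>) \<in> \<A>" "t \<in> I" "y \<in> V"
  shows "area_density \<psi> (F t) y = sqrt (gram_det (\<lambda>(t, y). F t (\<psi> y)) (t, y))"
proof -
  have "frechet_derivative (F t \<circ> \<psi>) (at y) v = dder (0, v) (\<lambda>(t, y). F t (\<psi> y)) (t, y)" for v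
    using spatial_derivative_chart[OF assms, of v] by (simp add: dder_def o_def)
  then show ?thesis by (simp add: area_density_def gram_def)
qed

subsection \<open>The area measure\<close>

text \<open>A bridge between the extended integrals that define the area measure and absolute
  integrability, in which the change of variables theorem is phrased. Infinite values must be
  covered, since a chart may have infinite area.\<close>

lemma nn_integral_set_lborel:
  fixes f :: "'a::euclidean_space \<Rightarrow> real"
  assumes nn: "\<And>x. x \<in> S \<Longrightarrow> 0 \<le> f x"
    and m: "(\<lambda>x. indicator S x * f x) \<in> borel_measurable borel"
  shows "(\<integral>\<^sup>+x\<in>S. ennreal (f x) \<partial>lborel) = (if f absolutely_integrable_on S then ennreal (integral S f) else \<infinity>)"
proof (cases "f absolutely_integrable_on S")
  case True
  then have "(f has_integral integral S f) S"
    by (rule integrable_integral[OF set_lebesgue_integral_eq_integral(1)])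
  from nn_integral_has_integral_lebesgue'[OF nn this] True show ?thesis by simp
next
  case False
  have "(\<integral>\<^sup>+x\<in>S. ennreal (f x) \<partial>lborel) = \<infinity>"
  proof (rule ccontr)
    assume "(\<integral>\<^sup>+x\<in>S. ennreal (f x) \<partial>lborel) \<noteq> \<infinity>"
    moreover have "(\<integral>\<^sup>+x. ennreal (indicator S x * f x) \<partial>lborel) = (\<integral>\<^sup>+x\<in>S. ennreal (f x) \<partial>lborel)"
      by (intro nn_integral_cong) (auto simp: indicator_def)
    ultimately have "(\<integral>\<^sup>+x. ennreal (indicator S x * f x) \<partial>lborel) < \<infinity>"
      by (simp add: less_top)
    then have i: "integrable lborel (\<lambda>x. indicator S x * f x)"
      using m nn by (intro integrableI_nonneg) (auto simp: indicator_def)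
    then have "integrable lebesgue (\<lambda>x. indicator S x *\<^sub>R f x)"
      using m by (subst integrable_completion) auto
    then show False using False by (simp add: set_integrable_def)
  qed
  with False show ?thesis by simp
qed

lemma nn_integral_change_of_variables:
  fixes g :: "real^'n::{finite,wellorder} \<Rightarrow> real^'n::_" and h :: "real^'n::_ \<Rightarrow> real"
  assumes S: "S \<in> sets borel" and g': "\<And>x. x \<in> S \<Longrightarrow> (g has_derivative g' x) (at x)" and inj: "inj_on g S"
    and h: "\<And>y. y \<in> g ` S \<Longrightarrow> 0 \<le> h y"
    and m: "(\<lambda>y. indicator (g ` S) y * h y) \<in> borel_measurable borel"
      "(\<lambda>x. indicator S x * (\<bar>det (matrix (g' x))\<bar> * h (g x))) \<in> borel_measurable borel"
  shows "(\<integral>\<^sup>+y\<in>g ` S. ennreal (h y) \<partial>lborel) = (\<integral>\<^sup>+x\<in>S. ennreal (\<bar>det (matrix (g' x))\<bar> * h (g x)) \<partial>lborel)"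
proof -
  let ?k = "\<lambda>x. \<bar>det (matrix (g' x))\<bar> * h (g x)"
  have "S \<in> sets lebesgue" using S by auto
  \<comment> \<open>The theorem concerns vector-valued integrands, so \<open>h\<close> is regarded
    as a map into \<open>real^1\<close>. The equivalence for every \<open>b\<close> yields both
    simultaneous integrability and equality of the integrals.\<close>
  then have "(?k absolutely_integrable_on S \<and> integral S ?k = b)
      \<longleftrightarrow> (h absolutely_integrable_on (g ` S) \<and> integral (g ` S) h = b)" for b
    using has_absolute_integral_change_of_variables[OF _ has_derivative_at_withinI[OF g'] inj,
        of "\<lambda>y. vec (h y) :: real^1" "vec b"]
    by (simp add: absolutely_integrable_on_1_iff integral_on_1_eq)
  then have "?k absolutely_integrable_on S \<longleftrightarrow> h absolutely_integrable_on (g ` S)"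
    "h absolutely_integrable_on (g ` S) \<Longrightarrow> integral S ?k = integral (g ` S) h" by blast+
  moreover have "(\<integral>\<^sup>+y\<in>g ` S. ennreal (h y) \<partial>lborel)
      = (if h absolutely_integrable_on (g ` S) then ennreal (integral (g ` S) h) else \<infinity>)"
    by (rule nn_integral_set_lborel[OF h m(1)])
  moreover have "(\<integral>\<^sup>+x\<in>S. ennreal (?k x) \<partial>lborel) = (if ?k absolutely_integrable_on S then ennreal (integral S ?k) else \<infinity>)"
    by (rule nn_integral_set_lborel[OF _ m(2)]) (simp add: h)
  ultimately show ?thesis by simp
qed

section \<open>Area densities under a change of chart\<close>

text \<open>A single hypersurface is treated as a family constant in time, so that everything proved
  for \<open>gram\<close> on space-time applies to it.\<close>

lemma smooth_family_const:
  assumes "smooth_atlas \<A>" "smooth_map \<A> Y"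
  shows "smooth_family \<A> UNIV (\<lambda>t::real. Y)"
  unfolding smooth_family_def
proof safe
  fix V \<psi> assume c: "(V, \<psi>) \<in> \<A>"
  have "open (UNIV \<times> V :: (real \<times> (real^'a)) set)" using atlas_chart[OF assms(1) c] by (simp add: open_Times)
  then have "smooth_on (UNIV \<times> V) (\<lambda>p::real \<times> (real^'a). Y (\<psi> (snd p)))"
    by (rule smooth_on_compose[OF _ smooth_mapD[OF assms(2) c] smooth_on_bounded_linear[OF bounded_linear_snd]]) auto
  then show "smooth_on (UNIV \<times> V) (\<lambda>(t::real, y). Y (\<psi> y))" by (simp add: split_def)
qed

text \<open>Either the determinant vanishes or the differential is injective and the determinant
  positive. This covers time slices that fail to be immersed.\<close>

lemma gram_det_nonneg:
  fixes \<Phi> :: "real \<times> (real^'n) \<Rightarrow> 'e::euclidean_space"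
  assumes "smooth_on S \<Phi>" "p \<in> S"
  shows "gram_det \<Phi> p \<ge> 0"
  using gram_det_pos[OF assms] inj_of_gram_det_nonzero[OF assms] by fastforce

lemma area_density_static:
  assumes "smooth_atlas \<A>" "(V, \<psi>) \<in> \<A>" "smooth_map \<A> Y" "y \<in> V"
  shows "area_density \<psi> Y y = sqrt (gram_det (\<lambda>(t::real, y). Y (\<psi> y)) (0, y))" "area_density \<psi> Y y \<ge> 0"
proof -
  show *: "area_density \<psi> Y y = sqrt (gram_det (\<lambda>(t::real, y). Y (\<psi> y)) (0, y))"
    using area_density_chart[OF smooth_family_const[OF assms(1,3)] assms(2) UNIV_I assms(4)] .
  show "area_density \<psi> Y y \<ge> 0"
    unfolding * using gram_det_nonneg[OF smooth_familyD[OF smooth_family_const[OF assms(1,3)] assms(2)], of "(0, y)"] assms(4)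
    by simp
qed

lemma continuous_on_area_density:
  assumes "smooth_atlas \<A>" "(V, \<psi>) \<in> \<A>" "smooth_map \<A> Y"
  shows "continuous_on V (area_density \<psi> Y)"
proof -
  let ?\<Phi> = "\<lambda>(t::real, y). Y (\<psi> y)"
  have "open V" using atlas_chart[OF assms(1,2)] by simp
  then have o: "open (UNIV \<times> V :: (real \<times> _) set)" by (simp add: open_Times)
  have "continuous_on (UNIV \<times> V) (gram_det ?\<Phi>)"
    by (rule smooth_on_imp_continuous_on[OF smooth_on_gram_det[OF o smooth_familyD[OF smooth_family_const[OF assms(1,3)] assms(2)]]])
  then have "continuous_on V (\<lambda>y. gram_det ?\<Phi> (0, y))"
    by (rule continuous_on_compose2) (auto intro!: continuous_intros)
  then have "continuous_on V (\<lambda>y. sqrt (gram_det ?\<Phi> (0, y)))" by (rule continuous_on_real_sqrt)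
  then show ?thesis
    by (rule continuous_on_eq) (simp add: area_density_static[OF assms])
qed

text \<open>The Gram matrix in one chart is the Gram matrix of the other on the images
  \<open>q\<close> of the coordinate vectors under the transition map; the square root turns the
  squared Jacobian into its absolute value.\<close>

lemma area_density_transition:
  fixes \<A> :: "('n::finite, 'm::{t2_space,second_countable_topology}) param set" and Y :: "'m \<Rightarrow> 'e::euclidean_space"
  assumes \<A>: "smooth_atlas \<A>" and c: "(V, \<psi>) \<in> \<A>" "(W, \<xi>) \<in> \<A>" and Y: "smooth_map \<A> Y"
    and y: "y \<in> V" "\<psi> y \<in> \<xi> ` W"
  shows "area_density \<psi> Y y
    = \<bar>det (matrix (\<lambda>v. dder v (\<lambda>y. inv_into W \<xi> (\<psi> y)) y))\<bar> * area_density \<xi> Y (inv_into W \<xi> (\<psi> y))"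
proof -
  define \<tau> where "\<tau> y = inv_into W \<xi> (\<psi> y)" for y
  let ?U = "V \<inter> \<psi> -` (\<xi> ` W)"
  let ?\<Psi> = "\<lambda>(t::real, y). Y (\<psi> y)" and ?\<Xi> = "\<lambda>(t::real, y). Y (\<xi> y)"
  have yU: "y \<in> ?U" using y by auto
  have \<tau>: "open ?U" "smooth_on ?U \<tau>" using atlas_transition[OF \<A> c] by (auto simp: \<tau>_def[abs_def])
  have \<tau>W: "\<tau> y \<in> W" using y by (auto simp: \<tau>_def intro: inv_into_into)
  define q where "q i = dder (axis i 1) \<tau> y" for i
  have fam: "smooth_family \<A> UNIV (\<lambda>t::real. Y)" by (rule smooth_family_const[OF \<A> Y])
  have "dder (0, axis i 1) ?\<Psi> (0, y) = dder (0, q i) ?\<Xi> (0, \<tau> y)" for i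
  proof -
    have "dder (0, axis i 1) ?\<Psi> (0, y) = dder (axis i 1) (\<lambda>y. Y (\<psi> y)) y"
      using spatial_derivative_chart[OF fam c(1) UNIV_I y(1)] by metis
    also have "\<dots> = dder (axis i 1) (\<lambda>y. Y (\<xi> (\<tau> y))) y"
      by (rule dder_cong[OF \<tau>(1) yU]) (simp add: \<tau>_def f_inv_into_f)
    also have "\<dots> = dder (q i) (\<lambda>y. Y (\<xi> y)) (\<tau> y)"
      unfolding q_def by (rule dder_compose[OF \<tau>(2) yU smooth_mapD[OF Y c(2)] \<tau>W])
    also have "\<dots> = dder (0, q i) ?\<Xi> (0, \<tau> y)"
      using spatial_derivative_chart[OF fam c(2) UNIV_I \<tau>W] by metis
    finally show ?thesis .
  qed
  then have "gram (\<lambda>i. axis i 1) ?\<Psi> (0, y) = gram q ?\<Xi> (0, \<tau> y)" by (simp add: gram_def)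
  then have "gram_det ?\<Psi> (0, y) = (det (\<chi> i. q i))\<^sup>2 * gram_det ?\<Xi> (0, \<tau> y)"
    using det_gram_basis[OF smooth_familyD[OF fam c(2)], of "(0, \<tau> y)" q] \<tau>W by simp
  \<comment> \<open>The vectors \<open>q i\<close> are rows here but columns of the Jacobian matrix,
    hence the transpose.\<close>
  moreover have "det (\<chi> i. q i) = det (matrix (\<lambda>v. dder v \<tau> y))"
    using det_transpose[of "matrix (\<lambda>v. dder v \<tau> y)"] by (simp add: transpose_def matrix_def q_def)
  ultimately have "area_density \<psi> Y y = \<bar>det (matrix (\<lambda>v. dder v \<tau> y))\<bar> * area_density \<xi> Y (\<tau> y)"
    using area_density_static[OF \<A> c(1) Y y(1)] area_density_static[OF \<A> c(2) Y \<tau>W]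
    by (simp add: real_sqrt_mult)
  then show ?thesis by (simp add: \<tau>_def[abs_def])
qed

lemma borel_chart_preimage:
  assumes "smooth_atlas \<A>" "(V, \<psi>) \<in> \<A>" "B \<in> sets borel"
  shows "V \<inter> \<psi> -` B \<in> sets borel"
proof -
  have "\<psi> -` B \<inter> space (restrict_space borel V) \<in> sets (restrict_space borel V)"
    by (rule measurable_sets[OF borel_measurable_continuous_on_restrict assms(3)])
       (rule atlas_chart[OF assms(1,2)])
  then show ?thesis
    using atlas_chart(1)[OF assms(1,2)] by (simp add: sets_restrict_space_iff space_restrict_space Int_commute)
qed

text \<open>The densities of two charts differ exactly by the Jacobian of the transition map. This
  compatibility is what makes the local formulas for the area measure consistent.\<close>

lemma area_overlap:
  fixes \<A> :: "('n::{finite,wellorder}, 'm::{t2_space,second_countable_topology}) param set" and Y :: "'m \<Rightarrow> 'e::euclidean_space"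
  assumes \<A>: "smooth_atlas \<A>" and c: "(V, \<psi>) \<in> \<A>" "(W, \<xi>) \<in> \<A>" and Y: "smooth_map \<A> Y"
    and B: "B \<in> sets borel" "B \<subseteq> \<psi> ` V" "B \<subseteq> \<xi> ` W"
  shows "(\<integral>\<^sup>+z\<in>W \<inter> \<xi> -` B. ennreal (area_density \<xi> Y z) \<partial>lborel)
       = (\<integral>\<^sup>+y\<in>V \<inter> \<psi> -` B. ennreal (area_density \<psi> Y y) \<partial>lborel)"
proof -
  define \<tau> where "\<tau> y = inv_into W \<xi> (\<psi> y)" for y
  define S where "S = V \<inter> \<psi> -` B"
  note inj = atlas_chart(3)[OF \<A> c(1)] atlas_chart(3)[OF \<A> c(2)]
  have S: "S \<in> sets borel" "S \<subseteq> V" "S \<subseteq> V \<inter> \<psi> -` (\<xi> ` W)"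
    using borel_chart_preimage[OF \<A> c(1) B(1)] B by (auto simp: S_def)
  have \<tau>: "smooth_on (V \<inter> \<psi> -` (\<xi> ` W)) \<tau>" using atlas_transition[OF \<A> c] by (auto simp: \<tau>_def[abs_def])
  have \<tau>\<xi>: "\<xi> (\<tau> y) = \<psi> y" if "y \<in> S" for y using S(3) that by (auto simp: \<tau>_def f_inv_into_f)
  have im: "\<tau> ` S = W \<inter> \<xi> -` B"
  proof (intro equalityI subsetI)
    fix z assume "z \<in> \<tau> ` S"
    then obtain y where y: "y \<in> S" "z = \<tau> y" by auto
    then have "\<psi> y \<in> \<xi> ` W" using S(3) by auto
    then show "z \<in> W \<inter> \<xi> -` B" using y \<tau>\<xi>[OF y(1)] by (auto simp: S_def \<tau>_def intro: inv_into_into)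
  next
    fix z assume z: "z \<in> W \<inter> \<xi> -` B"
    then obtain y where "y \<in> V" "\<xi> z = \<psi> y" using B(2) by auto
    moreover from this z have "y \<in> S" "\<tau> y = z" using inj by (auto simp: S_def \<tau>_def simp flip: \<open>\<xi> z = \<psi> y\<close>)
    ultimately show "z \<in> \<tau> ` S" by auto
  qed
  have injS: "inj_on \<tau> S"
    by (rule inj_onI) (metis \<tau>\<xi> S(2) inj(1) inj_onD subsetD)
  have dens: "area_density \<psi> Y y = \<bar>det (matrix (\<lambda>v. dder v \<tau> y))\<bar> * area_density \<xi> Y (\<tau> y)" if "y \<in> S" for y
    using area_density_transition[OF \<A> c Y, of y] S(3) that by (auto simp: \<tau>_def[abs_def])
  have "(\<integral>\<^sup>+z\<in>\<tau> ` S. ennreal (area_density \<xi> Y z) \<partial>lborel)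
      = (\<integral>\<^sup>+y\<in>S. ennreal (\<bar>det (matrix (\<lambda>v. dder v \<tau> y))\<bar> * area_density \<xi> Y (\<tau> y)) \<partial>lborel)"
  proof (rule nn_integral_change_of_variables[OF S(1) _ injS])
    show "(\<tau> has_derivative (\<lambda>v. dder v \<tau> y)) (at y)" if "y \<in> S" for y
      using smooth_on_has_derivative[OF \<tau>] S(3) that by blast
    show "0 \<le> area_density \<xi> Y z" if "z \<in> \<tau> ` S" for z
      using area_density_static(2)[OF \<A> c(2) Y] im that by auto
    have "(\<lambda>z. indicator (\<tau> ` S) z *\<^sub>R area_density \<xi> Y z) \<in> borel_measurable borel"
      unfolding im using borel_chart_preimage[OF \<A> c(2) B(1)] continuous_on_area_density[OF \<A> c(2) Y]
      by (intro borel_measurable_continuous_on_indicator) (auto intro: continuous_on_subset)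
    then show "(\<lambda>z. indicator (\<tau> ` S) z * area_density \<xi> Y z) \<in> borel_measurable borel" by simp
    \<comment> \<open>On \<open>S\<close> the transformed integrand coincides with the density of
      the chart \<psi>, whose continuity gives measurability without looking at the
      Jacobian.\<close>
    have "(\<lambda>y. indicator S y *\<^sub>R area_density \<psi> Y y) \<in> borel_measurable borel"
      using S continuous_on_area_density[OF \<A> c(1) Y]
      by (intro borel_measurable_continuous_on_indicator) (auto intro: continuous_on_subset)
    moreover have "(\<lambda>y. indicator S y *\<^sub>R area_density \<psi> Y y)
        = (\<lambda>y. indicator S y * (\<bar>det (matrix (\<lambda>v. dder v \<tau> y))\<bar> * area_density \<xi> Y (\<tau> y)))"
      by (auto simp: fun_eq_iff indicator_def dens)
    ultimately show "(\<lambda>y. indicator S y * (\<bar>det (matrix (\<lambda>v. dder v \<tau> y))\<bar> * area_density \<xi> Y (\<tau> y)))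
        \<in> borel_measurable borel" by (simp only:)
  qed
  also have "\<dots> = (\<integral>\<^sup>+y\<in>S. ennreal (area_density \<psi> Y y) \<partial>lborel)"
    by (intro nn_integral_cong) (auto simp: dens indicator_def)
  finally show ?thesis unfolding im unfolding S_def .
qed

section \<open>Gluing the local area measures\<close>

text \<open>Lindelof's theorem, from second countability. The sequence may repeat charts, so finite
  subcovers are included.\<close>

lemma countable_charts:
  fixes \<A> :: "('n::finite, 'm::{t2_space,second_countable_topology}) param set"
  assumes "smooth_atlas \<A>"
  shows "\<exists>c :: nat \<Rightarrow> ('n, 'm) param. (\<forall>k. c k \<in> \<A>) \<and> (\<Union>k. snd (c k) ` fst (c k)) = UNIV"
proof -
  let ?U = "\<lambda>c. snd c ` fst (c :: ('n, 'm) param)"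
  have op: "openin (top_of_set UNIV) S" if "S \<in> ?U ` \<A>" for S
  proof -
    obtain V \<psi> where "(V, \<psi>) \<in> \<A>" "S = \<psi> ` V" using \<open>S \<in> ?U ` \<A>\<close> by auto
    then show ?thesis using atlas_chart(2)[OF assms] by simp
  qed
  obtain \<F> where \<F>: "\<F> \<subseteq> ?U ` \<A>" "countable \<F>" "\<Union>\<F> = \<Union>(?U ` \<A>)"
    by (rule Lindelof_openin[of "?U ` \<A>" UNIV]) (use op in auto)
  moreover have "\<Union>(?U ` \<A>) = UNIV"
    using assms by (simp add: smooth_atlas_def split_def)
  ultimately have cover: "\<Union>\<F> = UNIV" by simp
  then have "\<F> \<noteq> {}" by auto
  then have r: "range (from_nat_into \<F>) = \<F>" using \<F>(2) by (rule range_from_nat_into)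
  have "\<exists>c. c \<in> \<A> \<and> from_nat_into \<F> k = ?U c" for k
  proof -
    have "from_nat_into \<F> k \<in> ?U ` \<A>" using r \<F>(1) by blast
    then show ?thesis by blast
  qed
  then have "\<exists>c. \<forall>k. c k \<in> \<A> \<and> from_nat_into \<F> k = ?U (c k)" by (intro choice allI)
  then obtain c where c: "\<And>k. c k \<in> \<A>" "\<And>k. from_nat_into \<F> k = ?U (c k)" by blast
  have "(\<Union>k. ?U (c k)) = \<Union>(range (from_nat_into \<F>))" by (simp add: c(2))
  then have "(\<Union>k. ?U (c k)) = UNIV" using r cover by simp
  then show ?thesis using c(1) by blast
qed

text \<open>The condition under the description operator of \<open>area_measure\<close>, named so
  that existence and uniqueness can be stated.\<close>

definition is_area_measure ::
  "('n::finite, 'm::topological_space) param set \<Rightarrow> ('m \<Rightarrow> 'e::euclidean_space) \<Rightarrow> 'm measure \<Rightarrow> bool" where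
  "is_area_measure \<A> Y \<mu> \<longleftrightarrow> sets \<mu> = sets borel \<and>
     (\<forall>(V,\<psi>)\<in>\<A>. \<forall>B\<in>sets borel. B \<subseteq> \<psi> ` V \<longrightarrow>
        emeasure \<mu> B = (\<integral>\<^sup>+y\<in>V \<inter> \<psi> -` B. ennreal (area_density \<psi> Y y) \<partial>lborel))"

lemma is_area_measureD:
  assumes "is_area_measure \<A> Y \<mu>"
  shows "sets \<mu> = sets borel"
    and "\<And>V \<psi> B. (V, \<psi>) \<in> \<A> \<Longrightarrow> B \<in> sets borel \<Longrightarrow> B \<subseteq> \<psi> ` V \<Longrightarrow>
      emeasure \<mu> B = (\<integral>\<^sup>+y\<in>V \<inter> \<psi> -` B. ennreal (area_density \<psi> Y y) \<partial>lborel)"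
  using assms unfolding is_area_measure_def by fast+

lemma borel_measurable_area_density:
  assumes "smooth_atlas \<A>" "(V, \<psi>) \<in> \<A>" "smooth_map \<A> Y" "S \<in> sets borel" "S \<subseteq> V"
  shows "(\<lambda>y. ennreal (area_density \<psi> Y y) * indicator S y) \<in> borel_measurable borel"
proof -
  have "(\<lambda>y. indicator S y *\<^sub>R area_density \<psi> Y y) \<in> borel_measurable borel"
    using assms(4,5) continuous_on_area_density[OF assms(1-3)]
    by (intro borel_measurable_continuous_on_indicator) (auto intro: continuous_on_subset)
  then have "(\<lambda>y. ennreal (indicator S y *\<^sub>R area_density \<psi> Y y)) \<in> borel_measurable borel"
    by measurable
  moreover have "(\<lambda>y. ennreal (indicator S y *\<^sub>R area_density \<psi> Y y))
      = (\<lambda>y. ennreal (area_density \<psi> Y y) * indicator S y)"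
    by (auto simp: fun_eq_iff indicator_def)
  ultimately show ?thesis by (simp only:)
qed

text \<open>Making a countable cover by charts disjoint cuts every Borel set into pieces lying in
  one chart each, where the condition fixes the value; countable additivity determines the
  rest.\<close>

lemma area_measure_unique:
  fixes \<A> :: "('n::finite, 'm::{t2_space,second_countable_topology}) param set"
  assumes \<A>: "smooth_atlas \<A>" and "is_area_measure \<A> Y \<mu>" "is_area_measure \<A> Y \<mu>'"
  shows "\<mu> = \<mu>'"
proof (rule measure_eqI)
  show "sets \<mu> = sets \<mu>'" using assms by (simp add: is_area_measure_def)
  obtain c :: "nat \<Rightarrow> ('n, 'm) param" where cA: "\<forall>k. c k \<in> \<A>" and c: "(\<Union>k. snd (c k) ` fst (c k)) = UNIV"
    using countable_charts[OF \<A>] by blast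
  define U where "U k = snd (c k) ` fst (c k)" for k :: nat
  fix B assume "B \<in> sets \<mu>"
  then have B: "B \<in> sets borel" using assms by (simp add: is_area_measure_def)
  have c': "(fst (c k), snd (c k)) \<in> \<A>" for k using cA by simp
  have "U k \<in> sets borel" for k unfolding U_def by (rule borel_open[OF atlas_chart(2)[OF \<A> c']])
  then have D: "disjointed U k \<in> sets borel" for k
    using sets.range_disjointed_sets[of U borel] by blast
  have DU: "disjointed U k \<subseteq> U k" for k by (rule disjointed_subset)
  have UN: "(\<Union>k. B \<inter> disjointed U k) = B"
    using c UN_disjointed_eq[of U] by (auto simp: U_def)
  have dj: "disjoint_family (\<lambda>k. B \<inter> disjointed U k)"
    using disjoint_family_disjointed[of U] by (auto simp: disjoint_family_on_def)
  have *: "emeasure \<mu> (B \<inter> disjointed U k) = emeasure \<mu>' (B \<inter> disjointed U k)" for k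
  proof -
    have "B \<inter> disjointed U k \<in> sets borel" "B \<inter> disjointed U k \<subseteq> snd (c k) ` fst (c k)"
      using B D[of k] DU[of k] by (auto simp: U_def)
    then show ?thesis
      using is_area_measureD(2)[OF assms(2) c'] is_area_measureD(2)[OF assms(3) c'] by simp
  qed
  have sum: "(\<Sum>k. emeasure M (B \<inter> disjointed U k)) = emeasure M B" if M: "is_area_measure \<A> Y M" for M
  proof -
    have "range (\<lambda>k. B \<inter> disjointed U k) \<subseteq> sets M" using is_area_measureD(1)[OF M] B D by auto
    from suminf_emeasure[OF this dj] show ?thesis unfolding UN .
  qed
  show "emeasure \<mu> B = emeasure \<mu>' B"
    using sum[OF assms(2)] sum[OF assms(3)] * by simp
qed

text \<open>The measure is assembled from disjoint pieces \<open>D k\<close>, each measured in one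
  preferred chart. Compatibility on overlaps shows that every other chart computes the same
  values.\<close>

lemma area_measure_exists:
  fixes \<A> :: "('n::{finite,wellorder}, 'm::{t2_space,second_countable_topology}) param set" and Y :: "'m \<Rightarrow> 'e::euclidean_space"
  assumes \<A>: "smooth_atlas \<A>" and Y: "smooth_map \<A> Y"
  shows "\<exists>\<mu>. is_area_measure \<A> Y \<mu>"
proof -
  obtain c :: "nat \<Rightarrow> ('n, 'm) param" where cA: "\<forall>k. c k \<in> \<A>" and c: "(\<Union>k. snd (c k) ` fst (c k)) = UNIV"
    using countable_charts[OF \<A>] by blast
  define V where "V k = fst (c k)" for k :: nat
  define \<psi> where "\<psi> k = snd (c k)" for k :: nat
  define D where "D = disjointed (\<lambda>k. \<psi> k ` V k)"
  have c': "(V k, \<psi> k) \<in> \<A>" for k using cA by (simp add: V_def \<psi>_def)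
  have "\<psi> k ` V k \<in> sets borel" for k by (rule borel_open[OF atlas_chart(2)[OF \<A> c']])
  then have D: "D k \<in> sets borel" for k
    unfolding D_def using sets.range_disjointed_sets[of "\<lambda>k. \<psi> k ` V k" borel] by blast
  have DU: "D k \<subseteq> \<psi> k ` V k" for k unfolding D_def by (rule disjointed_subset)
  have UN: "(\<Union>k. B \<inter> D k) = B" for B
    using c UN_disjointed_eq[of "\<lambda>k. \<psi> k ` V k"] by (auto simp: D_def V_def \<psi>_def)
  have dj: "disjoint_family (\<lambda>k. B \<inter> D k)" for B
    using disjoint_family_disjointed[of "\<lambda>k. \<psi> k ` V k"] by (auto simp: disjoint_family_on_def D_def)
  define m where "m k B = (\<integral>\<^sup>+y\<in>V k \<inter> \<psi> k -` (B \<inter> D k). ennreal (area_density (\<psi> k) Y y) \<partial>lborel)" for k B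
  define \<mu> where "\<mu> = measure_of UNIV (sets borel) (\<lambda>B. \<Sum>k. m k B)"
  have meas: "(\<lambda>y. ennreal (area_density (\<psi> k) Y y) * indicator (V k \<inter> \<psi> k -` (B \<inter> D k)) y) \<in> borel_measurable borel"
    if "B \<in> sets borel" for k B
    by (rule borel_measurable_area_density[OF \<A> c' Y])
       (auto intro!: borel_chart_preimage[OF \<A> c'] that D simp del: vimage_Int)
  \<comment> \<open>Each summand is moved from its preferred chart into the chart \<xi>; there the
    pieces of \<open>B\<close> are disjoint and monotone convergence reassembles the
    integral.\<close>
  have chart: "(\<Sum>k. m k B) = (\<integral>\<^sup>+y\<in>W \<inter> \<xi> -` B. ennreal (area_density \<xi> Y y) \<partial>lborel)"
    if B: "B \<in> sets borel" and W: "(W, \<xi>) \<in> \<A>" "B \<subseteq> \<xi> ` W" for B W \<xi>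
  proof -
    have "m k B = (\<integral>\<^sup>+y\<in>W \<inter> \<xi> -` (B \<inter> D k). ennreal (area_density \<xi> Y y) \<partial>lborel)" for k
      unfolding m_def by (rule area_overlap[OF \<A> W(1) c' Y]) (use B D DU W(2) in auto)
    then have "(\<Sum>k. m k B) = (\<Sum>k. \<integral>\<^sup>+y\<in>W \<inter> \<xi> -` (B \<inter> D k). ennreal (area_density \<xi> Y y) \<partial>lborel)" by simp
    also have "\<dots> = (\<integral>\<^sup>+y. (\<Sum>k. ennreal (area_density \<xi> Y y) * indicator (W \<inter> \<xi> -` (B \<inter> D k)) y) \<partial>lborel)"
    proof (rule nn_integral_suminf[symmetric])
      fix k
      have "B \<inter> D k \<in> sets borel" using B D by simp
      from borel_measurable_area_density[OF \<A> W(1) Y borel_chart_preimage[OF \<A> W(1) this]]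
      show "(\<lambda>y. ennreal (area_density \<xi> Y y) * indicator (W \<inter> \<xi> -` (B \<inter> D k)) y) \<in> borel_measurable lborel"
        by simp
    qed
    also have "\<dots> = (\<integral>\<^sup>+y\<in>W \<inter> \<xi> -` B. ennreal (area_density \<xi> Y y) \<partial>lborel)"
    proof (intro nn_integral_cong)
      fix y
      have "disjoint_family (\<lambda>k. W \<inter> \<xi> -` (B \<inter> D k))"
        using dj[of B] unfolding disjoint_family_on_def by blast
      then have "(\<Sum>k. indicator (W \<inter> \<xi> -` (B \<inter> D k)) y) = (indicator (\<Union>k. W \<inter> \<xi> -` (B \<inter> D k)) y :: ennreal)"
        by (rule suminf_indicator)
      moreover have "(\<Union>k. W \<inter> \<xi> -` (B \<inter> D k)) = W \<inter> \<xi> -` B" using UN[of B] by blast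
      ultimately show "(\<Sum>k. ennreal (area_density \<xi> Y y) * indicator (W \<inter> \<xi> -` (B \<inter> D k)) y)
          = ennreal (area_density \<xi> Y y) * indicator (W \<inter> \<xi> -` B) y"
        by (simp add: ennreal_suminf_cmult)
    qed
    finally show ?thesis .
  qed
  have \<mu>: "emeasure \<mu> B = (\<Sum>k. m k B)" if "B \<in> sets borel" for B
  proof (rule emeasure_measure_of[OF \<mu>_def])
    show "positive (sets \<mu>) (\<lambda>B. \<Sum>k. m k B)" by (simp add: positive_def m_def)
    have sets: "sets \<mu> = sets borel" unfolding \<mu>_def using sets.sets_measure_of_eq[of borel] by simp
    show "countably_additive (sets \<mu>) (\<lambda>B. \<Sum>k. m k B)"
      unfolding countably_additive_def sets
    proof safe
      fix A :: "nat \<Rightarrow> 'm set" assume A: "range A \<subseteq> sets borel" "disjoint_family A"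
      have inner: "(\<Sum>i. m k (A i)) = m k (\<Union>i. A i)" for k
      proof -
        have "(\<Sum>i. m k (A i)) = (\<integral>\<^sup>+y. (\<Sum>i. ennreal (area_density (\<psi> k) Y y) * indicator (V k \<inter> \<psi> k -` (A i \<inter> D k)) y) \<partial>lborel)"
          unfolding m_def using meas A(1) by (intro nn_integral_suminf[symmetric]) (auto simp del: vimage_Int)
        also have "\<dots> = m k (\<Union>i. A i)"
          unfolding m_def
        proof (intro nn_integral_cong)
          fix y
          have "disjoint_family (\<lambda>i. V k \<inter> \<psi> k -` (A i \<inter> D k))"
            using A(2) unfolding disjoint_family_on_def by blast
          then have "(\<Sum>i. indicator (V k \<inter> \<psi> k -` (A i \<inter> D k)) y)
              = (indicator (\<Union>i. V k \<inter> \<psi> k -` (A i \<inter> D k)) y :: ennreal)"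
            by (rule suminf_indicator)
          moreover have "(\<Union>i. V k \<inter> \<psi> k -` (A i \<inter> D k)) = V k \<inter> \<psi> k -` ((\<Union>i. A i) \<inter> D k)" by blast
          ultimately show "(\<Sum>i. ennreal (area_density (\<psi> k) Y y) * indicator (V k \<inter> \<psi> k -` (A i \<inter> D k)) y)
              = ennreal (area_density (\<psi> k) Y y) * indicator (V k \<inter> \<psi> k -` ((\<Union>i. A i) \<inter> D k)) y"
            by (simp add: ennreal_suminf_cmult)
        qed
        finally show ?thesis .
      qed
      \<comment> \<open>Tonelli for double series, one of the sums being read as an integral over
        counting measure.\<close>
      have "(\<Sum>i. \<Sum>k. m k (A i)) = (\<Sum>k. \<Sum>i. m k (A i))"
        using nn_integral_suminf[of "\<lambda>i k. m k (A i)" "count_space UNIV"]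
        by (simp add: nn_integral_count_space_nat)
      then show "(\<Sum>i. \<Sum>k. m k (A i)) = (\<Sum>k. m k (\<Union>i. A i))" by (simp add: inner)
    qed
    show "B \<in> sets \<mu>" using that sets by simp
  qed simp
  have "sets \<mu> = sets borel" unfolding \<mu>_def using sets.sets_measure_of_eq[of borel] by simp
  then have "is_area_measure \<A> Y \<mu>"
    unfolding is_area_measure_def using \<mu> chart by auto
  then show ?thesis by blast
qed

lemma is_area_measure_area_measure:
  fixes \<A> :: "('n::{finite,wellorder}, 'm::{t2_space,second_countable_topology}) param set" and Y :: "'m \<Rightarrow> 'e::euclidean_space"
  assumes "smooth_atlas \<A>" "smooth_map \<A> Y"
  shows "is_area_measure \<A> Y (area_measure \<A> Y)"
proof -
  have "area_measure \<A> Y = (THE \<mu>. is_area_measure \<A> Y \<mu>)"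
    by (simp add: area_measure_def is_area_measure_def)
  then show ?thesis
    using area_measure_exists[OF assms] area_measure_unique[OF assms(1)] theI' by metis
qed

subsection \<open>Integration in charts\<close>

lemma borel_measurable_weight:
  assumes "smooth_atlas \<A>" "smooth_map \<A> Y" "smooth_on UNIV f"
  shows "(\<lambda>x. exp (f (Y x)) :: real) \<in> borel_measurable borel"
proof -
  have "continuous_on UNIV Y"
    by (rule smooth_map_continuous[OF assms(1)]) (rule smooth_on_imp_continuous_on[OF smooth_mapD[OF assms(2)]])
  moreover have "continuous_on UNIV f" by (rule smooth_on_imp_continuous_on[OF assms(3)])
  ultimately have "continuous_on UNIV (\<lambda>x. exp (f (Y x)))"
    by (intro continuous_on_exp) (auto intro: continuous_on_compose2)
  then show ?thesis by (rule borel_measurable_continuous_onI)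
qed

text \<open>The area measure restricted to \<open>B\<close>, written as a density, is the image of a
  density on the chart domain, so the transfer of integrals is available. \<open>p\<close> is an
  everywhere defined measurable extension of \<psi>; its value off \<open>V\<close> is immaterial
  since the density vanishes there.\<close>

lemma area_measure_in_chart:
  fixes \<A> :: "('n::{finite,wellorder}, 'm::{t2_space,second_countable_topology}) param set" and Y :: "'m \<Rightarrow> 'e::euclidean_space"
  assumes \<A>: "smooth_atlas \<A>" and c: "(V, \<psi>) \<in> \<A>" and Y: "smooth_map \<A> Y"
    and B: "B \<in> sets borel" "B \<subseteq> \<psi> ` V"
  defines "p \<equiv> \<lambda>y. if y \<in> V then \<psi> y else undefined"
  shows "p \<in> borel \<rightarrow>\<^sub>M borel"
    and "(\<lambda>y. indicator (V \<inter> \<psi> -` B) y * area_density \<psi> Y y) \<in> borel_measurable borel"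
    and "density (area_measure \<A> Y) (\<lambda>x. ennreal (indicator B x))
      = distr (density lborel (\<lambda>y. ennreal (indicator (V \<inter> \<psi> -` B) y * area_density \<psi> Y y))) borel p"
proof -
  let ?S = "V \<inter> \<psi> -` B"
  let ?M = "area_measure \<A> Y"
  note M = is_area_measureD[OF is_area_measure_area_measure[OF \<A> Y]]
  note ch = atlas_chart[OF \<A> c]
  have S: "?S \<in> sets borel" by (rule borel_chart_preimage[OF \<A> c B(1)])
  show p: "p \<in> borel \<rightarrow>\<^sub>M borel"
    unfolding p_def using ch by (intro borel_measurable_continuous_on_if) auto
  have "(\<lambda>y. indicator ?S y *\<^sub>R area_density \<psi> Y y) \<in> borel_measurable borel"
    using S continuous_on_area_density[OF \<A> c Y]
    by (intro borel_measurable_continuous_on_indicator) (auto intro: continuous_on_subset)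
  then show d: "(\<lambda>y. indicator ?S y * area_density \<psi> Y y) \<in> borel_measurable borel" by simp
  show "density ?M (\<lambda>x. ennreal (indicator B x))
      = distr (density lborel (\<lambda>y. ennreal (indicator ?S y * area_density \<psi> Y y))) borel p"
  proof (rule measure_eqI)
    show "sets (density ?M (\<lambda>x. ennreal (indicator B x)))
        = sets (distr (density lborel (\<lambda>y. ennreal (indicator ?S y * area_density \<psi> Y y))) borel p)"
      using M(1) by simp
    fix C assume "C \<in> sets (density ?M (\<lambda>x. ennreal (indicator B x)))"
    then have C: "C \<in> sets borel" using M(1) by simp
    have BC: "B \<inter> C \<in> sets borel" "B \<inter> C \<subseteq> \<psi> ` V" using B C by auto
    have pC: "p -` C \<in> sets borel" using measurable_sets[OF p C] by simp
    have BM: "B \<in> sets ?M" "C \<in> sets ?M" using B C M(1) by auto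
    have "emeasure (density ?M (\<lambda>x. ennreal (indicator B x))) C = (\<integral>\<^sup>+x. ennreal (indicator B x) * indicator C x \<partial>?M)"
      using BM by (intro emeasure_density) auto
    also have "\<dots> = (\<integral>\<^sup>+x. indicator (B \<inter> C) x \<partial>?M)"
      by (intro nn_integral_cong) (auto simp: indicator_def)
    also have "\<dots> = emeasure ?M (B \<inter> C)" using BM by simp
    also have "\<dots> = (\<integral>\<^sup>+y\<in>V \<inter> \<psi> -` (B \<inter> C). ennreal (area_density \<psi> Y y) \<partial>lborel)"
      by (rule M(2)[OF c BC])
    also have "\<dots> = (\<integral>\<^sup>+y. ennreal (indicator ?S y * area_density \<psi> Y y) * indicator (p -` C) y \<partial>lborel)"
      by (intro nn_integral_cong) (auto simp: indicator_def p_def)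
    also have "\<dots> = emeasure (density lborel (\<lambda>y. ennreal (indicator ?S y * area_density \<psi> Y y))) (p -` C)"
      using d pC by (intro emeasure_density[symmetric]) auto
    also have "\<dots> = emeasure (distr (density lborel (\<lambda>y. ennreal (indicator ?S y * area_density \<psi> Y y))) borel p) C"
      using p C by (subst emeasure_distr) auto
    finally show "emeasure (density ?M (\<lambda>x. ennreal (indicator B x))) C
      = emeasure (distr (density lborel (\<lambda>y. ennreal (indicator ?S y * area_density \<psi> Y y))) borel p) C" .
  qed
qed

text \<open>The weight and the indicator of \<open>B\<close> are moved between measure and integrand
  until only the image measure of the chart remains. Integrability is transported along the same
  chain.\<close>

lemma weighted_integral_in_chart:
  fixes \<A> :: "('n::{finite,wellorder}, 'm::{t2_space,second_countable_topology}) param set" and Y :: "'m \<Rightarrow> 'e::euclidean_space"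
    and w :: "'m \<Rightarrow> real"
  assumes \<A>: "smooth_atlas \<A>" and c: "(V, \<psi>) \<in> \<A>" and Y: "smooth_map \<A> Y" and f: "smooth_on UNIV f"
    and B: "B \<in> sets borel" "B \<subseteq> \<psi> ` V" and w: "w \<in> borel_measurable borel"
  defines "g \<equiv> \<lambda>y. indicator (V \<inter> \<psi> -` B) y * (w (\<psi> y) * (exp (f (Y (\<psi> y))) * area_density \<psi> Y y))"
  shows "integrable (weighted_area_measure \<A> Y f) (\<lambda>x. indicator B x * w x) \<longleftrightarrow> integrable lborel g" (is ?int)
    and "(\<integral>x. indicator B x * w x \<partial>weighted_area_measure \<A> Y f) = (\<integral>y. g y \<partial>lborel)" (is ?eq)
proof -
  let ?S = "V \<inter> \<psi> -` B" and ?M = "area_measure \<A> Y" and ?E = "\<lambda>x. exp (f (Y x))"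
  let ?h = "\<lambda>y. indicator ?S y * area_density \<psi> Y y"
  define p where "p = (\<lambda>y. if y \<in> V then \<psi> y else undefined)"
  have M: "sets ?M = sets borel" by (rule is_area_measureD[OF is_area_measure_area_measure[OF \<A> Y]])
  have cm: "h \<in> borel_measurable borel \<Longrightarrow> h \<in> borel_measurable ?M" for h :: "'m \<Rightarrow> real"
    using measurable_cong_sets[OF M refl] by blast
  note ch = area_measure_in_chart[OF \<A> c Y B, folded p_def]
  have E: "?E \<in> borel_measurable borel" by (rule borel_measurable_weight[OF \<A> Y f])
  have wE: "(\<lambda>x. ?E x * w x) \<in> borel_measurable borel" using E w by measurable
  have wB: "(\<lambda>x. indicator B x * w x) \<in> borel_measurable borel" using B(1) w by measurable
  have iB: "indicator B \<in> borel_measurable borel" using B(1) by simp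
  have h0: "AE y in lborel. 0 \<le> ?h y"
    using area_density_static(2)[OF \<A> c Y] by (intro AE_I2) (auto simp: indicator_def)
  have wp: "(\<lambda>y. ?E (p y) * w (p y)) \<in> borel_measurable lborel"
    using measurable_compose[OF ch(1) wE] by simp
  have g: "g = (\<lambda>y. ?h y *\<^sub>R (?E (p y) * w (p y)))"
    by (auto simp: fun_eq_iff g_def p_def indicator_def)
  have "integrable (weighted_area_measure \<A> Y f) (\<lambda>x. indicator B x * w x)
      \<longleftrightarrow> integrable ?M (\<lambda>x. ?E x *\<^sub>R (indicator B x * w x))"
    unfolding weighted_area_measure_def by (rule integrable_density[OF cm[OF wB] cm[OF E]]) simp
  also have "\<dots> \<longleftrightarrow> integrable ?M (\<lambda>x. indicator B x *\<^sub>R (?E x * w x))"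
    by (simp add: mult.left_commute)
  also have "\<dots> \<longleftrightarrow> integrable (density ?M (\<lambda>x. ennreal (indicator B x))) (\<lambda>x. ?E x * w x)"
    by (rule integrable_density[OF cm[OF wE] cm[OF iB], symmetric]) simp
  also have "\<dots> \<longleftrightarrow> integrable (density lborel (\<lambda>y. ennreal (?h y))) (\<lambda>y. ?E (p y) * w (p y))"
    unfolding ch(3) by (rule integrable_distr_eq) (use ch(1) wE in auto)
  also have "\<dots> \<longleftrightarrow> integrable lborel g"
    unfolding g by (rule integrable_density[OF wp _ h0]) (use ch(2) in simp)
  finally show ?int .
  have "(\<integral>x. indicator B x * w x \<partial>weighted_area_measure \<A> Y f) = (\<integral>x. ?E x *\<^sub>R (indicator B x * w x) \<partial>?M)"
    unfolding weighted_area_measure_def by (rule integral_density[OF cm[OF wB] cm[OF E]]) simp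
  also have "\<dots> = (\<integral>x. indicator B x *\<^sub>R (?E x * w x) \<partial>?M)"
    by (simp add: mult.left_commute)
  also have "\<dots> = (\<integral>x. ?E x * w x \<partial>density ?M (\<lambda>x. ennreal (indicator B x)))"
    by (rule integral_density[OF cm[OF wE] cm[OF iB], symmetric]) simp
  also have "\<dots> = (\<integral>y. ?E (p y) * w (p y) \<partial>density lborel (\<lambda>y. ennreal (?h y)))"
    unfolding ch(3) by (rule integral_distr) (use ch(1) wE in auto)
  also have "\<dots> = (\<integral>y. g y \<partial>lborel)"
    unfolding g by (rule integral_density[OF wp _ h0]) (use ch(2) in simp)
  finally show ?eq .
qed

lemma integrable_indicator_compact:
  fixes g :: "'a::euclidean_space \<Rightarrow> real"
  assumes "S \<in> sets borel" "S \<subseteq> C" "compact C" "continuous_on C g"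
  shows "integrable lborel (\<lambda>y. indicator S y * g y)"
proof -
  have "integrable lborel (\<lambda>y. indicator S y *\<^sub>R (indicator C y *\<^sub>R g y))"
    by (rule integrable_mult_indicator[OF _ borel_integrable_compact[OF assms(3,4)]]) (use assms(1) in simp)
  moreover have "(\<lambda>y. indicator S y *\<^sub>R (indicator C y *\<^sub>R g y)) = (\<lambda>y. indicator S y * g y)"
    using assms(2) by (auto simp: fun_eq_iff indicator_def)
  ultimately show ?thesis by simp
qed

section \<open>Cutting a compact set along charts\<close>

text \<open>Plays the part of a partition of unity. A Borel partition suffices because it is fixed
  in time and only integrated over; the compact sets \<open>C i\<close> provide the uniform bounds
  for differentiation under the integral.\<close>

definition chart_pieces ::
  "('n::finite, 'm::topological_space) param set \<Rightarrow> 'm set \<Rightarrow> nat \<Rightarrow> (nat \<Rightarrow> (real^'n) set) \<Rightarrow> (nat \<Rightarrow> real^'n \<Rightarrow> 'm) \<Rightarrow>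
   (nat \<Rightarrow> (real^'n) set) \<Rightarrow> (nat \<Rightarrow> 'm set) \<Rightarrow> bool" where
  "chart_pieces \<A> K m V \<psi> C B \<longleftrightarrow>
     (\<forall>i<m. (V i, \<psi> i) \<in> \<A> \<and> compact (C i) \<and> C i \<subseteq> V i \<and> B i \<in> sets borel \<and> B i \<subseteq> \<psi> i ` C i) \<and>
     disjoint_family B \<and> (\<Union>i<m. B i) = K"

lemma open_chart_image:
  assumes "smooth_atlas \<A>" "(V, \<psi>) \<in> \<A>" "open U" "U \<subseteq> V"
  shows "open (\<psi> ` U)"
proof -
  note ch = atlas_chart[OF assms(1,2)]
  have "open (\<psi> ` V \<inter> inv_into V \<psi> -` U)"
    by (rule continuous_open_preimage[OF ch(5,2) assms(3)])
  moreover have "\<psi> ` V \<inter> inv_into V \<psi> -` U = \<psi> ` U"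
    using ch(3) assms(4) by (auto simp: image_iff f_inv_into_f inv_into_f_f)
  ultimately show ?thesis by simp
qed

text \<open>Every point lies in the image of an open ball whose closed ball still fits into a chart
  domain. The open balls give a finite subcover of \<open>K\<close>, the closed balls the compact
  sets.\<close>

lemma chart_pieces_exist:
  fixes \<A> :: "('n::finite, 'm::{t2_space,second_countable_topology}) param set"
  assumes \<A>: "smooth_atlas \<A>" and K: "compact K"
  shows "\<exists>m V \<psi> C B. chart_pieces \<A> K m V \<psi> C B"
proof -
  have "\<exists>V \<psi> y r. (V, \<psi>) \<in> \<A> \<and> cball y r \<subseteq> V \<and> x \<in> \<psi> ` ball y r" for x
  proof -
    obtain V \<psi> y where c: "(V, \<psi>) \<in> \<A>" "y \<in> V" "x = \<psi> y" using atlas_cover[OF \<A>] .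
    obtain r where "r > 0" "cball y r \<subseteq> V"
      using atlas_chart(1)[OF \<A> c(1)] c(2) open_contains_cball by blast
    then have "(V, \<psi>) \<in> \<A> \<and> cball y r \<subseteq> V \<and> x \<in> \<psi> ` ball y r" using c by auto
    then show ?thesis by blast
  qed
  then obtain V \<psi> y r where c: "\<And>x. (V x, \<psi> x) \<in> \<A>" "\<And>x. cball (y x) (r x) \<subseteq> V x" "\<And>x. x \<in> \<psi> x ` ball (y x) (r x)"
    by metis
  let ?U = "\<lambda>x. \<psi> x ` ball (y x) (r x)"
  have op: "open (?U x)" for x
    by (rule open_chart_image[OF \<A> c(1) open_ball]) (use c(2) ball_subset_cball in blast)
  have cov: "K \<subseteq> (\<Union>x\<in>K. ?U x)" using c(3) by blast
  obtain D where D: "D \<subseteq> K" "finite D" "K \<subseteq> (\<Union>x\<in>D. ?U x)"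
    by (rule compactE_image[OF K _ cov]) (rule op, (rule that; assumption))
  obtain e where e: "bij_betw e {0..<card D} D" using ex_bij_betw_nat_finite[OF D(2)] by blast
  \<comment> \<open>Subtracting the preceding images makes the cover disjoint; intersecting with
    \<open>K\<close> makes its union exact.\<close>
  define B where "B i = K \<inter> disjointed (\<lambda>i. ?U (e i)) i" for i
  have "K \<in> sets borel" using K by (intro borel_closed compact_imp_closed)
  moreover have "disjointed (\<lambda>i. ?U (e i)) i \<in> sets borel" for i
  proof -
    have "range (\<lambda>i. ?U (e i)) \<subseteq> sets borel" using borel_open[OF op] by auto
    from sets.range_disjointed_sets[OF this] show ?thesis by auto
  qed
  ultimately have Bb: "B i \<in> sets borel" for i by (auto simp: B_def)
  have BU: "B i \<subseteq> ?U (e i)" for i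
    unfolding B_def using disjointed_subset[of "\<lambda>i. ?U (e i)" i] by blast
  have "(\<Union>i<card D. B i) = K \<inter> (\<Union>i\<in>{0..<card D}. ?U (e i))"
    unfolding B_def lessThan_atLeast0 Int_UN_distrib[symmetric]
    by (simp only: finite_UN_disjointed_eq)
  also have "(\<Union>i\<in>{0..<card D}. ?U (e i)) = (\<Union>x\<in>e ` {0..<card D}. ?U x)" by auto
  also have "e ` {0..<card D} = D" by (rule bij_betw_imp_surj_on[OF e])
  finally have UN: "(\<Union>i<card D. B i) = K" unfolding Int_absorb2[OF D(3)] .
  have "disjoint_family B"
    using disjoint_family_disjointed[of "\<lambda>i. ?U (e i)"] unfolding B_def disjoint_family_on_def by blast
  then have "chart_pieces \<A> K (card D) (V \<circ> e) (\<psi> \<circ> e) (\<lambda>i. cball (y (e i)) (r (e i))) B"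
    unfolding chart_pieces_def using UN Bb c(1,2) subset_trans[OF BU image_mono[OF ball_subset_cball]]
    by simp
  then show ?thesis by blast
qed

lemma chart_piecesD:
  assumes "chart_pieces \<A> K m V \<psi> C B" "i < m"
  shows "(V i, \<psi> i) \<in> \<A>" "compact (C i)" "C i \<subseteq> V i" "B i \<in> sets borel" "B i \<subseteq> \<psi> i ` C i"
  using assms unfolding chart_pieces_def by auto

abbreviation piece :: "(nat \<Rightarrow> 'b set) \<Rightarrow> (nat \<Rightarrow> 'b \<Rightarrow> 'm) \<Rightarrow> (nat \<Rightarrow> 'm set) \<Rightarrow> nat \<Rightarrow> 'b set" where
  "piece V \<psi> B i \<equiv> V i \<inter> \<psi> i -` B i"

lemma chart_pieces_preimage:
  assumes "smooth_atlas \<A>" "chart_pieces \<A> K m V \<psi> C B" "i < m"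
  shows "piece V \<psi> B i \<subseteq> C i" "piece V \<psi> B i \<in> sets borel"
proof -
  note c = chart_piecesD[OF assms(2,3)]
  show "piece V \<psi> B i \<subseteq> C i"
    using c(3,5) atlas_chart(3)[OF assms(1) c(1)] unfolding inj_on_def by blast
  show "piece V \<psi> B i \<in> sets borel" by (rule borel_chart_preimage[OF assms(1) c(1,4)])
qed

lemma weighted_integral_pieces:
  fixes \<A> :: "('n::{finite,wellorder}, 'm::{t2_space,second_countable_topology}) param set" and Y :: "'m \<Rightarrow> 'e::euclidean_space"
    and w :: "'m \<Rightarrow> real"
  assumes \<A>: "smooth_atlas \<A>" and cp: "chart_pieces \<A> K m V \<psi> C B" and Y: "smooth_map \<A> Y" and f: "smooth_on UNIV f"
    and w: "continuous_on UNIV w"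
  shows "integrable (weighted_area_measure \<A> Y f) (\<lambda>x. indicator K x * w x)"
    and "(\<integral>x. indicator K x * w x \<partial>weighted_area_measure \<A> Y f)
      = (\<Sum>i<m. \<integral>y. indicator (piece V \<psi> B i) y *
          (w (\<psi> i y) * (exp (f (Y (\<psi> i y))) * area_density (\<psi> i) Y y)) \<partial>lborel)"
proof -
  let ?W = "weighted_area_measure \<A> Y f"
  let ?g = "\<lambda>i y. w (\<psi> i y) * (exp (f (Y (\<psi> i y))) * area_density (\<psi> i) Y y)"
  have wm: "w \<in> borel_measurable borel" using w by (rule borel_measurable_continuous_onI)
  have BV: "B i \<subseteq> \<psi> i ` V i" if "i < m" for i using chart_piecesD[OF cp that] by blast
  have int: "integrable ?W (\<lambda>x. indicator (B i) x * w x)" if i: "i < m" for i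
  proof -
    note c = chart_piecesD[OF cp i]
    have "continuous_on (V i) (\<lambda>y. w (\<psi> i y))"
      by (rule continuous_on_compose2[OF w atlas_chart(4)[OF \<A> c(1)]]) auto
    moreover have "continuous_on (V i) (\<lambda>y. f (Y (\<psi> i y)))"
      by (rule continuous_on_compose2[OF smooth_on_imp_continuous_on[OF f] smooth_on_imp_continuous_on[OF smooth_mapD[OF Y c(1)]]]) auto
    ultimately have "continuous_on (C i) (?g i)"
      using c(3) continuous_on_area_density[OF \<A> c(1) Y]
      by (intro continuous_intros) (auto intro: continuous_on_subset)
    then show ?thesis
      unfolding weighted_integral_in_chart(1)[OF \<A> c(1) Y f c(4) BV[OF i] wm]
      by (rule integrable_indicator_compact[OF chart_pieces_preimage(2,1)[OF \<A> cp i] c(2)])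
  qed
  have ind: "indicator K x * w x = (\<Sum>i<m. indicator (B i) x * w x)" for x
  proof -
    have "disjoint_family_on B {..<m}" "K = (\<Union>i<m. B i)"
      using cp by (auto simp: chart_pieces_def disjoint_family_on_def)
    then have "indicator K x = (\<Sum>i<m. indicator (B i) x :: real)"
      by (simp add: indicator_UN_disjoint)
    then show ?thesis by (simp add: sum_distrib_right)
  qed
  show "integrable ?W (\<lambda>x. indicator K x * w x)" unfolding ind using int by (intro Bochner_Integration.integrable_sum) auto
  have "(\<integral>x. indicator K x * w x \<partial>?W) = (\<Sum>i<m. \<integral>x. indicator (B i) x * w x \<partial>?W)"
    unfolding ind using int by (intro Bochner_Integration.integral_sum) auto
  also have "\<dots> = (\<Sum>i<m. \<integral>y. indicator (piece V \<psi> B i) y * ?g i y \<partial>lborel)"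
    using weighted_integral_in_chart(2)[OF \<A> _ Y f _ BV wm] chart_piecesD[OF cp] by (intro sum.cong) auto
  finally show "(\<integral>x. indicator K x * w x \<partial>?W) = (\<Sum>i<m. \<integral>y. indicator (piece V \<psi> B i) y * ?g i y \<partial>lborel)" .
qed

section \<open>Differentiation under the integral sign\<close>

lemma integral_indicator_bound:
  fixes h :: "'a::euclidean_space \<Rightarrow> real"
  assumes "S \<in> sets borel" "S \<subseteq> C" "compact C" "integrable lborel (\<lambda>y. indicator S y * h y)"
    and "\<And>y. y \<in> S \<Longrightarrow> \<bar>h y\<bar> \<le> c"
  shows "\<bar>\<integral>y. indicator S y * h y \<partial>lborel\<bar> \<le> c * measure lborel S"
proof -
  have "integrable lborel (\<lambda>y. indicator S y * c)"
    by (rule integrable_indicator_compact[OF assms(1-3)]) auto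
  then have "(\<integral>y. \<bar>indicator S y * h y\<bar> \<partial>lborel) \<le> (\<integral>y. indicator S y * c \<partial>lborel)"
    using assms(4,5) by (intro integral_mono) (auto simp: indicator_def)
  moreover have "\<bar>\<integral>y. indicator S y * h y \<partial>lborel\<bar> \<le> (\<integral>y. \<bar>indicator S y * h y\<bar> \<partial>lborel)"
    by (rule integral_abs_bound)
  moreover have "(\<integral>y. indicator S y * c \<partial>lborel) = c * measure lborel S"
    using assms(1) by (simp add: mult.commute)
  ultimately show ?thesis by linarith
qed

text \<open>By the mean value theorem a difference quotient of \<open>g\<close> is a value of
  \<open>g'\<close> at an intermediate time. Uniform continuity of \<open>g'\<close> on a compact
  time interval times \<open>C\<close> brings it close to the value at \<open>t0\<close>, uniformly
  in \<open>y\<close>, and \<open>S\<close> has finite measure.\<close>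

lemma leibniz_indicator:
  fixes g g' :: "real \<times> 'a::euclidean_space \<Rightarrow> real"
  assumes S: "S \<in> sets borel" "S \<subseteq> C" "compact C" and I: "open I" "t0 \<in> I"
    and g: "continuous_on (I \<times> C) g" "continuous_on (I \<times> C) g'"
    and deriv: "\<And>t y. t \<in> I \<Longrightarrow> y \<in> C \<Longrightarrow> ((\<lambda>t. g (t, y)) has_real_derivative g' (t, y)) (at t)"
  shows "((\<lambda>t. \<integral>y. indicator S y * g (t, y) \<partial>lborel) has_real_derivative
    (\<integral>y. indicator S y * g' (t0, y) \<partial>lborel)) (at t0)"
  unfolding has_field_derivative_iff
proof (rule LIM_I)
  let ?G = "\<lambda>t. \<integral>y. indicator S y * g (t, y) \<partial>lborel"
  let ?L = "\<integral>y. indicator S y * g' (t0, y) \<partial>lborel"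
  have ci: "integrable lborel (\<lambda>y. indicator S y * h (t, y))" if "t \<in> I" "continuous_on (I \<times> C) h" for t and h :: "real \<times> 'a \<Rightarrow> real"
  proof (rule integrable_indicator_compact[OF S, of "\<lambda>y. h (t, y)"])
    show "continuous_on C (\<lambda>y. h (t, y))"
      by (rule continuous_on_compose2[OF that(2)]) (use that(1) in \<open>auto intro!: continuous_intros\<close>)
  qed
  fix e :: real assume e: "e > 0"
  \<comment> \<open>Adding 1 to the measure admits null sets and makes the final estimate
    strict.\<close>
  define e' where "e' = e / (measure lborel S + 1)"
  have m: "measure lborel S + 1 > 0" by (simp add: add_nonneg_pos)
  have e': "e' > 0" using e m by (simp add: e'_def)
  obtain r where r: "r > 0" "cball t0 r \<subseteq> I" using I open_contains_cball by blast
  have "compact (cball t0 r \<times> C)" using S(3) by (intro compact_Times) auto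
  moreover have "continuous_on (cball t0 r \<times> C) g'"
    by (rule continuous_on_subset[OF g(2)]) (use r in auto)
  ultimately have "uniformly_continuous_on (cball t0 r \<times> C) g'" by (intro compact_uniformly_continuous)
  then obtain d where d: "d > 0" "\<And>p q. p \<in> cball t0 r \<times> C \<Longrightarrow> q \<in> cball t0 r \<times> C \<Longrightarrow> dist q p < d \<Longrightarrow> dist (g' q) (g' p) < e'"
    using e' unfolding uniformly_continuous_on_def by metis
  show "\<exists>s>0. \<forall>t. t \<noteq> t0 \<and> norm (t - t0) < s \<longrightarrow> norm ((?G t - ?G t0) / (t - t0) - ?L) < e"
  proof (intro exI conjI allI impI)
    show "min d r > 0" using d(1) r(1) by simp
    fix t assume t: "t \<noteq> t0 \<and> norm (t - t0) < min d r"
    then have tI: "t \<in> I" using r by (auto simp: dist_real_def cball_def abs_minus_commute)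
    let ?Q = "\<lambda>y. (g (t, y) - g (t0, y)) / (t - t0) - g' (t0, y)"
    have Q: "\<bar>?Q y\<bar> \<le> e'" if y: "y \<in> S" for y
    proof -
      have "\<exists>\<xi>. \<bar>\<xi> - t0\<bar> \<le> \<bar>t - t0\<bar> \<and> (g (t, y) - g (t0, y)) / (t - t0) = g' (\<xi>, y)"
      proof (cases "t < t0")
        case True
        have "\<exists>\<xi>. t < \<xi> \<and> \<xi> < t0 \<and> g (t0, y) - g (t, y) = (t0 - t) * g' (\<xi>, y)"
          using t r y S(2) by (intro MVT2[OF True] deriv) (auto simp: subset_eq dist_real_def)
        then obtain \<xi> where "t < \<xi>" "\<xi> < t0" "g (t0, y) - g (t, y) = (t0 - t) * g' (\<xi>, y)" by blast
        then show ?thesis using True by (intro exI[of _ \<xi>]) (auto simp: field_simps)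
      next
        case False
        then have True: "t0 < t" using t by auto
        have "\<exists>\<xi>. t0 < \<xi> \<and> \<xi> < t \<and> g (t, y) - g (t0, y) = (t - t0) * g' (\<xi>, y)"
          using t r y S(2) by (intro MVT2[OF True] deriv) (auto simp: subset_eq dist_real_def)
        then obtain \<xi> where "t0 < \<xi>" "\<xi> < t" "g (t, y) - g (t0, y) = (t - t0) * g' (\<xi>, y)" by blast
        then show ?thesis using True by (intro exI[of _ \<xi>]) (auto simp: field_simps)
      qed
      then obtain \<xi> where \<xi>: "\<bar>\<xi> - t0\<bar> \<le> \<bar>t - t0\<bar>" "(g (t, y) - g (t0, y)) / (t - t0) = g' (\<xi>, y)" by blast
      have "dist (g' (\<xi>, y)) (g' (t0, y)) < e'"
        using t \<xi>(1) r(1) y S(2) by (intro d(2)) (auto simp: dist_Pair_Pair dist_real_def abs_minus_commute)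
      then show ?thesis by (simp add: \<xi>(2) dist_real_def)
    qed
    have Qi: "integrable lborel (\<lambda>y. indicator S y * ?Q y)"
    proof -
      have "integrable lborel (\<lambda>y. (indicator S y * g (t, y) - indicator S y * g (t0, y)) / (t - t0) - indicator S y * g' (t0, y))"
        by (intro Bochner_Integration.integrable_diff integrable_divide ci g tI I(2))
      then show ?thesis by (rule back_subst[of "integrable lborel"]) (auto simp: fun_eq_iff indicator_def)
    qed
    have "(?G t - ?G t0) / (t - t0) - ?L = (\<integral>y. (indicator S y * g (t, y) - indicator S y * g (t0, y)) / (t - t0) - indicator S y * g' (t0, y) \<partial>lborel)"
      using ci[OF tI g(1)] ci[OF I(2) g(1)] ci[OF I(2) g(2)] by simp
    also have "\<dots> = (\<integral>y. indicator S y * ?Q y \<partial>lborel)"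
      by (rule Bochner_Integration.integral_cong) (auto simp: indicator_def)
    finally have "norm ((?G t - ?G t0) / (t - t0) - ?L) \<le> e' * measure lborel S"
      using integral_indicator_bound[OF S Qi Q] by simp
    also have "\<dots> < e' * (measure lborel S + 1)" using e' by simp
    also have "\<dots> = e" using m by (simp add: e'_def)
    finally show "norm ((?G t - ?G t0) / (t - t0) - ?L) < e" .
  qed
qed

subsection \<open>First variation\<close>

lemma leibniz_pieces:
  fixes g :: "nat \<Rightarrow> real \<times> (real^'n) \<Rightarrow> real"
  assumes \<A>: "smooth_atlas \<A>" and cp: "chart_pieces \<A> K m V \<psi> C B"
    and g: "\<And>i. i < m \<Longrightarrow> smooth_on (S i) (g i)"
    and sub: "\<And>i. i < m \<Longrightarrow> {-\<delta><..<\<delta>} \<times> C i \<subseteq> S i" and t: "t \<in> {-\<delta><..<\<delta>}"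
  shows "((\<lambda>t. \<Sum>i<m. \<integral>y. indicator (piece V \<psi> B i) y * g i (t, y) \<partial>lborel) has_real_derivative
    (\<Sum>i<m. \<integral>y. indicator (piece V \<psi> B i) y * dt (g i) (t, y) \<partial>lborel)) (at t)"
proof (rule DERIV_sum)
  fix i assume "i \<in> {..<m}"
  then have i: "i < m" by simp
  show "((\<lambda>t. \<integral>y. indicator (piece V \<psi> B i) y * g i (t, y) \<partial>lborel) has_real_derivative
    (\<integral>y. indicator (piece V \<psi> B i) y * dt (g i) (t, y) \<partial>lborel)) (at t)"
  proof (rule leibniz_indicator[OF chart_pieces_preimage(2,1)[OF \<A> cp i] chart_piecesD(2)[OF cp i] open_greaterThanLessThan t])
    show "continuous_on ({-\<delta><..<\<delta>} \<times> C i) (g i)" "continuous_on ({-\<delta><..<\<delta>} \<times> C i) (dt (g i))"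
      using smooth_on_imp_continuous_on[OF g[OF i]] smooth_on_imp_continuous_on[OF smooth_on_dder[OF g[OF i]]]
        sub[OF i] by (auto intro: continuous_on_subset)
    fix s y assume "s \<in> {-\<delta><..<\<delta>}" "y \<in> C i"
    then have "(s, y) \<in> S i" using sub[OF i] by blast
    from has_vector_derivative_time_slice[OF g[OF i] this]
    show "((\<lambda>t. g i (t, y)) has_real_derivative dt (g i) (s, y)) (at s)"
      by (simp add: has_real_derivative_iff_has_vector_derivative)
  qed
qed

lemma weighted_integral_family:
  fixes \<A> :: "('n::{finite,wellorder}, 'm::{t2_space,second_countable_topology}) param set" and F :: "real \<Rightarrow> 'm \<Rightarrow> 'e::euclidean_space"
    and w :: "'m \<Rightarrow> real"
  assumes \<A>: "smooth_atlas \<A>" and cp: "chart_pieces \<A> K m V \<psi> C B"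
    and F: "smooth_family \<A> I F" "open I" "t \<in> I" and f: "smooth_on UNIV f" and w: "continuous_on UNIV w"
  shows "(\<integral>x. indicator K x * w x \<partial>weighted_area_measure \<A> (F t) f)
      = (\<Sum>i<m. \<integral>y. indicator (piece V \<psi> B i) y *
          (w (\<psi> i y) * weighted_density f (\<lambda>(t, y). F t (\<psi> i y)) (t, y)) \<partial>lborel)"
proof -
  have "exp (f (F t (\<psi> i y))) * area_density (\<psi> i) (F t) y = weighted_density f (\<lambda>(t, y). F t (\<psi> i y)) (t, y)"
    if "i < m" "y \<in> V i" for i y
    using area_density_chart[OF F(1) chart_piecesD(1)[OF cp that(1)] F(3) that(2)]
    by (simp add: weighted_density_def)
  then show ?thesis
    unfolding weighted_integral_pieces(2)[OF \<A> cp smooth_family_slice[OF \<A> F] f w]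
    by (intro sum.cong refl Bochner_Integration.integral_cong) (auto simp: indicator_def)
qed

lemma weighted_area_eq_integral:
  fixes \<A> :: "('n::{finite,wellorder}, 'm::{t2_space,second_countable_topology}) param set" and Y :: "'m \<Rightarrow> 'e::euclidean_space"
  assumes "smooth_atlas \<A>" "smooth_map \<A> Y"
  shows "weighted_area \<A> Y f K = (\<integral>x. indicator K x * 1 \<partial>weighted_area_measure \<A> Y f)"
proof -
  have "sets (weighted_area_measure \<A> Y f) = sets borel"
    using is_area_measureD(1)[OF is_area_measure_area_measure[OF assms]] by (simp add: weighted_area_measure_def)
  then have "space (weighted_area_measure \<A> Y f) = space borel" by (rule sets_eq_imp_space_eq)
  then show ?thesis by (simp add: weighted_area_def)
qed

lemma weighted_area_family:
  fixes \<A> :: "('n::{finite,wellorder}, 'm::{t2_space,second_countable_topology}) param set" and F :: "real \<Rightarrow> 'm \<Rightarrow> 'e::euclidean_space"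
  assumes \<A>: "smooth_atlas \<A>" and cp: "chart_pieces \<A> K m V \<psi> C B"
    and F: "smooth_family \<A> I F" "open I" "t \<in> I" and f: "smooth_on UNIV f"
  shows "weighted_area \<A> (F t) f K = (\<Sum>i<m. \<integral>y. indicator (piece V \<psi> B i) y *
          weighted_density f (\<lambda>(t, y). F t (\<psi> i y)) (t, y) \<partial>lborel)"
  unfolding weighted_area_eq_integral[OF \<A> smooth_family_slice[OF \<A> F]]
  using weighted_integral_family[OF assms continuous_on_const, of 1] by simp

text \<open>Contains the hypersurface but no variation, because the first variation formula is
  applied to a variation other than the given one: the one that criticality provides.\<close>

locale weighted_hypersurface =
  fixes \<A> :: "('n::{finite,wellorder}, 'm::{t2_space,second_countable_topology}) param set"
    and X N :: "'m \<Rightarrow> 'e::euclidean_space" and f :: "'e \<Rightarrow> real"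
  assumes dim: "DIM('e) = CARD('n) + 1" and atlas: "smooth_atlas \<A>" and immersion: "immersion \<A> X"
    and N: "smooth_map \<A> N" "unit_normal_field \<A> X N" and f: "smooth_on UNIV f"
begin

text \<open>The weighted mean curvature, that is the trace of the second fundamental form plus the
  normal derivative of \<open>f\<close>.\<close>

definition H :: "'m \<Rightarrow> real" where
  "H x = surf_div \<A> X N x + euclid_grad f (X x) \<bullet> N x"

lemma X: "smooth_map \<A> X"
  using immersion by (simp add: immersion_def)

lemma N_normal: "(V, \<psi>) \<in> \<A> \<Longrightarrow> y \<in> V \<Longrightarrow> N (\<psi> y) \<bullet> dder v (\<lambda>y. X (\<psi> y)) y = 0"
  using N(2) tangent_space_chart[OF atlas _ _ X] unfolding unit_normal_field_def by blast

lemma N_unit: "N x \<bullet> N x = 1"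
  using N(2) by (simp add: unit_normal_field_def norm_eq_1[symmetric])

lemma spatial_derivative_initial:
  fixes \<Phi> :: "real \<times> (real^'n::_) \<Rightarrow> 'e"
  assumes "(V, \<psi>) \<in> \<A>" "smooth_on S \<Phi>" "\<And>y. y \<in> V \<Longrightarrow> (0, y) \<in> S" "\<And>y. y \<in> V \<Longrightarrow> \<Phi> (0, y) = X (\<psi> y)" "y \<in> V"
  shows "dder (0, v) \<Phi> (0, y) = dder v (\<lambda>y. X (\<psi> y)) y"
proof -
  have "dder (0, v) \<Phi> (0, y) = dder v (\<lambda>y. \<Phi> (0, y)) y"
    using dder_slice[OF assms(2) assms(3)[OF assms(5)]] by simp
  also have "\<dots> = dder v (\<lambda>y. X (\<psi> y)) y"
    by (rule dder_cong[OF atlas_chart(1)[OF atlas assms(1)] assms(5,4)])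
  finally show ?thesis .
qed

lemma gram_det_pos_initial:
  fixes \<Phi> :: "real \<times> (real^'n::_) \<Rightarrow> 'e"
  assumes "(V, \<psi>) \<in> \<A>" "smooth_on S \<Phi>" "\<And>y. y \<in> V \<Longrightarrow> (0, y) \<in> S" "\<And>y. y \<in> V \<Longrightarrow> \<Phi> (0, y) = X (\<psi> y)" "y \<in> V"
  shows "gram_det \<Phi> (0, y) > 0"
proof (rule gram_det_pos[OF assms(2) assms(3)[OF assms(5)]])
  show "inj (\<lambda>v. dder (0, v) \<Phi> (0, y))"
    using inj_chart[OF atlas assms(1,5) immersion] spatial_derivative_initial[OF assms] by simp
qed

lemma first_variation_chart:
  assumes c: "(V, \<psi>) \<in> \<A>" and S: "open S" and \<Phi>: "smooth_on S \<Phi>" "\<And>y. y \<in> V \<Longrightarrow> (0, y) \<in> S"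
      "\<And>y. y \<in> V \<Longrightarrow> \<Phi> (0, y) = X (\<psi> y)"
    and w: "smooth_on V w" "\<And>y. y \<in> V \<Longrightarrow> dt \<Phi> (0, y) = w y *\<^sub>R N (\<psi> y)" and y: "y \<in> V"
  shows "dt (log_density f \<Phi>) (0, y) = w y * H (\<psi> y)"
proof -
  obtain b :: "'n \<Rightarrow> 'e" and q where fr: "bij_betw b UNIV (tangent_frame \<A> X (\<psi> y))"
    "\<And>i. dder (q i) (\<lambda>y. X (\<psi> y)) y = b i" "\<And>i j. b i \<bullet> b j = (if i = j then 1 else 0)"
    by (rule tangent_frame_chart[OF atlas c y immersion]) (use that in blast)
  have "dt (log_density f \<Phi>) (0, y)
      = w y * ((\<Sum>i\<in>UNIV. dder (q i) (\<lambda>y. N (\<psi> y)) y \<bullet> b i) + euclid_grad f (\<Phi> (0, y)) \<bullet> N (\<psi> y))"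
  proof (rule first_variation_pointwise[OF S \<Phi>(1) f atlas_chart(1)[OF atlas c] \<Phi>(2) y smooth_mapD[OF N(1) c] w _ fr(3)])
    show "dder (0, q i) \<Phi> (0, y) = b i" for i
      using spatial_derivative_initial[OF c \<Phi> y] fr(2) by simp
    show "N (\<psi> y) \<bullet> b i = 0" for i using N_normal[OF c y] fr(2) by metis
  qed
  then show ?thesis
    using surf_div_chart[OF atlas c y immersion N(1) fr(1,2)] \<Phi>(3)[OF y] by (simp add: H_def)
qed

text \<open>\<open>H\<close> is smooth because it is the logarithmic derivative of the density along \<open>X + t N\<close>.\<close>

lemma smooth_map_H: "smooth_map \<A> H"
  unfolding smooth_map_def
proof safe
  fix V \<psi> assume c: "(V, \<psi>) \<in> \<A>"
  let ?S = "UNIV \<times> V :: (real \<times> (real^'n::_)) set"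
  let ?\<Phi> = "\<lambda>p. X (\<psi> (snd p)) + fst p *\<^sub>R N (\<psi> (snd p))"
  have V: "open V" by (rule atlas_chart(1)[OF atlas c])
  then have S: "open ?S" by (simp add: open_Times)
  have snd: "smooth_on ?S (\<lambda>p. h (\<psi> (snd p)))" if "smooth_map \<A> h" for h :: "'m \<Rightarrow> 'e"
    by (rule smooth_on_compose[OF S smooth_mapD[OF that c] smooth_on_bounded_linear[OF bounded_linear_snd]]) auto
  have \<Phi>: "smooth_on ?S ?\<Phi>"
    by (rule smooth_on_add[OF S snd[OF X] smooth_on_scaleR[OF S smooth_on_bounded_linear[OF bounded_linear_fst] snd[OF N(1)]]])
  have \<Phi>': "\<And>y. y \<in> V \<Longrightarrow> (0, y) \<in> ?S" "\<And>y. y \<in> V \<Longrightarrow> ?\<Phi> (0, y) = X (\<psi> y)" by auto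
  have vel: "dt ?\<Phi> (0, y) = 1 *\<^sub>R N (\<psi> y)" if "y \<in> V" for y
  proof -
    have "((\<lambda>s. ?\<Phi> (s, y)) has_vector_derivative dt ?\<Phi> (0, y)) (at 0)"
      by (rule has_vector_derivative_time_slice[OF \<Phi>]) (use that in auto)
    moreover have "((\<lambda>s. ?\<Phi> (s, y)) has_vector_derivative N (\<psi> y)) (at 0)"
      by (auto intro!: derivative_eq_intros)
    ultimately show ?thesis using vector_derivative_unique_at by simp
  qed
  have H: "H (\<psi> y) = dt (log_density f ?\<Phi>) (0, y)" if "y \<in> V" for y
    using first_variation_chart[OF c S \<Phi> \<Phi>' smooth_on_const vel that] by simp
  \<comment> \<open>The family \<open>X + t N\<close> may degenerate away from time 0; the log
    density is smooth where the Gram determinant is positive, and this open set contains time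
    0.\<close>
  let ?S' = "{p \<in> ?S. gram_det ?\<Phi> p > 0}"
  have S': "open ?S'" by (rule open_gram_det_pos[OF S \<Phi>])
  have "smooth_on ?S' (log_density f ?\<Phi>)"
    by (rule smooth_on_log_density[OF S' smooth_on_subset[OF \<Phi>] f]) auto
  then have "smooth_on V (\<lambda>y. dt (log_density f ?\<Phi>) (0, y))"
    using gram_det_pos_initial[OF c \<Phi> \<Phi>'] by (intro smooth_on_slice[OF S' smooth_on_dder V]) auto
  then show "smooth_on V (H \<circ> \<psi>)"
    using smooth_on_cong[OF V, of "H \<circ> \<psi>"] H by simp
qed

text \<open>Positivity of the Gram determinant is an open condition that holds at time 0. The tube
  lemma gives a time interval for each compact \<open>C i\<close>, and finitely many intervals have
  a common subinterval.\<close>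

lemma uniform_immersion:
  assumes cp: "chart_pieces \<A> K m V \<psi> C B" and F: "smooth_family \<A> {-\<epsilon><..<\<epsilon>} F" "F 0 = X" and \<epsilon>: "0 < \<epsilon>"
  shows "\<exists>\<delta>>0. \<delta> \<le> \<epsilon> \<and> (\<forall>i<m. {-\<delta><..<\<delta>} \<times> C i \<subseteq>
    {p \<in> {-\<epsilon><..<\<epsilon>} \<times> V i. gram_det (\<lambda>(t, y). F t (\<psi> i y)) p > 0})"
proof -
  let ?S = "\<lambda>i. {p \<in> {-\<epsilon><..<\<epsilon>} \<times> V i. gram_det (\<lambda>(t, y). F t (\<psi> i y)) p > 0}"
  have "\<exists>T. 0 \<in> T \<and> open T \<and> T \<times> C i \<subseteq> ?S i" if i: "i < m" for i
  proof -
    note c = chart_piecesD[OF cp i]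
    have o: "open ({-\<epsilon><..<\<epsilon>} \<times> V i)" using atlas_chart(1)[OF atlas c(1)] by (simp add: open_Times)
    have "open (?S i)" by (rule open_gram_det_pos[OF o smooth_familyD[OF F(1) c(1)]])
    moreover have "{0} \<times> C i \<subseteq> ?S i"
      using gram_det_pos_initial[OF c(1) smooth_familyD[OF F(1) c(1)]] c(3) \<epsilon> F(2) by auto
    ultimately show ?thesis by (rule Elementary_Topology.tube_lemma[OF c(2)])
  qed
  then have "\<forall>i. \<exists>T. i < m \<longrightarrow> 0 \<in> T \<and> open T \<and> T \<times> C i \<subseteq> ?S i" by blast
  from choice[OF this] obtain T where "\<forall>i. i < m \<longrightarrow> 0 \<in> T i \<and> open (T i) \<and> T i \<times> C i \<subseteq> ?S i" ..
  then have T: "\<And>i. i < m \<Longrightarrow> 0 \<in> T i \<and> open (T i) \<and> T i \<times> C i \<subseteq> ?S i" by blast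
  have o: "open ({-\<epsilon><..<\<epsilon>} \<inter> (\<Inter>i<m. T i))" using T by (intro open_Int open_INT) auto
  have z: "0 \<in> {-\<epsilon><..<\<epsilon>} \<inter> (\<Inter>i<m. T i)" using T \<epsilon> by auto
  obtain r where r: "r > 0" "ball 0 r \<subseteq> {-\<epsilon><..<\<epsilon>} \<inter> (\<Inter>i<m. T i)"
    by (rule openE[OF o z])
  have b: "ball 0 r = {-r<..<r}" by (auto simp: dist_real_def)
  have "r \<le> \<epsilon>"
  proof (rule ccontr)
    assume "\<not> r \<le> \<epsilon>"
    then have "\<epsilon> \<in> ball 0 r" using \<epsilon> by simp
    then show False using r(2) by auto
  qed
  moreover have "{-r<..<r} \<times> C i \<subseteq> ?S i" if "i < m" for i
  proof -
    have "{-r<..<r} \<subseteq> T i" using r(2) that unfolding b by auto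
    then show ?thesis using T[OF that] by (meson Sigma_mono subset_refl subset_trans)
  qed
  ultimately show ?thesis using r(1) by blast
qed

lemma velocity_chart_initial:
  assumes cnv: "compact_normal_variation \<A> X \<epsilon> K F" and c: "(V, \<psi>) \<in> \<A>" and y: "y \<in> V"
  shows "velocity F 0 (\<psi> y) = (velocity F 0 (\<psi> y) \<bullet> N (\<psi> y)) *\<^sub>R N (\<psi> y)"
proof -
  obtain b :: "'n \<Rightarrow> 'e" and q where fr: "\<And>i. dder (q i) (\<lambda>y. X (\<psi> y)) y = b i" "\<And>i j. b i \<bullet> b j = (if i = j then 1 else 0)"
    by (rule tangent_frame_chart[OF atlas c y immersion]) (use that in blast)
  have "velocity F 0 (\<psi> y) \<bullet> dder v (\<lambda>y. X (\<psi> y)) y = 0" for v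
    using cnv tangent_space_chart[OF atlas c y X] unfolding compact_normal_variation_def by auto
  then show ?thesis
    using N_normal[OF c y] fr N_unit by (intro hyperplane_normal[OF dim fr(2)]) metis+
qed

text \<open>Differentiation happens piece by piece in charts, and the result is put together again
  as an intrinsic integral. Volume preservation is not assumed, so the formula applies to any
  variation behind \<open>has_first_variation\<close>.\<close>

lemma first_variation:
  assumes cnv: "compact_normal_variation \<A> X \<epsilon> K F"
  shows "((\<lambda>t. weighted_area \<A> (F t) f K) has_real_derivative
    (\<integral>x. indicator K x * ((velocity F 0 x \<bullet> N x) * H x) \<partial>weighted_area_measure \<A> X f)) (at 0)"
proof -
  have \<epsilon>: "0 < \<epsilon>" and F: "smooth_family \<A> {-\<epsilon><..<\<epsilon>} F" "F 0 = X" and K: "compact K"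
    using cnv by (auto simp: compact_normal_variation_def)
  obtain m V \<psi> C B where cp: "chart_pieces \<A> K m V \<psi> C B" using chart_pieces_exist[OF atlas K] by blast
  let ?\<Phi> = "\<lambda>i (t, y). F t (\<psi> i y)"
  let ?S = "\<lambda>i. {p \<in> {-\<epsilon><..<\<epsilon>} \<times> V i. gram_det (?\<Phi> i) p > 0}"
  let ?w = "\<lambda>x. velocity F 0 x \<bullet> N x"
  obtain \<delta> where \<delta>: "\<delta> > 0" "\<delta> \<le> \<epsilon>" "\<And>i. i < m \<Longrightarrow> {-\<delta><..<\<delta>} \<times> C i \<subseteq> ?S i"
    using uniform_immersion[OF cp F \<epsilon>] by blast
  have vel: "smooth_map \<A> (velocity F 0)"
    by (rule smooth_family_slice[OF atlas smooth_family_velocity[OF atlas F(1)]]) (use \<epsilon> in auto)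
  have ws: "smooth_on V (\<lambda>y. ?w (\<psi> y))" if "(V, \<psi>) \<in> \<A>" for V \<psi>
    by (rule smooth_on_inner[OF atlas_chart(1)[OF atlas that] smooth_mapD[OF vel that] smooth_mapD[OF N(1) that]])
  have op: "open ({-\<epsilon><..<\<epsilon>} \<times> V i)" if "i < m" for i
    using atlas_chart(1)[OF atlas chart_piecesD(1)[OF cp that]] by (simp add: open_Times)
  have sm: "smooth_on ({-\<epsilon><..<\<epsilon>} \<times> V i) (?\<Phi> i)" if "i < m" for i
    by (rule smooth_familyD[OF F(1) chart_piecesD(1)[OF cp that]])
  have op': "open (?S i)" if "i < m" for i by (rule open_gram_det_pos[OF op[OF that] sm[OF that]])
  have sm': "smooth_on (?S i) (?\<Phi> i)" if "i < m" for i
    by (rule smooth_on_subset[OF sm[OF that]]) auto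
  have g: "smooth_on (?S i) (weighted_density f (?\<Phi> i))" if "i < m" for i
    by (rule smooth_on_weighted_density[OF op'[OF that] sm'[OF that] f]) auto
  have area: "weighted_area \<A> (F t) f K
      = (\<Sum>i<m. \<integral>y. indicator (piece V \<psi> B i) y * weighted_density f (?\<Phi> i) (t, y) \<partial>lborel)"
    if "t \<in> {-\<delta><..<\<delta>}" for t
    by (rule weighted_area_family[OF atlas cp F(1) open_greaterThanLessThan _ f]) (use that \<delta>(2) in auto)
  have t0: "0 \<in> {-\<delta><..<\<delta>}" using \<delta>(1) by auto
  have "(\<Sum>i<m. \<integral>y. indicator (piece V \<psi> B i) y * dt (weighted_density f (?\<Phi> i)) (0, y) \<partial>lborel)
      = (\<Sum>i<m. \<integral>y. indicator (piece V \<psi> B i) y * ((?w (\<psi> i y) * H (\<psi> i y)) * weighted_density f (?\<Phi> i) (0, y)) \<partial>lborel)"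
  proof (intro sum.cong refl Bochner_Integration.integral_cong)
    fix i y assume "i \<in> {..<m}"
    then have i: "i < m" by simp
    note c = chart_piecesD[OF cp i]
    have "dt (weighted_density f (?\<Phi> i)) (0, y) = (?w (\<psi> i y) * H (\<psi> i y)) * weighted_density f (?\<Phi> i) (0, y)"
      if y: "y \<in> piece V \<psi> B i"
    proof -
      have yC: "y \<in> C i" using chart_pieces_preimage(1)[OF atlas cp i] y by blast
      then have yV: "y \<in> V i" and y0: "(0, y) \<in> ?S i" using c(3) \<delta>(3)[OF i] t0 by blast+
      have vel: "dt (?\<Phi> i) (0, z) = ?w (\<psi> i z) *\<^sub>R N (\<psi> i z)" if "z \<in> V i" for z
        using velocity_chart_initial[OF cnv c(1) that] velocity_chart[OF F(1) c(1) _ that, of 0] \<epsilon> by simp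
      have "dt (log_density f (?\<Phi> i)) (0, y) = ?w (\<psi> i y) * H (\<psi> i y)"
        by (rule first_variation_chart[OF c(1) op[OF i] sm[OF i] _ _ ws[OF c(1)] vel yV]) (use \<epsilon> F(2) in auto)
      moreover have "dt (weighted_density f (?\<Phi> i)) (0, y)
          = weighted_density f (?\<Phi> i) (0, y) * dt (log_density f (?\<Phi> i)) (0, y)"
        by (rule dder_weighted_density[OF op'[OF i] sm'[OF i] f _ y0]) auto
      ultimately show ?thesis by simp
    qed
    then show "indicator (piece V \<psi> B i) y * dt (weighted_density f (?\<Phi> i)) (0, y)
      = indicator (piece V \<psi> B i) y * ((?w (\<psi> i y) * H (\<psi> i y)) * weighted_density f (?\<Phi> i) (0, y))"
      by (auto simp: indicator_def)
  qed
  also have "\<dots> = (\<integral>x. indicator K x * (?w x * H x) \<partial>weighted_area_measure \<A> (F 0) f)"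
  proof (rule weighted_integral_family[OF atlas cp F(1) open_greaterThanLessThan _ f, symmetric])
    show "0 \<in> {-\<epsilon><..<\<epsilon>}" using \<epsilon> by simp
    show "continuous_on UNIV (\<lambda>x. ?w x * H x)"
      using ws smooth_mapD[OF smooth_map_H]
      by (intro smooth_map_continuous[OF atlas] continuous_on_mult smooth_on_imp_continuous_on) auto
  qed
  finally have "((\<lambda>t. \<Sum>i<m. \<integral>y. indicator (piece V \<psi> B i) y * weighted_density f (?\<Phi> i) (t, y) \<partial>lborel)
      has_real_derivative (\<integral>x. indicator K x * (?w x * H x) \<partial>weighted_area_measure \<A> X f)) (at 0)"
    using leibniz_pieces[OF atlas cp g \<delta>(3) t0] F(2) by simp
  then show ?thesis
    by (rule has_field_derivative_transform_within_open[OF _ open_greaterThanLessThan t0]) (rule area[symmetric])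
qed

end

subsection \<open>Second variation\<close>

text \<open>The moving unit normal \<nu>, existentially quantified in
  \<open>preserves_weighted_volume\<close>, is fixed here so that it can be differentiated in
  time.\<close>

locale preserving_variation = weighted_hypersurface \<A> X N f
  for \<A> :: "('n::{finite,wellorder}, 'm::{t2_space,second_countable_topology}) param set"
    and X N :: "'m \<Rightarrow> 'e::euclidean_space" and f :: "'e \<Rightarrow> real" +
  fixes \<epsilon> :: real and K :: "'m set" and F \<nu> :: "real \<Rightarrow> 'm \<Rightarrow> 'e"
  assumes cnv: "compact_normal_variation \<A> X \<epsilon> K F"
    and \<nu>: "smooth_family \<A> {-\<epsilon><..<\<epsilon>} \<nu>" "\<nu> 0 = N"
    and \<nu>_normal: "\<And>t. t \<in> {-\<epsilon><..<\<epsilon>} \<Longrightarrow> unit_normal_field \<A> (F t) (\<nu> t)"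
    and volume: "\<And>t. t \<in> {-\<epsilon><..<\<epsilon>} \<Longrightarrow> (\<integral>x. velocity F t x \<bullet> \<nu> t x \<partial>weighted_area_measure \<A> (F t) f) = 0"
begin

abbreviation I :: "real set" where "I \<equiv> {-\<epsilon><..<\<epsilon>}"

definition \<phi> :: "real \<Rightarrow> 'm \<Rightarrow> real" where "\<phi> t x = velocity F t x \<bullet> \<nu> t x"
definition u :: "'m \<Rightarrow> real" where "u = \<phi> 0"
definition J :: "'m \<Rightarrow> real" where
  "J x = surf_laplacian \<A> X u x + (second_ff_norm \<A> X N x)\<^sup>2 * u x
     - euclid_hess f (X x) (N x) (N x) * u x + euclid_grad f (X x) \<bullet> surf_grad \<A> X u x"

text \<open>The normalized time derivative at \<open>0\<close> of the weighted volume density \<open>\<phi> e\<^sup>f d\<A>\<close>.\<close>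

definition v :: "'m \<Rightarrow> real" where "v x = velocity \<phi> 0 x + (u x)\<^sup>2 * H x"

lemma \<epsilon>: "0 < \<epsilon>" and F: "smooth_family \<A> I F" and F0: "F 0 = X" and K: "compact K"
  using cnv by (auto simp: compact_normal_variation_def)

lemma \<phi>: "smooth_family \<A> I \<phi>"
  unfolding smooth_family_def
proof safe
  fix V \<psi> assume c: "(V, \<psi>) \<in> \<A>"
  have "open (I \<times> V)" using atlas_chart(1)[OF atlas c] by (simp add: open_Times)
  from smooth_on_inner[OF this smooth_familyD[OF smooth_family_velocity[OF atlas F] c] smooth_familyD[OF \<nu>(1) c]]
  show "smooth_on (I \<times> V) (\<lambda>(t, y). \<phi> t (\<psi> y))"
    by (simp add: \<phi>_def split_def)
qed

lemma \<phi>_outside: "t \<in> I \<Longrightarrow> x \<notin> K \<Longrightarrow> \<phi> t x = 0"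
proof -
  assume t: "t \<in> I" and x: "x \<notin> K"
  have "((\<lambda>s. F s x) has_vector_derivative 0) (at t)"
    by (rule has_vector_derivative_transform_within_open[OF has_vector_derivative_const[of "X x"] open_greaterThanLessThan t])
       (use cnv x in \<open>auto simp: compact_normal_variation_def\<close>)
  then have "velocity F t x = 0" unfolding velocity_def by (rule vector_derivative_at)
  then show "\<phi> t x = 0" by (simp add: \<phi>_def)
qed

lemma v_outside: "x \<notin> K \<Longrightarrow> v x = 0"
proof -
  assume x: "x \<notin> K"
  have "((\<lambda>s. \<phi> s x) has_vector_derivative 0) (at 0)"
    by (rule has_vector_derivative_transform_within_open[OF has_vector_derivative_const[of "0::real"] open_greaterThanLessThan[of "-\<epsilon>" \<epsilon>]])
       (use \<phi>_outside x \<epsilon> in auto)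
  then have "velocity \<phi> 0 x = 0" unfolding velocity_def by (rule vector_derivative_at)
  moreover have "u x = 0" using \<phi>_outside x \<epsilon> by (simp add: u_def)
  ultimately show "v x = 0" by (simp add: v_def)
qed

lemma smooth_map_u: "smooth_map \<A> u"
  unfolding u_def by (rule smooth_family_slice[OF atlas \<phi>]) (use \<epsilon> in auto)

text \<open>Since \<open>v\<close> involves \<open>H\<close>, smoothness of \<open>H\<close> is what
  makes \<open>v\<close> an admissible test function for criticality.\<close>

lemma smooth_map_v: "smooth_map \<A> v"
  unfolding smooth_map_def
proof safe
  fix V \<psi> assume c: "(V, \<psi>) \<in> \<A>"
  have "smooth_map \<A> (velocity \<phi> 0)"
    by (rule smooth_family_slice[OF atlas smooth_family_velocity[OF atlas \<phi>]]) (use \<epsilon> in auto)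
  note s = smooth_mapD[OF this c] smooth_mapD[OF smooth_map_u c] smooth_mapD[OF smooth_map_H c]
  note V = atlas_chart(1)[OF atlas c]
  have "smooth_on V (\<lambda>y. velocity \<phi> 0 (\<psi> y) + (u (\<psi> y) * u (\<psi> y)) * H (\<psi> y))"
    by (rule smooth_on_add[OF V s(1) smooth_on_mult[OF V smooth_on_mult[OF V s(2) s(2)] s(3)]])
  then show "smooth_on V (v \<circ> \<psi>)" by (simp add: v_def[abs_def] o_def power2_eq_square)
qed

section \<open>The variation in a single chart\<close>

context
  fixes V :: "(real^'n::_) set" and \<psi> :: "real^'n::_ \<Rightarrow> 'm"
  assumes c: "(V, \<psi>) \<in> \<A>"
begin

abbreviation \<Phi> :: "real \<times> (real^'n::_) \<Rightarrow> 'e" where "\<Phi> \<equiv> \<lambda>(t, y). F t (\<psi> y)"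
abbreviation \<nu>' :: "real \<times> (real^'n::_) \<Rightarrow> 'e" where "\<nu>' \<equiv> \<lambda>(t, y). \<nu> t (\<psi> y)"
abbreviation \<phi>' :: "real \<times> (real^'n::_) \<Rightarrow> real" where "\<phi>' \<equiv> \<lambda>(t, y). \<phi> t (\<psi> y)"
text \<open>The part of space-time on which the time slices are immersed in this chart. It is open
  and contains every point at time 0, so derivatives at time 0 can be computed in it.\<close>

abbreviation S :: "(real \<times> (real^'n::_)) set" where
  "S \<equiv> {p \<in> I \<times> V. gram_det \<Phi> p > 0}"

lemma V: "open V" by (rule atlas_chart(1)[OF atlas c])

lemma open_S: "open S"
  using V by (intro open_gram_det_pos[OF _ smooth_familyD[OF F c]]) (simp add: open_Times)

lemma smooth_on_S: "smooth_on S \<Phi>" "smooth_on S \<nu>'" "smooth_on S \<phi>'"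
  using smooth_familyD[OF F c] smooth_familyD[OF \<nu>(1) c] smooth_familyD[OF \<phi> c]
  by (auto intro: smooth_on_subset)

lemma initial_in_S: "y \<in> V \<Longrightarrow> (0, y) \<in> S"
  using gram_det_pos_initial[OF c smooth_familyD[OF F c]] \<epsilon> F0 by auto

lemma F_smooth_map: "t \<in> I \<Longrightarrow> smooth_map \<A> (F t)"
  by (rule smooth_family_slice[OF atlas F open_greaterThanLessThan])

lemma tangent_S:
  assumes "(t, y) \<in> S"
  shows "tangent_space \<A> (F t) (\<psi> y) = range (\<lambda>w. dder (0, w) \<Phi> (t, y))"
  using assms tangent_space_chart[OF atlas c _ F_smooth_map] spatial_derivative_chart[OF F c] by auto

lemma \<nu>_unit: "p \<in> S \<Longrightarrow> \<nu>' p \<bullet> \<nu>' p = 1"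
  using \<nu>_normal by (auto simp: unit_normal_field_def norm_eq_1[symmetric])

lemma \<nu>_orth: "p \<in> S \<Longrightarrow> \<nu>' p \<bullet> dder (0, w) \<Phi> p = 0"
  using \<nu>_normal tangent_S unfolding unit_normal_field_def by (cases p) fastforce

text \<open>On \<open>S\<close> the tangent space has full dimension, so being orthogonal to it
  leaves only multiples of the unit normal.\<close>

lemma velocity_S: "p \<in> S \<Longrightarrow> dt \<Phi> p = \<phi>' p *\<^sub>R \<nu>' p"
proof -
  assume p: "p \<in> S"
  obtain t y where ty: "p = (t, y)" by (cases p)
  then have t: "t \<in> I" and y: "y \<in> V" using p by auto
  let ?T = "\<lambda>w. dder (0, w) \<Phi> p"
  have lin: "linear ?T" by (rule linear_dder_spatial[OF smooth_on_S(1) p])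
  have inj: "inj ?T" by (rule inj_of_gram_det_nonzero[OF smooth_on_S(1) p]) (use p in auto)
  obtain B where B: "orthonormal_basis (range ?T) B"
    using orthonormal_basis_exists[OF linear_subspace_image[OF lin subspace_UNIV]] .
  obtain b :: "'n \<Rightarrow> 'e" and q where b: "\<And>i. ?T (q i) = b i" "\<And>i j. b i \<bullet> b j = (if i = j then 1 else 0)"
    by (rule orthonormal_frame[OF lin inj B]) (use that in blast)
  have vel: "velocity F t (\<psi> y) = dt \<Phi> p"
    using velocity_chart[OF F c t y] ty by simp
  have "dt \<Phi> p \<bullet> ?T w = 0" for w
  proof -
    have "?T w \<in> tangent_space \<A> (F t) (\<psi> y)" using tangent_S[of t y] p ty by simp
    then show ?thesis using cnv t unfolding vel[symmetric] compact_normal_variation_def by blast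
  qed
  then have "dt \<Phi> p = (dt \<Phi> p \<bullet> \<nu>' p) *\<^sub>R \<nu>' p"
    using \<nu>_orth[OF p] \<nu>_unit[OF p] b(1) by (intro hyperplane_normal[OF dim b(2)]) metis+
  then show ?thesis using vel by (simp add: \<phi>_def ty)
qed

text \<open>Obtained by differentiating in time that \<nu> has length 1 and is orthogonal to the
  tangent vectors. The time derivative of a tangent vector has normal part equal to the spatial
  derivative of the normal speed.\<close>

lemma \<nu>_time_derivative:
  assumes y: "y \<in> V"
  shows "N (\<psi> y) \<bullet> dt \<nu>' (0, y) = 0"
    and "dt \<nu>' (0, y) \<bullet> dder w (\<lambda>y. X (\<psi> y)) y = - dder w (\<lambda>y. u (\<psi> y)) y"
proof -
  let ?p = "(0, y)" and ?e = "(1, 0) :: real \<times> (real^'n::_)"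
  have p: "?p \<in> S" by (rule initial_in_S[OF y])
  have orth: "\<nu>' ?p \<bullet> dder a \<nu>' ?p = 0" for a
  proof -
    have "dder a (\<lambda>p. \<nu>' p \<bullet> \<nu>' p) ?p = dder a (\<lambda>p. 1) ?p"
      by (rule dder_cong[OF open_S p \<nu>_unit])
    also have "\<dots> = 0" by (simp add: dder_def)
    finally show ?thesis
      using dder_inner[OF smooth_on_S(2) smooth_on_S(2) p, of a] by (simp add: inner_commute)
  qed
  then show "N (\<psi> y) \<bullet> dder ?e \<nu>' ?p = 0" using \<nu>(2) by (metis case_prod_conv)
  have "dder ?e (dder (0, w) \<Phi>) ?p = dder (0, w) (dder ?e \<Phi>) ?p"
    by (rule dder_commute[OF open_S smooth_on_S(1) p])
  also have "\<dots> = dder (0, w) (\<lambda>p. \<phi>' p *\<^sub>R \<nu>' p) ?p"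
    by (rule dder_cong[OF open_S p velocity_S])
  also have "\<dots> = dder (0, w) \<phi>' ?p *\<^sub>R \<nu>' ?p + \<phi>' ?p *\<^sub>R dder (0, w) \<nu>' ?p"
    by (rule dder_scaleR[OF smooth_on_S(3,2) p])
  finally have 1: "\<nu>' ?p \<bullet> dder ?e (dder (0, w) \<Phi>) ?p = dder (0, w) \<phi>' ?p"
    using orth \<nu>_unit[OF p] by (simp add: inner_add_right)
  have "dder ?e (\<lambda>p. \<nu>' p \<bullet> dder (0, w) \<Phi> p) ?p = dder ?e (\<lambda>p. 0) ?p"
    by (rule dder_cong[OF open_S p \<nu>_orth])
  also have "\<dots> = 0" by (simp add: dder_def)
  finally have 2: "dder ?e \<nu>' ?p \<bullet> dder (0, w) \<Phi> ?p + \<nu>' ?p \<bullet> dder ?e (dder (0, w) \<Phi>) ?p = 0"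
    using dder_inner[OF smooth_on_S(2) smooth_on_dder[OF smooth_on_S(1)] p] by simp
  have t0: "0 \<in> I" using \<epsilon> by simp
  have "dder (0, w) \<phi>' ?p = dder w (\<lambda>y. u (\<psi> y)) y"
    using spatial_derivative_chart[OF \<phi> c t0 y] by (simp add: u_def)
  moreover have "dder (0, w) \<Phi> ?p = dder w (\<lambda>y. X (\<psi> y)) y"
    using spatial_derivative_chart[OF F c t0 y] F0 by simp
  ultimately show "dder ?e \<nu>' ?p \<bullet> dder w (\<lambda>y. X (\<psi> y)) y = - dder w (\<lambda>y. u (\<psi> y)) y"
    using 1 2 by simp
qed

text \<open>The time derivative of the normal is tangent and represents minus the differential of
  \<open>u\<close>. The gradient, defined by a description, thereby becomes an explicit smooth
  field.\<close>

lemma surf_grad_chart: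
  assumes y: "y \<in> V"
  shows "surf_grad \<A> X u (\<psi> y) = - dt \<nu>' (0, y)"
proof (rule surf_grad_eqI)
  let ?g = "- dt \<nu>' (0, y)" and ?T = "\<lambda>w. dder w (\<lambda>y. X (\<psi> y)) y"
  note T = tangent_space_chart[OF atlas c y X]
  have lin: "linear ?T" by (rule smooth_on_linear_dder[OF smooth_mapD[OF X c] y])
  show sub: "subspace (tangent_space \<A> X (\<psi> y))"
    unfolding T by (rule linear_subspace_image[OF lin subspace_UNIV])
  obtain b :: "'n \<Rightarrow> 'e" and q where fr: "\<And>i. ?T (q i) = b i" "\<And>i j. b i \<bullet> b j = (if i = j then 1 else 0)"
    by (rule tangent_frame_chart[OF atlas c y immersion]) (use that in blast)
  have "N (\<psi> y) \<bullet> b i = 0" for i using N_normal[OF c y] fr(1) by metis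
  note expansion = hyperplane_expansion[OF dim fr(2) N_unit this, of ?g]
  have gN: "?g \<bullet> N (\<psi> y) = 0" using \<nu>_time_derivative(1)[OF y] by (simp add: inner_commute)
  have "?g = (\<Sum>i\<in>UNIV. (?g \<bullet> b i) *\<^sub>R b i)"
    using expansion unfolding gN scaleR_zero_left add_0_left .
  moreover have "b i \<in> tangent_space \<A> X (\<psi> y)" for i unfolding T using fr(1) by (metis rangeI)
  then have "(\<Sum>i\<in>UNIV. (?g \<bullet> b i) *\<^sub>R b i) \<in> tangent_space \<A> X (\<psi> y)"
    by (intro subspace_sum[OF sub] subspace_scale[OF sub])
  ultimately show "?g \<in> tangent_space \<A> X (\<psi> y)"
    by (rule ssubst[where P = "\<lambda>z. z \<in> tangent_space \<A> X (\<psi> y)"])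
  fix e assume "e \<in> tangent_space \<A> X (\<psi> y)"
  then obtain w where "e = ?T w" unfolding T by auto
  then show "?g \<bullet> e = tderiv \<A> X u (\<psi> y) e"
    using tderiv_chart[OF atlas c y immersion smooth_map_u] \<nu>_time_derivative(2)[OF y, of w] by simp
qed

end

lemma surf_grad_u: "surf_grad \<A> X u x = - velocity \<nu> 0 x"
proof -
  obtain V \<psi> y where c: "(V, \<psi>) \<in> \<A>" "y \<in> V" "x = \<psi> y" using atlas_cover[OF atlas] .
  then show ?thesis
    using surf_grad_chart[OF c(1,2)] velocity_chart[OF \<nu>(1) c(1) _ c(2), of 0] \<epsilon> by simp
qed

section \<open>Derivatives of the weighted density at time 0\<close>

abbreviation D :: "(real^'n::_ \<Rightarrow> 'm) \<Rightarrow> real \<times> (real^'n::_) \<Rightarrow> real" where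
  "D \<psi> \<equiv> weighted_density f (\<lambda>(t, y). F t (\<psi> y))"

abbreviation logD :: "(real^'n::_ \<Rightarrow> 'm) \<Rightarrow> real \<times> (real^'n::_) \<Rightarrow> real" where
  "logD \<psi> \<equiv> log_density f (\<lambda>(t, y). F t (\<psi> y))"

text \<open>Since the normal evolves by minus the gradient of \<open>u\<close>, the divergence of
  its time derivative is minus the Laplacian, and its product with the gradient of \<open>f\<close>
  gives the first-order term of \<open>J\<close>.\<close>

lemma second_variation_log_density:
  assumes c: "(V, \<psi>) \<in> \<A>" and y: "y \<in> V"
  shows "dt (dt (logD \<psi>)) (0, y)
    = velocity \<phi> 0 (\<psi> y) * H (\<psi> y) - u (\<psi> y) * J (\<psi> y)"
proof -
  let ?e = "(1, 0) :: real \<times> (real^'n::_)" and ?\<nu> = "\<lambda>(t, y). \<nu> t (\<psi> y)"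
  have t0: "0 \<in> I" using \<epsilon> by simp
  have p: "(0, y) \<in> S V \<psi>" by (rule initial_in_S[OF c y])
  obtain b :: "'n \<Rightarrow> 'e" and q where fr: "bij_betw b UNIV (tangent_frame \<A> X (\<psi> y))"
    "\<And>i. dder (q i) (\<lambda>y. X (\<psi> y)) y = b i" "\<And>i j. b i \<bullet> b j = (if i = j then 1 else 0)"
    by (rule tangent_frame_chart[OF atlas c y immersion]) (use that in blast)
  have b: "dder (0, q i) (\<lambda>(t, y). F t (\<psi> y)) (0, y) = b i" for i
    using spatial_derivative_chart[OF F c t0 y] F0 fr(2) by simp
  have dN: "dder (0, w) ?\<nu> (0, y) = dder w (\<lambda>y. N (\<psi> y)) y" for w
    using spatial_derivative_chart[OF \<nu>(1) c t0 y] \<nu>(2) by simp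
  have vel\<nu>: "smooth_map \<A> (velocity \<nu> 0)"
    by (rule smooth_family_slice[OF atlas smooth_family_velocity[OF atlas \<nu>(1) open_greaterThanLessThan]
          open_greaterThanLessThan t0])
  have grad: "surf_grad \<A> X u = (\<lambda>x. - velocity \<nu> 0 x)" using surf_grad_u by auto
  have "smooth_map \<A> (surf_grad \<A> X u)"
    unfolding smooth_map_def grad
  proof safe
    fix W \<xi> assume c': "(W, \<xi>) \<in> \<A>"
    have "smooth_on W (\<lambda>y. (-1) *\<^sub>R velocity \<nu> 0 (\<xi> y))"
      by (rule smooth_on_scaleR[OF atlas_chart(1)[OF atlas c'] smooth_on_const smooth_mapD[OF vel\<nu> c']])
    then show "smooth_on W ((\<lambda>x. - velocity \<nu> 0 x) \<circ> \<xi>)" by (simp add: o_def)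
  qed
  note lap = surf_div_chart[OF atlas c y immersion this fr(1,2)]
  have "dder w (\<lambda>y. surf_grad \<A> X u (\<psi> y)) y = - dder (0, w) (dder ?e ?\<nu>) (0, y)" for w
  proof -
    have "dder w (\<lambda>y. velocity \<nu> 0 (\<psi> y)) y = dder w (\<lambda>y. dder ?e ?\<nu> (0, y)) y"
      by (rule dder_cong[OF atlas_chart(1)[OF atlas c] y velocity_chart[OF \<nu>(1) c t0]])
    also have "\<dots> = dder (0, w) (dder ?e ?\<nu>) (0, y)"
      by (rule dder_slice[OF smooth_on_dder[OF smooth_on_S(2)[OF c]] p])
    finally show ?thesis
      using dder_eqI[OF has_derivative_minus[OF smooth_on_has_derivative[OF smooth_mapD[OF vel\<nu> c] y]], of w]
      by (simp add: grad)
  qed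
  then have lap': "(\<Sum>i\<in>UNIV. dder (0, q i) (dder ?e ?\<nu>) (0, y) \<bullet> b i) = - surf_laplacian \<A> X u (\<psi> y)"
    unfolding surf_laplacian_def lap by (simp add: sum_negf)
  have \<phi>e: "dder ?e (\<lambda>(t, y). \<phi> t (\<psi> y)) (0, y) = velocity \<phi> 0 (\<psi> y)"
    using velocity_chart[OF \<phi> c t0 y] by simp
  have \<nu>e: "dder ?e ?\<nu> (0, y) = - surf_grad \<A> X u (\<psi> y)"
    using surf_grad_chart[OF c y] by simp
  have "dder ?e (dder ?e (logD \<psi>)) (0, y) =
      velocity \<phi> 0 (\<psi> y) * H (\<psi> y) + u (\<psi> y) * (- surf_laplacian \<A> X u (\<psi> y)
       - (second_ff_norm \<A> X N (\<psi> y))\<^sup>2 * u (\<psi> y)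
       + euclid_hess f (X (\<psi> y)) (N (\<psi> y)) (N (\<psi> y)) * u (\<psi> y)
       + euclid_grad f (X (\<psi> y)) \<bullet> (- surf_grad \<A> X u (\<psi> y)))"
    using second_variation_pointwise[OF dim open_S[OF c] smooth_on_S(1,2)[OF c] f \<nu>_unit[OF c] \<nu>_orth[OF c]
        smooth_on_S(3)[OF c] velocity_S[OF c] p b fr(3)]
    unfolding lap' \<phi>e \<nu>e dN second_ff_norm_chart[OF atlas c y immersion N(1) fr(1,2)]
    by (simp add: F0 \<nu>(2) u_def H_def surf_div_chart[OF atlas c y immersion N(1) fr(1,2)])
  then show ?thesis by (simp add: J_def algebra_simps)
qed

lemma first_variation_density:
  assumes c: "(V, \<psi>) \<in> \<A>" and y: "y \<in> V"
  shows "dt (D \<psi>) (0, y)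
    = D \<psi> (0, y) * (u (\<psi> y) * H (\<psi> y))"
    and "dt (logD \<psi>) (0, y) = u (\<psi> y) * H (\<psi> y)"
proof -
  have p: "(0, y) \<in> S V \<psi>" by (rule initial_in_S[OF c y])
  show *: "dt (logD \<psi>) (0, y) = u (\<psi> y) * H (\<psi> y)"
  proof (rule first_variation_chart[OF c open_S[OF c] smooth_on_S(1)[OF c] initial_in_S[OF c] _ smooth_mapD[OF smooth_map_u c] _ y])
    show "(\<lambda>(t, y). F t (\<psi> y)) (0, z) = X (\<psi> z)" for z by (simp add: F0)
    show "dt (\<lambda>(t, y). F t (\<psi> y)) (0, z) = u (\<psi> z) *\<^sub>R N (\<psi> z)" if "z \<in> V" for z
      using velocity_S[OF c initial_in_S[OF c that]] \<nu>(2) by (simp add: u_def)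
  qed
  show "dt (D \<psi>) (0, y)
    = D \<psi> (0, y) * (u (\<psi> y) * H (\<psi> y))"
    unfolding *[symmetric] by (rule dder_weighted_density[OF open_S[OF c] smooth_on_S(1)[OF c] f _ p]) simp
qed

text \<open>\<open>D''\<close> is \<open>D\<close> times the second logarithmic derivative plus the
  square of the first. That square, \<open>(u H)\<^sup>2\<close>, is exactly what the summand
  \<open>u\<^sup>2 H\<close> of \<open>v\<close> contributes to \<open>v H\<close>.\<close>

lemma second_variation_density:
  assumes c: "(V, \<psi>) \<in> \<A>" and y: "y \<in> V"
  shows "dt (dt (D \<psi>)) (0, y)
    = (v (\<psi> y) * H (\<psi> y) - u (\<psi> y) * J (\<psi> y)) * D \<psi> (0, y)"
proof -
  have p: "(0, y) \<in> S V \<psi>" by (rule initial_in_S[OF c y])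
  have "dt (dt (D \<psi>)) (0, y)
      = D \<psi> (0, y) *
        (dt (dt (logD \<psi>)) (0, y)
         + (dt (logD \<psi>) (0, y))\<^sup>2)"
    by (rule dder2_weighted_density[OF open_S[OF c] smooth_on_S(1)[OF c] f _ p]) simp
  then show ?thesis
    unfolding second_variation_log_density[OF c y] first_variation_density(2)[OF c y]
    by (simp add: v_def algebra_simps power2_eq_square)
qed

text \<open>Product rule: the factor \<open>u H\<close> by which the density grows is multiplied by
  the speed \<open>u\<close>. This is the origin of the second summand of \<open>v\<close>.\<close>

lemma volume_density_derivative:
  assumes c: "(V, \<psi>) \<in> \<A>" and y: "y \<in> V"
  shows "dt (\<lambda>p. (case p of (t, y) \<Rightarrow> \<phi> t (\<psi> y)) * D \<psi> p) (0, y)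
    = v (\<psi> y) * D \<psi> (0, y)"
proof -
  have p: "(0, y) \<in> S V \<psi>" by (rule initial_in_S[OF c y])
  have g: "smooth_on (S V \<psi>) (D \<psi>)"
    by (rule smooth_on_weighted_density[OF open_S[OF c] smooth_on_S(1)[OF c] f]) simp
  have \<phi>e: "dt (\<lambda>(t, y). \<phi> t (\<psi> y)) (0, y) = velocity \<phi> 0 (\<psi> y)"
    using velocity_chart[OF \<phi> c _ y, of 0] \<epsilon> by simp
  show ?thesis
    unfolding dder_mult[OF smooth_on_S(3)[OF c] g p] first_variation_density(1)[OF c y] \<phi>e
    by (simp add: v_def u_def algebra_simps power2_eq_square)
qed

text \<open>Read off from the formula for the second derivative of the log density, whose other
  terms are continuous. The terms of \<open>J\<close> are built from arbitrarily chosen tangent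
  frames, so they are not examined one by one.\<close>

lemma continuous_uJ: "continuous_on UNIV (\<lambda>x. u x * J x)"
proof (rule smooth_map_continuous[OF atlas])
  fix V \<psi> assume c: "(V, \<psi>) \<in> \<A>"
  let ?\<Phi> = "\<lambda>(t, y). F t (\<psi> y)"
  have g: "smooth_on (S V \<psi>) (log_density f ?\<Phi>)"
    by (rule smooth_on_log_density[OF open_S[OF c] smooth_on_S(1)[OF c] f]) simp
  have "continuous_on V (\<lambda>y. dt (dt (log_density f ?\<Phi>)) (0, y))"
    by (rule smooth_on_imp_continuous_on, rule smooth_on_slice[OF open_S[OF c] smooth_on_dder[OF smooth_on_dder[OF g]] V[OF c]])
       (rule initial_in_S[OF c])
  moreover have "smooth_map \<A> (velocity \<phi> 0)"
    by (rule smooth_family_slice[OF atlas smooth_family_velocity[OF atlas \<phi>]]) (use \<epsilon> in auto)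
  then have "continuous_on V (\<lambda>y. velocity \<phi> 0 (\<psi> y) * H (\<psi> y))"
    by (intro continuous_on_mult smooth_on_imp_continuous_on smooth_mapD[OF _ c] smooth_map_H)
  ultimately have "continuous_on V (\<lambda>y. velocity \<phi> 0 (\<psi> y) * H (\<psi> y) - dt (dt (log_density f ?\<Phi>)) (0, y))"
    by (intro continuous_on_diff)
  then show "continuous_on V (\<lambda>y. u (\<psi> y) * J (\<psi> y))"
    by (rule continuous_on_eq) (simp add: second_variation_log_density[OF c])
qed

section \<open>Integration over the hypersurface\<close>

lemma indicator_K: "(\<And>x. x \<notin> K \<Longrightarrow> w x = 0) \<Longrightarrow> (\<lambda>x. indicator K x * w x) = (w :: 'm \<Rightarrow> real)"
  by (auto simp: fun_eq_iff indicator_def)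

lemma smooth_map_continuous_UNIV: "smooth_map \<A> (w :: 'm \<Rightarrow> real) \<Longrightarrow> continuous_on UNIV w"
  by (rule smooth_map_continuous[OF atlas]) (rule smooth_on_imp_continuous_on[OF smooth_mapD])

text \<open>The rate of change of weighted volume vanishes for all small times, hence so does its
  time derivative at 0, which is the integral of \<open>v\<close>.\<close>

lemma integral_v: "(\<integral>x. v x \<partial>weighted_area_measure \<A> X f) = 0"
proof -
  obtain m V \<psi> C B where cp: "chart_pieces \<A> K m V \<psi> C B" using chart_pieces_exist[OF atlas K] by blast
  let ?\<Phi> = "\<lambda>i (t, y). F t (\<psi> i y)"
  obtain \<delta> where \<delta>: "\<delta> > 0" "\<delta> \<le> \<epsilon>" "\<And>i. i < m \<Longrightarrow> {-\<delta><..<\<delta>} \<times> C i \<subseteq> S (V i) (\<psi> i)"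
    using uniform_immersion[OF cp F F0 \<epsilon>] by blast
  let ?g = "\<lambda>i p. (case p of (t, y) \<Rightarrow> \<phi> t (\<psi> i y)) * weighted_density f (?\<Phi> i) p"
  let ?G = "\<lambda>t. \<Sum>i<m. \<integral>y. indicator (piece V \<psi> B i) y * ?g i (t, y) \<partial>lborel"
  have t0: "0 \<in> {-\<delta><..<\<delta>}" using \<delta>(1) by auto
  have g: "smooth_on (S (V i) (\<psi> i)) (?g i)" if "i < m" for i
  proof -
    note c = chart_piecesD(1)[OF cp that]
    show ?thesis
      by (rule smooth_on_mult[OF open_S[OF c] smooth_on_S(3)[OF c]
            smooth_on_weighted_density[OF open_S[OF c] smooth_on_S(1)[OF c] f]]) simp
  qed
  have zero: "?G t = 0" if "t \<in> {-\<delta><..<\<delta>}" for t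
  proof -
    have t: "t \<in> I" using that \<delta>(2) by auto
    have sm: "smooth_map \<A> (\<phi> t)" by (rule smooth_family_slice[OF atlas \<phi> open_greaterThanLessThan t])
    have "?G t = (\<integral>x. indicator K x * \<phi> t x \<partial>weighted_area_measure \<A> (F t) f)"
      using weighted_integral_family[OF atlas cp F open_greaterThanLessThan t f smooth_map_continuous_UNIV[OF sm]] by simp
    \<comment> \<open>The volume condition integrates over the whole manifold, the chart pieces only
      over \<open>K\<close>; the speed vanishes elsewhere.\<close>
    also have "\<dots> = 0"
      using volume[OF t] \<phi>_outside[OF t] by (simp add: indicator_K \<phi>_def)
    finally show ?thesis .
  qed
  have "(?G has_real_derivative (\<Sum>i<m. \<integral>y. indicator (piece V \<psi> B i) y * dt (?g i) (0, y) \<partial>lborel)) (at 0)"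
    by (rule leibniz_pieces[OF atlas cp g \<delta>(3) t0])
  moreover have "(?G has_real_derivative 0) (at 0)"
    by (rule has_field_derivative_transform_within_open[OF DERIV_const open_greaterThanLessThan t0]) (rule zero[symmetric])
  ultimately have "(\<Sum>i<m. \<integral>y. indicator (piece V \<psi> B i) y * dt (?g i) (0, y) \<partial>lborel) = 0"
    by (rule DERIV_unique)
  moreover have "(\<Sum>i<m. \<integral>y. indicator (piece V \<psi> B i) y * dt (?g i) (0, y) \<partial>lborel)
      = (\<Sum>i<m. \<integral>y. indicator (piece V \<psi> B i) y * (v (\<psi> i y) * weighted_density f (?\<Phi> i) (0, y)) \<partial>lborel)"
    using volume_density_derivative[OF chart_piecesD(1)[OF cp]]
    by (intro sum.cong refl Bochner_Integration.integral_cong) (auto simp: indicator_def)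
  moreover have "\<dots> = (\<integral>x. indicator K x * v x \<partial>weighted_area_measure \<A> (F 0) f)"
    by (rule weighted_integral_family[OF atlas cp F open_greaterThanLessThan _ f smooth_map_continuous_UNIV[OF smooth_map_v], symmetric])
       (use \<epsilon> in simp)
  ultimately show ?thesis using indicator_K[OF v_outside] F0 by simp
qed

text \<open>Two applications of differentiation under the integral, followed by the pointwise
  formula for the second derivative of the density. Criticality has not entered yet, so the integral
  of \<open>v H\<close> is still present.\<close>

lemma second_variation:
  "has_second_variation \<A> f K F
    ((\<integral>x. v x * H x \<partial>weighted_area_measure \<A> X f) - (\<integral>x. u x * J x \<partial>weighted_area_measure \<A> X f))"
proof -
  obtain m V \<psi> C B where cp: "chart_pieces \<A> K m V \<psi> C B" using chart_pieces_exist[OF atlas K] by blast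
  let ?\<Phi> = "\<lambda>i (t, y). F t (\<psi> i y)"
  let ?g = "\<lambda>i. weighted_density f (?\<Phi> i)"
  let ?L = "\<lambda>h t. \<Sum>i<m. \<integral>y. indicator (piece V \<psi> B i) y * h i (t, y) \<partial>lborel"
  let ?W = "weighted_area_measure \<A> X f"
  obtain \<delta> where \<delta>: "\<delta> > 0" "\<delta> \<le> \<epsilon>" "\<And>i. i < m \<Longrightarrow> {-\<delta><..<\<delta>} \<times> C i \<subseteq> S (V i) (\<psi> i)"
    using uniform_immersion[OF cp F F0 \<epsilon>] by blast
  have t0: "0 \<in> {-\<delta><..<\<delta>}" using \<delta>(1) by auto
  have g: "smooth_on (S (V i) (\<psi> i)) (?g i)" if "i < m" for i
  proof -
    note c = chart_piecesD(1)[OF cp that]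
    show ?thesis by (rule smooth_on_weighted_density[OF open_S[OF c] smooth_on_S(1)[OF c] f]) simp
  qed
  have area: "weighted_area \<A> (F t) f K = ?L ?g t" if "t \<in> {-\<delta><..<\<delta>}" for t
    by (rule weighted_area_family[OF atlas cp F open_greaterThanLessThan _ f]) (use that \<delta>(2) in auto)
  \<comment> \<open>A second derivative at 0 presupposes the first derivative on a whole
    neighbourhood, not only at 0.\<close>
  have d1: "((\<lambda>t. weighted_area \<A> (F t) f K) has_real_derivative ?L (\<lambda>i. dt (?g i)) t) (at t)"
    if "t \<in> {-\<delta><..<\<delta>}" for t
  proof -
    have "(?L ?g has_real_derivative ?L (\<lambda>i. dt (?g i)) t) (at t)"
      by (rule leibniz_pieces[OF atlas cp g \<delta>(3) that])
    then show ?thesis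
      by (rule has_field_derivative_transform_within_open[OF _ open_greaterThanLessThan that]) (rule area[symmetric])
  qed
  have d2: "(?L (\<lambda>i. dt (?g i)) has_real_derivative ?L (\<lambda>i. dt (dt (?g i))) 0) (at 0)"
    by (rule leibniz_pieces[OF atlas cp smooth_on_dder[OF g] \<delta>(3) t0])
  have vH: "continuous_on UNIV (\<lambda>x. v x * H x)"
    by (intro continuous_on_mult smooth_map_continuous_UNIV smooth_map_v smooth_map_H)
  have "?L (\<lambda>i. dt (dt (?g i))) 0
      = (\<Sum>i<m. \<integral>y. indicator (piece V \<psi> B i) y * ((v (\<psi> i y) * H (\<psi> i y) - u (\<psi> i y) * J (\<psi> i y)) * ?g i (0, y)) \<partial>lborel)"
    using second_variation_density[OF chart_piecesD(1)[OF cp]]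
    by (intro sum.cong refl Bochner_Integration.integral_cong) (auto simp: indicator_def)
  also have "\<dots> = (\<integral>x. indicator K x * (v x * H x - u x * J x) \<partial>weighted_area_measure \<A> (F 0) f)"
    by (rule weighted_integral_family[OF atlas cp F open_greaterThanLessThan _ f continuous_on_diff[OF vH continuous_uJ], symmetric])
       (use \<epsilon> in simp)
  also have "\<dots> = (\<integral>x. indicator K x * (v x * H x) - indicator K x * (u x * J x) \<partial>?W)"
    by (simp add: F0 right_diff_distrib)
  \<comment> \<open>Both integrands are continuous, hence integrable over the compact set
    \<open>K\<close>. The indicators are removed only after the split, where \<open>u\<close> and
    \<open>v\<close> vanish outside \<open>K\<close>.\<close>
  also have "\<dots> = (\<integral>x. indicator K x * (v x * H x) \<partial>?W) - (\<integral>x. indicator K x * (u x * J x) \<partial>?W)"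
    by (intro Bochner_Integration.integral_diff weighted_integral_pieces(1)[OF atlas cp X f] vH continuous_uJ)
  also have "\<dots> = (\<integral>x. v x * H x \<partial>?W) - (\<integral>x. u x * J x \<partial>?W)"
    using indicator_K[of "\<lambda>x. v x * H x"] indicator_K[of "\<lambda>x. u x * J x"] v_outside \<phi>_outside[of 0] \<epsilon>
    by (simp add: u_def)
  finally have "?L (\<lambda>i. dt (dt (?g i))) 0 = (\<integral>x. v x * H x \<partial>?W) - (\<integral>x. u x * J x \<partial>?W)" .
  moreover have "\<forall>\<^sub>F s in nhds 0. ((\<lambda>t. weighted_area \<A> (F t) f K) has_real_derivative ?L (\<lambda>i. dt (?g i)) s) (at s)"
    unfolding eventually_nhds using d1 t0 by (intro exI[of _ "{-\<delta><..<\<delta>}"]) auto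
  ultimately show ?thesis
    unfolding has_second_variation_def has_second_real_derivative_def using d2 by auto
qed

end

theorem lemma1p3:
  fixes \<A> :: "('n::{finite,wellorder}, 'm::{t2_space,second_countable_topology}) param set"
    and X N :: "'m \<Rightarrow> 'e::euclidean_space"
    and f :: "'e \<Rightarrow> real"
    and F :: "real \<Rightarrow> 'm \<Rightarrow> 'e"
    and \<epsilon> :: real and K :: "'m set" and u :: "'m \<Rightarrow> real"
  assumes "DIM('e) = CARD('n) + 1"
    and "smooth_atlas \<A>"
    and "proper_immersion \<A> X"
    and "smooth_map \<A> N" and "unit_normal_field \<A> X N"
    and "smooth_on UNIV f"
    and "\<And>v. test_function \<A> v \<Longrightarrow> (\<integral>x. v x \<partial>weighted_area_measure \<A> X f) = 0 \<Longrightarrow>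
           has_first_variation \<A> X N f v 0"
    and "compact_normal_variation \<A> X \<epsilon> K F"
    and "preserves_weighted_volume \<A> N f \<epsilon> F"
    and "\<And>x. u x = velocity F 0 x \<bullet> N x"
  shows "has_second_variation \<A> f K F
    (- (\<integral>x. u x * (surf_laplacian \<A> X u x + (second_ff_norm \<A> X N x)\<^sup>2 * u x
               - euclid_hess f (X x) (N x) (N x) * u x
               + euclid_grad f (X x) \<bullet> surf_grad \<A> X u x)
         \<partial>weighted_area_measure \<A> X f))"
proof -
  obtain \<nu> where \<nu>: "smooth_family \<A> {-\<epsilon><..<\<epsilon>} \<nu>" "\<nu> 0 = N"
    "\<And>t. t \<in> {-\<epsilon><..<\<epsilon>} \<Longrightarrow> unit_normal_field \<A> (F t) (\<nu> t)"
    "\<And>t. t \<in> {-\<epsilon><..<\<epsilon>} \<Longrightarrow> (\<integral>x. velocity F t x \<bullet> \<nu> t x \<partial>weighted_area_measure \<A> (F t) f) = 0"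
    using assms(9) unfolding preserves_weighted_volume_def by blast
  interpret P: preserving_variation \<A> X N f \<epsilon> K F \<nu>
    by standard (use assms(1-8) \<nu> in \<open>auto simp: proper_immersion_def\<close>)
  let ?W = "weighted_area_measure \<A> X f"
  have u: "P.u = u" using assms(10) \<nu>(2) by (auto simp: P.u_def P.\<phi>_def)
  have "test_function \<A> P.v"
    using P.smooth_map_v P.K P.v_outside by (auto simp: test_function_def)
  \<comment> \<open>Criticality is applied to \<open>v\<close>, not to \<open>u\<close>. It yields
    some variation \<open>F'\<close> with initial normal speed \<open>v\<close> along which the area
    has derivative 0.\<close>
  then have "has_first_variation \<A> X N f P.v 0" by (rule assms(7)) (rule P.integral_v)
  then obtain \<epsilon>' K' F' where F': "compact_normal_variation \<A> X \<epsilon>' K' F'" "\<And>x. velocity F' 0 x \<bullet> N x = P.v x"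
    "((\<lambda>t. weighted_area \<A> (F' t) f K') has_real_derivative 0) (at 0)"
    unfolding has_first_variation_def by blast
  \<comment> \<open>The first variation formula computes the same derivative along
    \<open>F'\<close>, and derivatives are unique.\<close>
  have "(\<integral>x. indicator K' x * (P.v x * P.H x) \<partial>?W) = 0"
    using P.first_variation[OF F'(1)] F'(3) unfolding F'(2) by (rule DERIV_unique)
  \<comment> \<open>The compact set \<open>K'\<close> belongs to \<open>F'\<close> and is unrelated
    to \<open>K\<close>; outside it \<open>F'\<close> stands still, so its normal speed
    \<open>v\<close> is zero there.\<close>
  moreover have "(\<lambda>x. indicator K' x * (P.v x * P.H x)) = (\<lambda>x. P.v x * P.H x)"
  proof -
    have "P.v x = 0" if "x \<notin> K'" for x
    proof -
      have "0 < \<epsilon>'" "\<And>t. t \<in> {-\<epsilon>'<..<\<epsilon>'} \<Longrightarrow> F' t x = X x"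
        using F'(1) that by (auto simp: compact_normal_variation_def)
      then have "((\<lambda>s. F' s x) has_vector_derivative 0) (at 0)"
        by (intro has_vector_derivative_transform_within_open[OF has_vector_derivative_const[of "X x"] open_greaterThanLessThan[of "-\<epsilon>'" \<epsilon>']]) auto
      then have "velocity F' 0 x = 0" unfolding velocity_def by (rule vector_derivative_at)
      then show ?thesis using F'(2)[of x] by simp
    qed
    then show ?thesis by (auto simp: fun_eq_iff indicator_def)
  qed
  ultimately have "(\<integral>x. P.v x * P.H x \<partial>?W) = 0" by simp
  then show ?thesis using P.second_variation by (simp add: P.J_def u)
qed

end
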